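(* Let $n\ge1$, $\varepsilon>0$, and $\varepsilon_0^d(n)=\frac{2^{n/2}}{2^n-1}\,n\log2$. If $\varepsilon<\varepsilon_0^d(n)$, then $$ \boldsymbol{B}^n_\varepsilon(x)=B_{2^{-n},\varepsilon}(x)\quad\text{for all } x\in\Omega_\varepsilon. $$ If $\varepsilon\ge\varepsilon_0^d(n)$, then $$ \boldsymbol{B}_\varepsilon^n(x)= \begin{cases} e^{x_1},& x\in\Gamma_0,\\ \infty,&x\in\Omega_\varepsilon\setminus\Gamma_0. \end{cases} $$
   Context: $\Omega_\varepsilon=\{x=(x_1,x_2)\in\mathbb{R}^2:\ x_1^2\le x_2\le x_1^2+\varepsilon^2\}$, $\Gamma_0=\{x:\ x_2=x_1^2\}$. Bellman function: fix a dyadic cube $Q\subset\mathbb{R}^n$; write $\langle\varphi\rangle_J=\frac1{|J|}\int_J\varphi$ and let $\mathrm{BMO}^d_\varepsilon(Q)$ be the set of real $\varphi\in L^1(Q)$ with $\sup_{J}\big(\langle|\varphi-\langle\varphi\rangle_J|^2\rangle_J\big)^{1/2}\le\varepsilon$, the supremum being over all dyadic subcubes $J$ of $Q$ (including $Q$). For $x\in\Omega_\varepsilon$, $$\boldsymbol{B}^n_{\varepsilon}(x)=\sup_{\varphi\in \mathrm{BMO}^d_{\varepsilon}(Q)}\left\{\langle e^\varphi\rangle_Q:\ \langle\varphi\rangle_Q=x_1,\ \langle\varphi^2\rangle_Q=x_2\right\};$$ this does not depend on $Q$. The function $B_{\alpha,\varepsilon}$: for $\alpha\in(0,\frac12]$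 let $\varepsilon_0^\alpha=\frac{\sqrt\alpha}{1-\alpha}\log(1/\alpha)$ (so $\varepsilon_0^{2^{-n}}=\varepsilon_0^d(n)$) and $K(\alpha,\varepsilon)=\frac{1-\alpha}{e^{\sqrt\alpha\varepsilon}-\alpha e^{\varepsilon/\sqrt\alpha}}$. For $\varepsilon\in(0,\varepsilon_0^\alpha)$ let $\delta(\alpha,\varepsilon)$ be the unique solution $\delta$ of $$\frac{1-\sqrt{\delta^2-\varepsilon^2}}{1-\delta}\,e^{-\delta+\sqrt{\delta^2-\varepsilon^2}}=K(\alpha,\varepsilon)$$ satisfying $\varepsilon<\delta<\min\{1,\frac{1+\alpha}{2\sqrt\alpha}\varepsilon\}$ (it exists and is unique). With $\delta=\delta(\alpha,\varepsilon)$, $$B_{\alpha,\varepsilon}(x)=\frac{e^{-\delta}}{1-\delta}\,e^{x_1+r(x)}(1-r(x)),\qquad r(x)=\sqrt{\delta^2-x_2+x_1^2},\qquad x\in\Omega_\varepsilon.$$ *)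

theory Defs
  imports "HOL-Analysis.Analysis"
begin

definition Omega :: "real \<Rightarrow> (real \<times> real) set" where
  "Omega \<epsilon> = {(x1, x2). x1\<^sup>2 \<le> x2 \<and> x2 \<le> x1\<^sup>2 + \<epsilon>\<^sup>2}"

definition Gamma0 :: "(real \<times> real) set" where
  "Gamma0 = {(x1, x2). x2 = x1\<^sup>2}"

text \<open>Dyadic cubes are half-open, so that the dyadic cubes contained in a dyadic cube are
  exactly those obtained from it by repeated bisection of its edges.\<close>

definition dyadic_cube :: "(real ^ 'n) set \<Rightarrow> bool" where
  "dyadic_cube J \<longleftrightarrow> (\<exists>(m::int) (k::'n \<Rightarrow> int).
     J = {t. \<forall>i. of_int (k i) * 2 powi (- m) \<le> t $ i \<and> t $ i < (of_int (k i) + 1) * 2 powi (- m)})"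

definition dyadic_subcubes :: "(real ^ 'n) set \<Rightarrow> (real ^ 'n) set set" where
  "dyadic_subcubes Q = {J. dyadic_cube J \<and> J \<subseteq> Q}"

definition avg :: "(real ^ 'n) set \<Rightarrow> (real ^ 'n \<Rightarrow> real) \<Rightarrow> real" where
  "avg J \<phi> = (LINT t:J|lebesgue. \<phi> t) / measure lebesgue J"

text \<open>Averages of nonnegative functions, with the value infinity when the integral diverges
  (whereas the Bochner integral in \<^const>\<open>avg\<close> is then 0 by convention).\<close>

definition nn_avg :: "(real ^ 'n) set \<Rightarrow> (real ^ 'n \<Rightarrow> real) \<Rightarrow> ennreal" where
  "nn_avg J f = (\<integral>\<^sup>+t\<in>J. ennreal (f t) \<partial>lebesgue) / emeasure lebesgue J"

definition mean_osc :: "(real ^ 'n) set \<Rightarrow> (real ^ 'n \<Rightarrow> real) \<Rightarrow> ereal" where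
  "mean_osc J \<phi> =
     (let v = nn_avg J (\<lambda>t. \<bar>\<phi> t - avg J \<phi>\<bar>\<^sup>2)
      in if v = \<infinity> then \<infinity> else ereal (sqrt (enn2real v)))"

definition BMO_d :: "(real ^ 'n) set \<Rightarrow> real \<Rightarrow> (real ^ 'n \<Rightarrow> real) set" where
  "BMO_d Q \<epsilon> = {\<phi>. set_integrable lebesgue Q \<phi> \<and>
      (SUP J\<in>dyadic_subcubes Q. mean_osc J \<phi>) \<le> ereal \<epsilon>}"

text \<open>Members of \<^const>\<open>BMO_d\<close> are square integrable on \<open>Q\<close>, so the Bochner average of
  \<open>\<phi>\<^sup>2\<close> is the genuine one; the average of \<open>exp \<circ> \<phi>\<close> may be infinite.\<close>

definition bellman :: "(real ^ 'n) set \<Rightarrow> real \<Rightarrow> real \<times> real \<Rightarrow> ereal" where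
  "bellman Q \<epsilon> x =
     Sup {enn2ereal (nn_avg Q (\<lambda>t. exp (\<phi> t))) | \<phi>.
            \<phi> \<in> BMO_d Q \<epsilon> \<and> avg Q \<phi> = fst x \<and> avg Q (\<lambda>t. (\<phi> t)\<^sup>2) = snd x}"

definition eps0_d :: "nat \<Rightarrow> real" where
  "eps0_d n = 2 powr (real n / 2) / (2 ^ n - 1) * real n * ln 2"

definition K_const :: "real \<Rightarrow> real \<Rightarrow> real" where
  "K_const \<alpha> \<epsilon> = (1 - \<alpha>) / (exp (sqrt \<alpha> * \<epsilon>) - \<alpha> * exp (\<epsilon> / sqrt \<alpha>))"

text \<open>Meaningful for \<open>0 < \<alpha> \<le> 1/2\<close> and
  \<open>0 < \<epsilon> < sqrt \<alpha> / (1 - \<alpha>) * ln (1 / \<alpha>)\<close>, where the solution exists and is unique;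
  for \<open>\<alpha> = 1 / 2 ^ n\<close> this upper bound is \<open>eps0_d n\<close>.\<close>

definition delta :: "real \<Rightarrow> real \<Rightarrow> real" where
  "delta \<alpha> \<epsilon> = (THE \<delta>. \<epsilon> < \<delta> \<and> \<delta> < min 1 ((1 + \<alpha>) / (2 * sqrt \<alpha>) * \<epsilon>) \<and>
     (1 - sqrt (\<delta>\<^sup>2 - \<epsilon>\<^sup>2)) / (1 - \<delta>) * exp (- \<delta> + sqrt (\<delta>\<^sup>2 - \<epsilon>\<^sup>2)) = K_const \<alpha> \<epsilon>)"

definition B_fun :: "real \<Rightarrow> real \<Rightarrow> real \<times> real \<Rightarrow> real" where
  "B_fun \<alpha> \<epsilon> x =
     (let \<delta> = delta \<alpha> \<epsilon>; r = sqrt (\<delta>\<^sup>2 - snd x + (fst x)\<^sup>2)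
      in exp (- \<delta>) / (1 - \<delta>) * exp (fst x + r) * (1 - r))"

end

theory Submission
  imports Defs
begin

text \<open>Write \<open>\<alpha> = 2\<^sup>-\<^sup>n\<close> and \<open>r(x) = sqrt (\<delta>\<^sup>2 - x2 + x1\<^sup>2)\<close>; up to a constant the candidate is
  \<open>exp (x1 + r) * (1 - r)\<close>. It lies below its tangent plane at \<open>x\<close> at every point \<open>y\<close> with
  \<open>y1 - x1 \<le> r(x) + r(y)\<close>, which gives concavity along segments on which the variance
  \<open>x2 - x1\<^sup>2\<close> stays below \<open>\<delta>\<^sup>2\<close>. For the remaining two-point splittings, with weight
  at least \<open>\<alpha>\<close> on the right end point, sliding points along the segment reduces the claim to weight
  exactly \<open>\<alpha>\<close> with the average on the upper boundary of \<open>\<Omega>\<close>. There a unimodality argument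
  leaves the single extremal splitting whose equality case is the equation for \<open>\<delta>\<close>. A splitting
  into \<open>2\<^sup>n\<close> children is reduced to two-point splittings by removing points one at a time, so
  induction over the generations and Fatou's lemma give the upper bound. Conversely, on the upper
  boundary one child is put on the upper boundary again and the others on the lower one: this sums
  a geometric series of ratio \<open>\<alpha> exp ((1 - \<alpha>) \<epsilon> / sqrt \<alpha>)\<close>, which diverges exactly when
  \<open>\<epsilon> \<ge> \<epsilon>\<^sub>0\<close>. Other points are reached along segments (extremal tangents in the finite
  case, vertical ones in the infinite case) by base-\<open>2\<^sup>n\<close> digit splitting.\<close>

section \<open>Concavity of the candidate\<close>

text \<open>The obstacle is that \<open>Omega\<close> is not convex. The candidate is the Bellman
  function of non-dyadic BMO with \<delta> in place of \<epsilon>. Dyadic splittings can jump across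
  the wider strip of variance at most \<delta>^2; only their weights, all at least \<alpha>, limit
  the jump, and \<delta> is the parameter for which the worst jump gives equality. In that jump the
  average and the right end, of weight \<alpha>, are on the upper boundary and the left end is on
  the lower one, so the gap D satisfies \<open>\<alpha> * \<epsilon>^2 + \<alpha> * (1 - \<alpha>) *
  D^2 = \<epsilon>^2\<close>, that is, \<open>D = \<epsilon> / sqrt \<alpha>\<close>. If
  \<open>M * exp c\<close> is the value at the upper boundary over c, then \<open>M = \<alpha> * exp
  ((1 - \<alpha>) * D) * M + (1 - \<alpha>) * exp (- \<alpha> * D)\<close>. Inserting the candidate,
  \<open>M = exp (r0 - \<delta>) * (1 - r0) / (1 - \<delta>)\<close> with
  \<open>r0 = sqrt (\<delta>^2 - \<epsilon>^2)\<close>, gives the equation for \<delta>. At the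
  upper limit \<open>(1 + \<alpha>) / (2 * sqrt \<alpha>) * \<epsilon>\<close> one has
  \<open>(1 - \<alpha>) * D = 2 * r0\<close>: the jump would only touch the edge of the wider strip,
  and local concavity would already cover it.\<close>

lemma exp_third_order_le:
  fixes s :: real
  assumes "s \<ge> 0"
  shows "exp s - 1 - s - s\<^sup>2 / 2 \<le> s / 2 * (exp s - 1 - s)"
proof -
  define f where "f = (\<lambda>s::real. s / 2 * (exp s - 1 - s) - (exp s - 1 - s - s\<^sup>2 / 2))"
  define g where "g = (\<lambda>s::real. (exp s - 1 - s) / 2 + s / 2 * (exp s - 1) - (exp s - 1 - s))"
  have g0: "g 0 \<le> g x" if "x \<ge> 0" for x
  proof (rule DERIV_nonneg_imp_nondecreasing[OF that])
    fix y :: real assume "0 \<le> y" "y \<le> x"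
    have "(g has_real_derivative (y / 2 * exp y)) (at y)"
      unfolding g_def by (auto intro!: derivative_eq_intros simp: field_simps)
    moreover have "y / 2 * exp y \<ge> 0" using \<open>0 \<le> y\<close> by simp
    ultimately show "\<exists>z. DERIV g y :> z \<and> 0 \<le> z" by blast
  qed
  have "f 0 \<le> f s"
  proof (rule DERIV_nonneg_imp_nondecreasing[OF assms])
    fix y :: real assume "0 \<le> y" "y \<le> s"
    have "(f has_real_derivative g y) (at y)"
      unfolding f_def g_def by (auto intro!: derivative_eq_intros simp: field_simps power2_eq_square)
    moreover have "g y \<ge> 0" using g0[OF \<open>0 \<le> y\<close>] by (simp add: g_def)
    ultimately show "\<exists>z. DERIV f y :> z \<and> 0 \<le> z" by blast
  qed
  then show ?thesis by (simp add: f_def)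
qed

lemma exp_le_second_order: 
  fixes s :: real
  assumes "s \<le> 0"
  shows "exp s \<le> 1 + s + s\<^sup>2 / 2"
proof -
  define f where "f = (\<lambda>s::real. 1 + s + s\<^sup>2 / 2 - exp s)"
  have "f s \<ge> f 0"
  proof (rule DERIV_nonpos_imp_nonincreasing[OF assms])
    fix y :: real assume "s \<le> y" "y \<le> 0"
    have "(f has_real_derivative (1 + y - exp y)) (at y)"
      unfolding f_def by (auto intro!: derivative_eq_intros simp: field_simps)
    moreover have "1 + y - exp y \<le> 0" using exp_ge_add_one_self[of y] by linarith
    ultimately show "\<exists>z. DERIV f y :> z \<and> z \<le> 0" by blast
  qed
  then show ?thesis by (simp add: f_def)
qed

text \<open>Collecting the terms with \<rho> leaves
  \<open>exp s - 1 - s - s^2 / 2 \<le> \<rho> * (exp s - 1 - s)\<close>. The factor of \<rho> is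
  nonnegative, so for \<open>s \<ge> 0\<close> the worst case is \<open>\<rho> = s / 2\<close>,
  which is \<open>exp_third_order_le\<close>. For negative s the left-hand side is at most
  0.\<close>

lemma exp_tangent_bound:
  fixes s \<rho> :: real
  assumes "\<rho> \<ge> 0" "s \<le> 2 * \<rho>"
  shows "exp s * (1 - \<rho>) \<le> 1 + s + s\<^sup>2 / 2 - \<rho> * (1 + s)"
proof -
  have pos: "exp s - 1 - s \<ge> 0" using exp_ge_add_one_self[of s] by linarith
  have "exp s - 1 - s - s\<^sup>2 / 2 \<le> \<rho> * (exp s - 1 - s)"
  proof (cases "s \<ge> 0")
    case True
    have "s / 2 * (exp s - 1 - s) \<le> \<rho> * (exp s - 1 - s)"
      using assms pos by (intro mult_right_mono) auto
    then show ?thesis using exp_third_order_le[OF True] by linarith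
  next
    case False
    then show ?thesis using exp_le_second_order[of s] pos assms mult_nonneg_nonneg[of \<rho> "exp s - 1 - s"] by linarith
  qed
  then show ?thesis by (simp add: algebra_simps)
qed

text \<open>The right-hand side is the tangent plane of the Bellman function at the point with
  coordinates \<open>(0, r)\<close>, evaluated at \<open>(\<Delta>, \<rho>)\<close>, where the second
  coordinate is \<open>sqrt (\<delta>\<^sup>2 - x2 + x1\<^sup>2)\<close>.\<close>

lemma tangent_plane_bound:
  fixes \<Delta> r \<rho> :: real
  assumes "\<rho> \<ge> 0" "\<Delta> \<le> r + \<rho>"
  shows "exp (\<Delta> + \<rho>) * (1 - \<rho>) \<le> exp r * ((1 - r) * (1 + \<Delta>) + \<Delta>\<^sup>2 / 2 + (r\<^sup>2 - \<rho>\<^sup>2) / 2)"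
proof -
  \<comment> \<open>The quotient of the two exponentials in the claim is \<open>exp s\<close>, and
    the hypothesis on \<Delta> says exactly \<open>s \<le> 2 * \<rho>\<close>.\<close>
  define s where "s = \<Delta> - r + \<rho>"
  have "exp s * (1 - \<rho>) \<le> 1 + s + s\<^sup>2 / 2 - \<rho> * (1 + s)"
    by (rule exp_tangent_bound) (use assms in \<open>auto simp: s_def\<close>)
  also have "\<dots> = (1 - r) * (1 + \<Delta>) + \<Delta>\<^sup>2 / 2 + (r\<^sup>2 - \<rho>\<^sup>2) / 2"
    by (simp add: s_def power2_eq_square field_simps)
  finally have "exp r * (exp s * (1 - \<rho>)) \<le> exp r * \<dots>"
    by (intro mult_left_mono) auto
  moreover have "exp r * exp s = exp (\<Delta> + \<rho>)"
    by (simp add: s_def flip: exp_add)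
  ultimately show ?thesis by (simp add: mult.assoc[symmetric])
qed

text \<open>Shifting all first coordinates by w at fixed variance multiplies the candidate by
  \<open>exp w\<close>. Two-point inequalities are proved with a normalised first coordinate and
  then moved into place by this rule.\<close>

lemma exp_scale_le:
  fixes w p q r :: real
  assumes "b * (exp p * A) + c * (exp q * B) \<le> exp r * C"
  shows "b * (exp (w + p) * A) + c * (exp (w + q) * B) \<le> exp (w + r) * C"
  using mult_left_mono[OF assms, of "exp w"] by (simp add: exp_add algebra_simps)

text \<open>Both ends are compared with the tangent plane at the average. The plane is affine in
  \<open>(x1, x2)\<close>, so the weighted sum of the bounds is its value at the average. Only the
  right end needs a closeness hypothesis: for the left one the horizontal displacement is at most
  0.\<close>

lemma two_point_close:
  fixes \<beta> d r a b :: real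
  assumes "0 \<le> \<beta>" "\<beta> \<le> 1" "d \<ge> 0" "r \<ge> 0" "a \<ge> 0" "b \<ge> 0"
    and r: "r\<^sup>2 = \<beta> * a\<^sup>2 + (1 - \<beta>) * b\<^sup>2 - \<beta> * (1 - \<beta>) * d\<^sup>2"
    and close: "(1 - \<beta>) * d \<le> r + a"
  shows "\<beta> * (exp ((1 - \<beta>) * d + a) * (1 - a)) + (1 - \<beta>) * (exp (- \<beta> * d + b) * (1 - b))
    \<le> exp r * (1 - r)"
proof -
  define y where "y = (1 - r) * (1 + (1 - \<beta>) * d) + ((1 - \<beta>) * d)\<^sup>2 / 2 + (r\<^sup>2 - a\<^sup>2) / 2"
  define z where "z = (1 - r) * (1 + (- \<beta> * d)) + (- \<beta> * d)\<^sup>2 / 2 + (r\<^sup>2 - b\<^sup>2) / 2"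
  have "exp ((1 - \<beta>) * d + a) * (1 - a) \<le> exp r * y"
    unfolding y_def by (rule tangent_plane_bound) (use assms in auto)
  moreover have "exp (- \<beta> * d + b) * (1 - b) \<le> exp r * z"
    unfolding z_def
  proof (rule tangent_plane_bound)
    have "\<beta> * d \<ge> 0" using assms by simp
    then show "- \<beta> * d \<le> r + b" using assms(4,6) by linarith
  qed (use assms in auto)
  ultimately have "\<beta> * (exp ((1 - \<beta>) * d + a) * (1 - a)) + (1 - \<beta>) * (exp (- \<beta> * d + b) * (1 - b))
      \<le> \<beta> * (exp r * y) + (1 - \<beta>) * (exp r * z)"
    using assms by (intro add_mono mult_left_mono) auto
  also have "\<dots> = exp r * (\<beta> * y + (1 - \<beta>) * z)" by (simp add: algebra_simps)
  also have "\<beta> * y + (1 - \<beta>) * z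
      = (1 - r) + (r\<^sup>2 - (\<beta> * a\<^sup>2 + (1 - \<beta>) * b\<^sup>2 - \<beta> * (1 - \<beta>) * d\<^sup>2)) / 2"
    by (simp add: y_def z_def power2_eq_square field_simps)
  also have "\<dots> = 1 - r" using r by simp
  finally show ?thesis .
qed

section \<open>The candidate along a segment\<close>

definition seg_sq :: "real \<Rightarrow> real \<Rightarrow> real \<Rightarrow> real \<Rightarrow> real" where
  "seg_sq a b d t = t * a\<^sup>2 + (1 - t) * b\<^sup>2 - t * (1 - t) * d\<^sup>2"

text \<open>Take a segment of horizontal extent d whose right end (parameter 1) and left end
  (parameter 0) have the values a and b of \<open>sqrt (\<delta>^2 - x2 + x1^2)\<close>. Then
  \<open>seg_sq\<close> is the square of this quantity at parameter t, negative where the segment is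
  outside the wider strip, and \<open>seg_val\<close> is the candidate there, with the left end at
  first coordinate 0.\<close>

definition seg_val :: "real \<Rightarrow> real \<Rightarrow> real \<Rightarrow> real \<Rightarrow> real" where
  "seg_val a b d t = exp (t * d + sqrt (seg_sq a b d t)) * (1 - sqrt (seg_sq a b d t))"

lemma seg_sq_convex_comb:
  "seg_sq a b d ((1 - \<theta>) * s + \<theta> * t) =
    (1 - \<theta>) * seg_sq a b d s + \<theta> * seg_sq a b d t - \<theta> * (1 - \<theta>) * ((t - s) * d)\<^sup>2"
  by (simp add: seg_sq_def power2_eq_square algebra_simps)

text \<open>Let L be the length on the left and p, q the two roots. The point dividing the stretch
  in the ratio p : q has \<open>seg_sq\<close> equal to
  \<open>p * q * (1 - (L / (p + q))^2)\<close>, which is negative if L exceeds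
  \<open>p + q\<close>.\<close>

lemma seg_close:
  assumes "d \<ge> 0" "s \<le> t" and nn: "\<And>\<tau>. s \<le> \<tau> \<Longrightarrow> \<tau> \<le> t \<Longrightarrow> seg_sq a b d \<tau> \<ge> 0"
  shows "(t - s) * d \<le> sqrt (seg_sq a b d s) + sqrt (seg_sq a b d t)"
proof (rule ccontr)
  define p where "p = sqrt (seg_sq a b d s)"
  define q where "q = sqrt (seg_sq a b d t)"
  assume "\<not> ?thesis"
  then have far: "p + q < (t - s) * d" by (simp add: p_def q_def)
  have p: "p \<ge> 0" "p\<^sup>2 = seg_sq a b d s" and q: "q \<ge> 0" "q\<^sup>2 = seg_sq a b d t"
    using nn[of s] nn[of t] assms by (auto simp: p_def q_def)
  \<comment> \<open>If p or q vanishes, the dividing point gives no strict inequality. Both are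
    therefore enlarged by e, which is small enough to keep \<open>P + Q\<close> below the
    length.\<close>
  define e where "e = ((t - s) * d - p - q) / 4"
  have e: "e > 0" "p + q + 2 * e < (t - s) * d" using far by (auto simp: e_def field_simps)
  define P where "P = p + e"
  define Q where "Q = q + e"
  define \<theta> where "\<theta> = P / (P + Q)"
  have PQ: "P > 0" "Q > 0" "P + Q < (t - s) * d" using p q e by (auto simp: P_def Q_def)
  have l: "0 \<le> \<theta>" "\<theta> \<le> 1" using PQ by (auto simp: \<theta>_def)
  have l1: "1 - \<theta> = Q / (P + Q)" using PQ by (simp add: \<theta>_def field_simps)
  have "0 \<le> seg_sq a b d ((1 - \<theta>) * s + \<theta> * t)"
  proof (rule nn)
    show "s \<le> (1 - \<theta>) * s + \<theta> * t"
      using mult_left_mono[OF \<open>s \<le> t\<close> l(1)] by (simp add: algebra_simps)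
    show "(1 - \<theta>) * s + \<theta> * t \<le> t"
      using mult_left_mono[OF \<open>s \<le> t\<close>, of "1 - \<theta>"] l by (simp add: algebra_simps)
  qed
  also have "\<dots> = (1 - \<theta>) * p\<^sup>2 + \<theta> * q\<^sup>2 - \<theta> * (1 - \<theta>) * ((t - s) * d)\<^sup>2"
    by (simp add: seg_sq_convex_comb p q)
  also have "\<dots> < (1 - \<theta>) * P\<^sup>2 + \<theta> * Q\<^sup>2 - \<theta> * (1 - \<theta>) * (P + Q)\<^sup>2"
  proof -
    have "\<theta> > 0" "1 - \<theta> > 0" unfolding l1 using PQ by (auto simp: \<theta>_def)
    moreover have "(P + Q)\<^sup>2 < ((t - s) * d)\<^sup>2" using PQ by (intro power_strict_mono) auto
    moreover have "p\<^sup>2 \<le> P\<^sup>2" "q\<^sup>2 \<le> Q\<^sup>2" unfolding P_def Q_def using p(1) q(1) e(1) by (auto intro!: power_mono simp del: p(2) q(2))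
    ultimately have "\<theta> * (1 - \<theta>) * (P + Q)\<^sup>2 < \<theta> * (1 - \<theta>) * ((t - s) * d)\<^sup>2"
        "(1 - \<theta>) * p\<^sup>2 \<le> (1 - \<theta>) * P\<^sup>2" "\<theta> * q\<^sup>2 \<le> \<theta> * Q\<^sup>2"
      by auto
    then show ?thesis by linarith
  qed
  also have "\<dots> = 0"
    unfolding l1 unfolding \<theta>_def using PQ by (simp add: field_simps power2_eq_square)
  finally show False by simp
qed

text \<open>On a stretch inside the wider strip any two points are close by
  \<open>seg_close\<close>, so \<open>two_point_close\<close> applies to every convex combination.
  This avoids second derivatives of \<open>seg_val\<close>, whose square root degenerates where
  \<open>seg_sq\<close> vanishes.\<close>

lemma seg_val_concave:
  assumes "d \<ge> 0" "s \<le> t" "0 \<le> \<theta>" "\<theta> \<le> 1"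
    and nn: "\<And>\<tau>. s \<le> \<tau> \<Longrightarrow> \<tau> \<le> t \<Longrightarrow> seg_sq a b d \<tau> \<ge> 0"
  shows "(1 - \<theta>) * seg_val a b d s + \<theta> * seg_val a b d t \<le> seg_val a b d ((1 - \<theta>) * s + \<theta> * t)"
proof -
  define u where "u = (1 - \<theta>) * s + \<theta> * t"
  define D where "D = (t - s) * d"
  let ?R = "\<lambda>\<tau>. sqrt (seg_sq a b d \<tau>)"
  have su: "s \<le> u"
    using mult_left_mono[OF \<open>s \<le> t\<close> \<open>0 \<le> \<theta>\<close>] by (simp add: u_def algebra_simps)
  have ut: "u \<le> t"
    using mult_left_mono[OF \<open>s \<le> t\<close>, of "1 - \<theta>"] assms by (simp add: u_def algebra_simps)
  have close: "(1 - \<theta>) * D \<le> ?R u + ?R t"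
    using seg_close[of d u t a b] nn assms su ut by (simp add: u_def D_def algebra_simps)
  have "\<theta> * (exp ((1 - \<theta>) * D + ?R t) * (1 - ?R t)) + (1 - \<theta>) * (exp (- \<theta> * D + ?R s) * (1 - ?R s))
     \<le> exp (?R u) * (1 - ?R u)"
  proof (rule two_point_close)
    show "(?R u)\<^sup>2 = \<theta> * (?R t)\<^sup>2 + (1 - \<theta>) * (?R s)\<^sup>2 - \<theta> * (1 - \<theta>) * D\<^sup>2"
    proof -
      have "(?R u)\<^sup>2 = seg_sq a b d u" "(?R s)\<^sup>2 = seg_sq a b d s" "(?R t)\<^sup>2 = seg_sq a b d t"
        using nn su ut by auto
      then show ?thesis using seg_sq_convex_comb[of a b d \<theta> s t] by (simp add: D_def u_def)
    qed
  qed (use assms nn su ut close in \<open>auto simp: D_def\<close>)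
  from exp_scale_le[OF this, of "u * d"] show ?thesis
    by (simp add: seg_val_def u_def D_def algebra_simps)
qed

section \<open>Two-point inequality for splittings that leave the wider strip\<close>

lemma exp_one_minus_antimono:
  fixes s t :: real
  assumes "0 \<le> s" "s \<le> t"
  shows "exp t * (1 - t) \<le> exp s * (1 - s)"
proof (rule DERIV_nonpos_imp_nonincreasing[OF \<open>s \<le> t\<close>])
  fix y assume "s \<le> y" "y \<le> t"
  have "((\<lambda>t::real. exp t * (1 - t)) has_real_derivative (- y * exp y)) (at y)"
    by (auto intro!: derivative_eq_intros simp: field_simps)
  moreover have "- y * exp y \<le> 0" using assms \<open>s \<le> y\<close> by simp
  ultimately show "\<exists>z. ((\<lambda>t::real. exp t * (1 - t)) has_real_derivative z) (at y) \<and> z \<le> 0" by blast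
qed

lemma exp_one_minus_mono:
  fixes s t :: real
  assumes "t \<le> 0" "s \<le> t"
  shows "exp s * (1 - s) \<le> exp t * (1 - t)"
proof (rule DERIV_nonneg_imp_nondecreasing[OF \<open>s \<le> t\<close>])
  fix y assume "s \<le> y" "y \<le> t"
  have "((\<lambda>t::real. exp t * (1 - t)) has_real_derivative (- y * exp y)) (at y)"
    by (auto intro!: derivative_eq_intros simp: field_simps)
  moreover have "- y * exp y \<ge> 0" using assms \<open>y \<le> t\<close> by (intro mult_nonneg_nonneg) auto
  ultimately show "\<exists>z. ((\<lambda>t::real. exp t * (1 - t)) has_real_derivative z) (at y) \<and> 0 \<le> z" by blast
qed

lemma DERIV_exp_one_minus:
  fixes k :: real
  assumes "(S has_real_derivative s') (at x)"
  shows "((\<lambda>x. exp (k * x + S x) * (1 - S x)) has_real_derivative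
    exp (k * x + S x) * (k * (1 - S x) - s' * S x)) (at x)"
  using assms by (auto intro!: derivative_eq_intros simp: algebra_simps)

text \<open>\<open>K\<close> is the equation for \<delta> cleared of denominators. It is equality in
  the two-point inequality for the gap \<open>\<epsilon> / sqrt \<alpha>\<close>, with the average
  and the right end at root \<open>r0\<close> (upper boundary) and the left end at root \<delta>
  (lower boundary). The second bound on \<delta> is weaker than the one in
  \<open>delta\<close>.\<close>

locale bellman_data =
  fixes \<alpha> \<epsilon> \<delta> r0 :: real
  assumes \<alpha>: "0 < \<alpha>" "\<alpha> \<le> 1 / 2"
    and \<epsilon>: "0 < \<epsilon>" "\<epsilon> < \<delta>"
    and \<delta>: "\<delta> < 1" "\<delta> \<le> \<epsilon> / sqrt \<alpha>"
    and r0: "r0 = sqrt (\<delta>\<^sup>2 - \<epsilon>\<^sup>2)"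
    and K: "exp r0 * (1 - r0) = \<alpha> * (exp ((1 - \<alpha>) * (\<epsilon> / sqrt \<alpha>) + r0) * (1 - r0))
      + (1 - \<alpha>) * (exp (- \<alpha> * (\<epsilon> / sqrt \<alpha>) + \<delta>) * (1 - \<delta>))"
begin

lemma r0_sq: "r0\<^sup>2 = \<delta>\<^sup>2 - \<epsilon>\<^sup>2" and r0_pos: "0 < r0" and r0_less: "r0 < \<delta>"
proof -
  have "\<epsilon>\<^sup>2 < \<delta>\<^sup>2" using \<epsilon> by (intro power_strict_mono) auto
  then show 1: "r0\<^sup>2 = \<delta>\<^sup>2 - \<epsilon>\<^sup>2" "0 < r0" by (auto simp: r0)
  have "\<epsilon>\<^sup>2 > 0" using \<epsilon> by simp
  then have "r0\<^sup>2 < \<delta>\<^sup>2" using 1 by linarith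
  then show "r0 < \<delta>" using \<epsilon> by (simp add: power2_less_imp_less)
qed

text \<open>With the average on the upper and the left end on the lower boundary, only the gap d is
  free, and it determines a. The left-hand side of the claim decreases as d grows, and the smallest
  admissible gap, where \<open>a = r0\<close>, is the equality case \<open>K\<close>.\<close>

lemma far_bottom:
  assumes a: "r0 \<le> a" and d: "d \<ge> 0"
    and eq: "r0\<^sup>2 = \<alpha> * a\<^sup>2 + (1 - \<alpha>) * \<delta>\<^sup>2 - \<alpha> * (1 - \<alpha>) * d\<^sup>2"
  shows "\<alpha> * (exp ((1 - \<alpha>) * d + a) * (1 - a)) + (1 - \<alpha>) * (exp (- \<alpha> * d + \<delta>) * (1 - \<delta>))
    \<le> exp r0 * (1 - r0)"
proof -
  define D where "D = \<epsilon> / sqrt \<alpha>"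
  \<comment> \<open>\<open>q x\<close> is the squared root that the constraint \<open>eq\<close>
    forces on the right end when the gap is x.\<close>
  define q where "q = (\<lambda>x. (r0\<^sup>2 - (1 - \<alpha>) * \<delta>\<^sup>2) / \<alpha> + (1 - \<alpha>) * x\<^sup>2)"
  define F where "F = (\<lambda>x. \<alpha> * (exp ((1 - \<alpha>) * x + sqrt (q x)) * (1 - sqrt (q x)))
      + (1 - \<alpha>) * (exp (- \<alpha> * x + \<delta>) * (1 - \<delta>)))"
  have D: "D > 0" "\<alpha> * D\<^sup>2 = \<epsilon>\<^sup>2" using \<alpha> \<epsilon> by (auto simp: D_def power_divide)
  have qD: "q D = r0\<^sup>2"
  proof -
    have "\<alpha> * q D = r0\<^sup>2 - (1 - \<alpha>) * \<delta>\<^sup>2 + (1 - \<alpha>) * (\<alpha> * D\<^sup>2)"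
      using \<alpha> by (simp add: q_def distrib_left mult.left_commute)
    also have "\<dots> = \<alpha> * r0\<^sup>2" unfolding D by (simp add: r0_sq algebra_simps)
    finally show ?thesis using \<alpha> by simp
  qed
  have qd: "q d = a\<^sup>2" using eq \<alpha> by (simp add: q_def field_simps)
  have Dd: "D \<le> d"
  proof (rule power2_le_imp_le)
    have "q D \<le> q d" using a r0_pos by (simp add: qD qd power_mono)
    then show "D\<^sup>2 \<le> d\<^sup>2" using \<alpha> by (simp add: q_def)
  qed fact
  have "F d \<le> F D"
  proof (rule DERIV_nonpos_imp_nonincreasing[OF Dd])
    fix x assume x: "D \<le> x" "x \<le> d"
    define s where "s = sqrt (q x)"
    have qx: "q x \<ge> r0\<^sup>2"
    proof -
      have "q D \<le> q x" unfolding q_def using x D \<alpha> by (intro add_left_mono mult_left_mono power_mono) auto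
      then show ?thesis by (simp add: qD)
    qed
    then have "q x > 0" using r0_pos by (smt (verit) zero_less_power)
    then have s: "s > 0" by (simp add: s_def)
    have "((\<lambda>x. sqrt (q x)) has_real_derivative ((1 - \<alpha>) * x / s)) (at x)"
      unfolding s_def using \<open>q x > 0\<close> unfolding q_def
      by (auto intro!: derivative_eq_intros simp: field_simps)
    from DERIV_add[OF DERIV_cmult[OF DERIV_exp_one_minus[OF this, of "1 - \<alpha>"], of \<alpha>]
      DERIV_cmult[OF DERIV_exp_one_minus[OF DERIV_const[of \<delta>], of "- \<alpha>"], of "1 - \<alpha>"]]
    have "(F has_real_derivative \<alpha> * (exp ((1 - \<alpha>) * x + s) * ((1 - \<alpha>) * (1 - s) - (1 - \<alpha>) * x / s * s))
        + (1 - \<alpha>) * (exp (- \<alpha> * x + \<delta>) * (- \<alpha> * (1 - \<delta>) - 0 * \<delta>))) (at x)"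
      unfolding F_def s_def .
    moreover have "\<alpha> * (exp ((1 - \<alpha>) * x + s) * ((1 - \<alpha>) * (1 - s) - (1 - \<alpha>) * x / s * s))
        + (1 - \<alpha>) * (exp (- \<alpha> * x + \<delta>) * (- \<alpha> * (1 - \<delta>) - 0 * \<delta>))
       = \<alpha> * (1 - \<alpha>) * exp (- \<alpha> * x) * (exp (x + s) * (1 - (x + s)) - exp \<delta> * (1 - \<delta>))"
    proof -
      have e1: "exp ((1 - \<alpha>) * x + s) = exp (- \<alpha> * x) * exp (x + s)"
        unfolding exp_add[symmetric] by (simp add: algebra_simps)
      have e2: "exp (- \<alpha> * x + \<delta>) = exp (- \<alpha> * x) * exp \<delta>" by (rule exp_add)
      have e3: "(1 - \<alpha>) * x / s * s = (1 - \<alpha>) * x" using s by simp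
      show ?thesis unfolding e1 e2 e3 by (simp add: algebra_simps)
    qed
    moreover have "\<alpha> * (1 - \<alpha>) * exp (- \<alpha> * x) * (exp (x + s) * (1 - (x + s)) - exp \<delta> * (1 - \<delta>)) \<le> 0"
    proof -
      \<comment> \<open>The map \<open>t \<mapsto> exp t * (1 - t)\<close> decreases for nonnegative
        t, and \<open>x \<ge> D \<ge> \<delta>\<close>. This is where the bound
        \<open>\<delta> \<le> \<epsilon> / sqrt \<alpha>\<close> enters.\<close>
      have "exp (x + s) * (1 - (x + s)) \<le> exp \<delta> * (1 - \<delta>)"
        using x s \<delta> \<epsilon> by (intro exp_one_minus_antimono) (auto simp: D_def)
      then show ?thesis using \<alpha> by (intro mult_nonneg_nonpos) auto
    qed
    ultimately show "\<exists>y. DERIV F x :> y \<and> y \<le> 0" by metis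
  qed
  moreover have "F D = exp r0 * (1 - r0)"
    using K r0_pos unfolding F_def qD by (simp add: D_def)
  moreover have "sqrt (q d) = a" using a r0_pos by (simp add: qd)
  ultimately show ?thesis by (simp add: F_def)
qed


text \<open>Here a stays fixed and the gap x determines the left end. Let p be the gap at which
  closeness is tight and m the gap at which the left end reaches the lower boundary. Between them
  \<open>F\<close> cannot rise and later fall, so it is bounded by its larger end value; the ends
  are covered by \<open>two_point_close\<close> and \<open>far_bottom\<close>.\<close>

lemma far_top:
  assumes a: "r0 \<le> a" and b: "0 \<le> b" "b \<le> \<delta>" and d: "d \<ge> 0"
    and eq: "r0\<^sup>2 = \<alpha> * a\<^sup>2 + (1 - \<alpha>) * b\<^sup>2 - \<alpha> * (1 - \<alpha>) * d\<^sup>2"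
  shows "\<alpha> * (exp ((1 - \<alpha>) * d + a) * (1 - a)) + (1 - \<alpha>) * (exp (- \<alpha> * d + b) * (1 - b))
    \<le> exp r0 * (1 - r0)"
proof (cases "(1 - \<alpha>) * d \<le> r0 + a")
  case True
  then show ?thesis using two_point_close[of \<alpha> d r0 a b] \<alpha> a b d eq r0_pos by auto
next
  case far: False
  define q where "q = (\<lambda>x. (r0\<^sup>2 - \<alpha> * a\<^sup>2) / (1 - \<alpha>) + \<alpha> * x\<^sup>2)"
  define F where "F = (\<lambda>x. \<alpha> * (exp ((1 - \<alpha>) * x + a) * (1 - a))
     + (1 - \<alpha>) * (exp (- \<alpha> * x + sqrt (q x)) * (1 - sqrt (q x))))"
  define p where "p = (r0 + a) / (1 - \<alpha>)"
  define m where "m = sqrt ((\<delta>\<^sup>2 - (r0\<^sup>2 - \<alpha> * a\<^sup>2) / (1 - \<alpha>)) / \<alpha>)"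
  have a0: "a > 0" and a1: "1 - \<alpha> > 0" using a r0_pos \<alpha> by auto
  have p0: "p \<ge> 0" and pd: "p < d" using far a0 r0_pos a1 by (auto simp: p_def field_simps)
  have qd: "q d = b\<^sup>2" using eq a1 by (simp add: q_def field_simps)
  have q_eq: "r0\<^sup>2 = \<alpha> * a\<^sup>2 + (1 - \<alpha>) * q x - \<alpha> * (1 - \<alpha>) * x\<^sup>2" for x
    using a1 by (simp add: q_def field_simps)
  have q_mono: "q x \<le> q y" if "0 \<le> x" "x \<le> y" for x y
    unfolding q_def using that \<alpha> by (intro add_left_mono mult_left_mono power_mono) auto
  have ppos: "(1 - \<alpha>) * x \<ge> r0 + a" if "x \<ge> p" for x
    using that a1 by (simp add: p_def field_simps)
  have q_ge: "q x > (\<alpha> * x)\<^sup>2" if "x \<ge> p" for x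
  proof -
    have "a\<^sup>2 < (r0 + a)\<^sup>2" using a0 r0_pos by (intro power_strict_mono) auto
    also have "\<dots> \<le> ((1 - \<alpha>) * x)\<^sup>2" using ppos[OF that] a0 r0_pos by (intro power_mono) auto
    finally have "\<alpha> * a\<^sup>2 < \<alpha> * ((1 - \<alpha>) * x)\<^sup>2" using \<alpha> by simp
    moreover have "r0\<^sup>2 > 0" using r0_pos by simp
    ultimately have "(1 - \<alpha>) * (\<alpha> * x)\<^sup>2 < (1 - \<alpha>) * q x"
      using q_eq[of x] by (simp add: power2_eq_square algebra_simps)
    then show ?thesis using a1 by simp
  qed
  have q_le: "sqrt (q x) \<le> a + x" if "x \<ge> p" for x
  proof -
    have "r0\<^sup>2 \<le> (a + (1 - \<alpha>) * x)\<^sup>2" using ppos[OF that] a0 r0_pos by (intro power_mono) auto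
    then have "(1 - \<alpha>) * q x \<le> (1 - \<alpha>) * (a + x)\<^sup>2"
      using q_eq[of x] by (simp add: power2_eq_square algebra_simps)
    then have "q x \<le> (a + x)\<^sup>2" using a1 by simp
    then show ?thesis using a0 that p0 by (intro real_le_lsqrt) auto
  qed
  have msq: "\<alpha> * m\<^sup>2 = \<delta>\<^sup>2 - (r0\<^sup>2 - \<alpha> * a\<^sup>2) / (1 - \<alpha>)" and dm: "d \<le> m"
  proof -
    have "q d \<le> \<delta>\<^sup>2" unfolding qd using b by (intro power_mono) auto
    then have *: "\<alpha> * d\<^sup>2 \<le> \<delta>\<^sup>2 - (r0\<^sup>2 - \<alpha> * a\<^sup>2) / (1 - \<alpha>)" by (simp add: q_def)
    then have "d\<^sup>2 \<le> (\<delta>\<^sup>2 - (r0\<^sup>2 - \<alpha> * a\<^sup>2) / (1 - \<alpha>)) / \<alpha>"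
      using \<alpha> by (simp only: pos_le_divide_eq mult.commute)
    then show "d \<le> m" unfolding m_def by (rule real_le_rsqrt)
    have "0 \<le> \<alpha> * d\<^sup>2" using \<alpha> by simp
    with * have "\<delta>\<^sup>2 - (r0\<^sup>2 - \<alpha> * a\<^sup>2) / (1 - \<alpha>) \<ge> 0" by linarith
    then show "\<alpha> * m\<^sup>2 = \<delta>\<^sup>2 - (r0\<^sup>2 - \<alpha> * a\<^sup>2) / (1 - \<alpha>)" using \<alpha> by (simp add: m_def)
  qed
  have qm: "q m = \<delta>\<^sup>2" using msq by (simp add: q_def)
  define F' where "F' = (\<lambda>x. \<alpha> * (1 - \<alpha>) * exp ((1 - \<alpha>) * x) *
      (exp a * (1 - a) - exp (sqrt (q x) - x) * (1 - (sqrt (q x) - x))))"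
  have deriv: "(F has_real_derivative F' x) (at x)" if "x \<ge> p" for x
  proof -
    define s where "s = sqrt (q x)"
    have "q x > 0" using q_ge[OF that] by (smt (verit) zero_le_power2)
    then have s: "s > 0" by (simp add: s_def)
    have "((\<lambda>x. sqrt (q x)) has_real_derivative (\<alpha> * x / s)) (at x)"
      unfolding s_def using \<open>q x > 0\<close> unfolding q_def
      by (auto intro!: derivative_eq_intros simp: field_simps)
    from DERIV_add[OF DERIV_cmult[OF DERIV_exp_one_minus[OF DERIV_const[of a], of "1 - \<alpha>"], of \<alpha>]
      DERIV_cmult[OF DERIV_exp_one_minus[OF this, of "- \<alpha>"], of "1 - \<alpha>"]]
    have "(F has_real_derivative \<alpha> * (exp ((1 - \<alpha>) * x + a) * ((1 - \<alpha>) * (1 - a) - 0 * a))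
        + (1 - \<alpha>) * (exp (- \<alpha> * x + s) * (- \<alpha> * (1 - s) - \<alpha> * x / s * s))) (at x)"
      unfolding F_def s_def .
    moreover have "\<alpha> * (exp ((1 - \<alpha>) * x + a) * ((1 - \<alpha>) * (1 - a) - 0 * a))
        + (1 - \<alpha>) * (exp (- \<alpha> * x + s) * (- \<alpha> * (1 - s) - \<alpha> * x / s * s)) = F' x"
    proof -
      have e1: "exp ((1 - \<alpha>) * x + a) = exp ((1 - \<alpha>) * x) * exp a" by (simp add: exp_add)
      have e2: "exp (- \<alpha> * x + s) = exp ((1 - \<alpha>) * x) * exp (s - x)"
        unfolding exp_add[symmetric] by (simp add: algebra_simps)
      have e3: "\<alpha> * x / s * s = \<alpha> * x" using s by simp
      show ?thesis unfolding F'_def s_def[symmetric] e1 e2 e3 by (simp add: algebra_simps)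
    qed
    ultimately show ?thesis by simp
  qed
  have anti: "sqrt (q y) - y \<le> sqrt (q x) - x" if "p \<le> x" "x \<le> y" for x y
  proof (rule DERIV_nonpos_imp_nonincreasing[OF that(2)])
    fix z assume z: "x \<le> z" "z \<le> y"
    have "q z > (\<alpha> * z)\<^sup>2" using q_ge z that by auto
    then have "q z > 0" "\<alpha> * z \<le> sqrt (q z)"
      by (smt (verit) zero_le_power2, intro real_le_rsqrt, simp)
    then have "((\<lambda>x. sqrt (q x) - x) has_real_derivative (\<alpha> * z / sqrt (q z) - 1)) (at z)"
      unfolding q_def
      by (auto intro!: derivative_eq_intros simp: field_simps)
    moreover have "\<alpha> * z / sqrt (q z) - 1 \<le> 0" 
      using \<open>q z > 0\<close> \<open>\<alpha> * z \<le> sqrt (q z)\<close> by simp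
    ultimately show "\<exists>w. ((\<lambda>x. sqrt (q x) - x) has_real_derivative w) (at z) \<and> w \<le> 0" by blast
  qed
  have Fp: "F p \<le> exp r0 * (1 - r0)"
    unfolding F_def
  proof (rule two_point_close)
    have "q p > 0" using q_ge[of p] by (smt (verit) zero_le_power2)
    then show "r0\<^sup>2 = \<alpha> * a\<^sup>2 + (1 - \<alpha>) * (sqrt (q p))\<^sup>2 - \<alpha> * (1 - \<alpha>) * p\<^sup>2"
      using q_eq[of p] by simp
    then show "0 \<le> sqrt (q p)" using \<open>q p > 0\<close> by simp
    show "(1 - \<alpha>) * p \<le> r0 + a" using a1 by (simp add: p_def)
  qed (use \<alpha> p0 r0_pos a0 in auto)
  have Fm: "F m \<le> exp r0 * (1 - r0)"
  proof -
    have "sqrt (q m) = \<delta>" using \<epsilon> by (simp add: qm)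
    then show ?thesis unfolding F_def using far_bottom[of a m] a d dm q_eq[of m] qm by simp
  qed
  have "F d \<le> exp r0 * (1 - r0)"
  proof (rule ccontr)
    assume neg: "\<not> ?thesis"
    have "d \<noteq> m" using neg Fm by auto
    then have dm': "d < m" using dm by simp
    obtain x1 where x1: "p < x1" "x1 < d" "F d - F p = (d - p) * F' x1"
      using MVT2[OF pd, of F F'] deriv by auto
    obtain x2 where x2: "d < x2" "x2 < m" "F m - F d = (m - d) * F' x2"
      using MVT2[OF dm', of F F'] deriv pd by auto
    have "(d - p) * F' x1 > 0" using neg Fp x1 by linarith
    then have f1: "F' x1 > 0" using pd by (simp add: zero_less_mult_iff)
    have "(m - d) * F' x2 < 0" using neg Fm x2 by linarith
    then have f2: "F' x2 < 0" using dm' by (simp add: mult_less_0_iff)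
    \<comment> \<open>The sign of \<open>F'\<close> compares \<open>exp a * (1 - a)\<close> with
      \<open>exp s * (1 - s)\<close> at \<open>s = sqrt (q x) - x\<close>, and this s decreases in x
      and is at most a. A positive \<open>F'\<close> at \<open>x1\<close> therefore forces
      \<open>s1 < 0\<close>, where \<open>exp s * (1 - s)\<close> is increasing in s; then
      \<open>s2 \<le> s1\<close> contradicts a negative \<open>F'\<close> at
      \<open>x2\<close>.\<close>
    define s1 where "s1 = sqrt (q x1) - x1"
    define s2 where "s2 = sqrt (q x2) - x2"
    have pos: "\<alpha> * (1 - \<alpha>) * exp ((1 - \<alpha>) * x) > 0" for x using \<alpha> a1 by simp
    have 1: "exp s1 * (1 - s1) < exp a * (1 - a)"
      using f1 pos[of x1] unfolding F'_def s1_def by (simp add: zero_less_mult_iff)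
    have 2: "exp s2 * (1 - s2) > exp a * (1 - a)"
      using f2 pos[of x2] \<alpha> a1 unfolding F'_def s2_def by (auto simp: mult_less_0_iff)
    have "s2 \<le> s1" unfolding s1_def s2_def using x1 x2 by (intro anti) auto
    have "s1 \<le> a" unfolding s1_def using q_le[of x1] x1 by simp
    show False
    proof (cases "s1 \<ge> 0")
      case True
      then show False using exp_one_minus_antimono[OF True \<open>s1 \<le> a\<close>] 1 by simp
    next
      case False
      then show False using exp_one_minus_mono[of s1 s2] \<open>s2 \<le> s1\<close> 1 2 by simp
    qed
  qed
  then show ?thesis using b by (simp add: F_def qd)
qed

text \<open>Failure of closeness means, by \<open>seg_close\<close>, that the segment leaves the
  wider strip to the right of \<beta>, so it crosses the upper boundary of \<open>Omega\<close> at
  some \<open>\<beta>'\<close> before that. Since \<open>seg_sq\<close> is convex in t, a drop from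
  \<open>r0^2\<close> at \<open>\<beta>'\<close> to a negative value later rules out values below
  \<open>r0^2\<close> earlier.\<close>

lemma seg_sq_IVT:
  assumes d: "d \<ge> 0" and \<beta>: "0 \<le> \<beta>" "\<beta> \<le> 1"
    and far: "\<not> (1 - \<beta>) * d \<le> sqrt (seg_sq a b d \<beta>) + sqrt (seg_sq a b d 1)"
    and ge: "seg_sq a b d 0 \<ge> r0\<^sup>2" "seg_sq a b d \<beta> \<ge> r0\<^sup>2"
  obtains \<beta>' where "\<beta> \<le> \<beta>'" "\<beta>' \<le> 1" "seg_sq a b d \<beta>' = r0\<^sup>2"
    "\<And>t. 0 \<le> t \<Longrightarrow> t \<le> \<beta>' \<Longrightarrow> seg_sq a b d t \<ge> r0\<^sup>2"
proof -
  let ?R = "seg_sq a b d"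
  obtain t0 where t0: "\<beta> \<le> t0" "t0 \<le> 1" "?R t0 < 0"
    using seg_close[of d \<beta> 1 a b] far d \<beta> by (meson not_le)
  have cont: "continuous_on S ?R" for S
    unfolding seg_sq_def by (intro continuous_intros)
  have "r0\<^sup>2 > 0" using r0_pos by simp
  then obtain \<beta>' where \<beta>': "\<beta> \<le> \<beta>'" "\<beta>' \<le> t0" "?R \<beta>' = r0\<^sup>2"
    using IVT2'[of ?R t0 "r0\<^sup>2" \<beta>] t0 ge cont by (smt (verit))
  have "?R t \<ge> r0\<^sup>2" if t: "0 \<le> t" "t \<le> \<beta>'" for t
  proof (rule ccontr)
    assume neg: "\<not> ?thesis"
    have less: "t < \<beta>'" "\<beta>' < t0" using neg t \<beta>' t0 \<open>r0\<^sup>2 > 0\<close> by (smt (verit))+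
    define \<theta> where "\<theta> = (\<beta>' - t) / (t0 - t)"
    have \<theta>: "0 < \<theta>" "\<theta> < 1" using less by (auto simp: \<theta>_def)
    have "\<theta> * (t0 - t) = \<beta>' - t" using less by (simp add: \<theta>_def)
    then have "(1 - \<theta>) * t + \<theta> * t0 = \<beta>'" by (simp add: algebra_simps)
    then have "r0\<^sup>2 = (1 - \<theta>) * ?R t + \<theta> * ?R t0 - \<theta> * (1 - \<theta>) * ((t0 - t) * d)\<^sup>2"
      using seg_sq_convex_comb[of a b d \<theta> t t0] \<beta>'(3) by simp
    also have "\<dots> \<le> (1 - \<theta>) * ?R t + \<theta> * ?R t0" using \<theta> by simp
    also have "\<dots> < (1 - \<theta>) * r0\<^sup>2 + \<theta> * r0\<^sup>2"
    proof -
      have "?R t < r0\<^sup>2" "?R t0 < r0\<^sup>2" using neg t0 \<open>r0\<^sup>2 > 0\<close> by linarith+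
      then show ?thesis using \<theta> by (intro add_strict_mono mult_strict_left_mono) linarith+
    qed
    finally show False by (simp add: algebra_simps)
  qed
  then show ?thesis using \<beta>' t0 by (intro that[of \<beta>']) auto
qed

lemma two_point:
  assumes d: "d \<ge> 0" and \<beta>: "\<alpha> \<le> \<beta>" "\<beta> \<le> 1"
    and a: "r0 \<le> a" "a \<le> \<delta>" and b: "r0 \<le> b" "b \<le> \<delta>"
    and ge: "seg_sq a b d \<beta> \<ge> r0\<^sup>2"
  shows "\<beta> * seg_val a b d 1 + (1 - \<beta>) * seg_val a b d 0 \<le> seg_val a b d \<beta>"
proof -
  let ?R = "seg_sq a b d" and ?h = "seg_val a b d"
  have a0: "a > 0" and b0: "b > 0" using a b r0_pos by auto
  have R: "?R 0 = b\<^sup>2" "?R 1 = a\<^sup>2" by (auto simp: seg_sq_def)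
  show ?thesis
  proof (cases "(1 - \<beta>) * d \<le> sqrt (?R \<beta>) + sqrt (?R 1)")
    case True
    have R0: "?R \<beta> \<ge> 0" using ge by (smt (verit) zero_le_power2)
    have "\<beta> * (exp ((1 - \<beta>) * d + a) * (1 - a)) + (1 - \<beta>) * (exp (- \<beta> * d + b) * (1 - b))
        \<le> exp (sqrt (?R \<beta>)) * (1 - sqrt (?R \<beta>))"
      by (rule two_point_close) (use True R R0 a0 b0 d \<alpha> \<beta> in \<open>auto simp: seg_sq_def\<close>)
    from exp_scale_le[OF this, of "\<beta> * d"] show ?thesis
      using R a0 b0 by (simp add: seg_val_def algebra_simps)
  next
    case False
    have "0 \<le> \<beta>" using \<alpha> \<beta> by simp
    moreover have "?R 0 \<ge> r0\<^sup>2" unfolding R using b r0_pos by (intro power_mono) auto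
    ultimately obtain \<beta>' where \<beta>': "\<beta> \<le> \<beta>'" "\<beta>' \<le> 1" "?R \<beta>' = r0\<^sup>2"
      "\<And>t. 0 \<le> t \<Longrightarrow> t \<le> \<beta>' \<Longrightarrow> ?R t \<ge> r0\<^sup>2"
      using seg_sq_IVT[OF d _ \<beta>(2) False] ge by blast
    have b'0: "\<beta>' > 0" and a1: "1 - \<alpha> > 0" using \<alpha> \<beta> \<beta>' by auto
    have nn: "?R t \<ge> 0" if "0 \<le> t" "t \<le> \<beta>'" for t
      using \<beta>'(4)[OF that] by (smt (verit) zero_le_power2)
    \<comment> \<open>Solves \<open>\<beta>' = (1 - \<alpha>) * s + \<alpha>\<close>: with s as left
      end, the point at \<open>\<beta>'\<close> gives the right end weight exactly \<alpha>, as
      \<open>far_top\<close> demands.\<close>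
    define s where "s = (\<beta>' - \<alpha>) / (1 - \<alpha>)"
    have s: "0 \<le> s" "s \<le> \<beta>'"
    proof -
      have "\<beta>' * \<alpha> \<le> 1 * \<alpha>" using \<beta>' \<alpha> by (intro mult_right_mono) auto
      then show "s \<le> \<beta>'" using a1 by (simp add: s_def field_simps)
    qed (use \<beta> \<beta>' a1 in \<open>auto simp: s_def\<close>)
    have s_eq: "(1 - \<alpha>) * s = \<beta>' - \<alpha>" using a1 by (simp add: s_def)
    have top: "\<alpha> * ?h 1 + (1 - \<alpha>) * ?h s \<le> ?h \<beta>'"
    proof -
      define D where "D = (1 - s) * d"
      have s1: "s \<le> 1" using s \<beta>' by simp
      have aD: "\<alpha> * D = (\<beta>' - s) * d"
        using s_eq by (simp add: D_def) (simp add: algebra_simps)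
      have "\<alpha> * (exp ((1 - \<alpha>) * D + a) * (1 - a)) + (1 - \<alpha>) * (exp (- \<alpha> * D + sqrt (?R s)) * (1 - sqrt (?R s)))
          \<le> exp r0 * (1 - r0)"
      proof (rule far_top)
        show "0 \<le> D" using d s1 by (simp add: D_def)
        have "?R s = (1 - s) * b\<^sup>2 + s * a\<^sup>2 - s * (1 - s) * d\<^sup>2" by (simp add: seg_sq_def)
        also have "\<dots> \<le> (1 - s) * b\<^sup>2 + s * a\<^sup>2" using s s1 by simp
        also have "\<dots> \<le> (1 - s) * \<delta>\<^sup>2 + s * \<delta>\<^sup>2"
          using s s1 a a0 b b0 by (intro add_mono mult_left_mono power_mono) auto
        finally have "?R s \<le> \<delta>\<^sup>2" by (simp add: algebra_simps)
        then show "sqrt (?R s) \<le> \<delta>" using \<epsilon> by (intro real_le_lsqrt) auto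
        show "0 \<le> sqrt (?R s)" using nn[OF s] by simp
        have "r0\<^sup>2 = ?R ((1 - \<alpha>) * s + \<alpha> * 1)" using \<beta>'(3) s_eq by simp
        also have "\<dots> = (1 - \<alpha>) * ?R s + \<alpha> * ?R 1 - \<alpha> * (1 - \<alpha>) * D\<^sup>2"
          unfolding seg_sq_convex_comb D_def ..
        finally show "r0\<^sup>2 = \<alpha> * a\<^sup>2 + (1 - \<alpha>) * (sqrt (?R s))\<^sup>2 - \<alpha> * (1 - \<alpha>) * D\<^sup>2"
          using nn[OF s] R by simp
      qed fact
      from exp_scale_le[OF this, of "\<beta>' * d"]
      have "\<alpha> * (exp (\<beta>' * d + ((1 - \<alpha>) * D + a)) * (1 - a))
          + (1 - \<alpha>) * (exp (\<beta>' * d + (- \<alpha> * D + sqrt (?R s))) * (1 - sqrt (?R s)))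
          \<le> exp (\<beta>' * d + r0) * (1 - r0)" .
      moreover have e1: "\<beta>' * d + ((1 - \<alpha>) * D + a) = 1 * d + a"
        unfolding left_diff_distrib aD by (simp add: D_def algebra_simps)
      moreover have e2: "\<beta>' * d + (- \<alpha> * D + sqrt (?R s)) = s * d + sqrt (?R s)"
        unfolding minus_mult_left[symmetric] aD by (simp add: algebra_simps)
      ultimately have "\<alpha> * (exp (1 * d + a) * (1 - a))
          + (1 - \<alpha>) * (exp (s * d + sqrt (?R s)) * (1 - sqrt (?R s)))
          \<le> exp (\<beta>' * d + r0) * (1 - r0)" by (simp only:)
      then show ?thesis using R a0 r0_pos \<beta>'(3) by (simp add: seg_val_def)
    qed
    have conc: "(1 - t / \<beta>') * ?h 0 + (t / \<beta>') * ?h \<beta>' \<le> ?h t" if "0 \<le> t" "t \<le> \<beta>'" for t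
      using seg_val_concave[of d 0 \<beta>' "t / \<beta>'" a b] d nn that b'0 by simp
    have "\<beta>' * ?h 1 + (1 - \<beta>') * ?h 0 \<le> ?h \<beta>'"
    proof -
      have "(1 - \<alpha>) * ((1 - s / \<beta>') * ?h 0 + (s / \<beta>') * ?h \<beta>') \<le> (1 - \<alpha>) * ?h s"
        using conc[OF s] a1 by (intro mult_left_mono) auto
      with top have "\<alpha> * ?h 1 + (1 - \<alpha>) * ((1 - s / \<beta>') * ?h 0 + (s / \<beta>') * ?h \<beta>') \<le> ?h \<beta>'"
        by linarith
      \<comment> \<open>Once \<open>?h s\<close> is replaced by its lower bound, only the values at
        0, \<open>\<beta>'\<close> and 1 remain. The factor \<open>\<beta>' / \<alpha>\<close> gives
        \<open>?h 1\<close> the coefficient \<open>\<beta>'\<close> and \<open>?h 0\<close> the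
        coefficient \<open>1 - \<beta>'\<close>; the surplus \<open>\<beta>' / \<alpha> - 1\<close>
        of \<open>?h \<beta>'\<close> then cancels.\<close>
      then have "\<beta>' / \<alpha> * (\<alpha> * ?h 1 + (1 - \<alpha>) * ((1 - s / \<beta>') * ?h 0 + (s / \<beta>') * ?h \<beta>')) \<le> \<beta>' / \<alpha> * ?h \<beta>'"
        using b'0 \<alpha> by (intro mult_left_mono) auto
      moreover have "\<beta>' / \<alpha> * (\<alpha> * ?h 1 + (1 - \<alpha>) * ((1 - s / \<beta>') * ?h 0 + (s / \<beta>') * ?h \<beta>'))
        = \<beta>' * ?h 1 + ((1 - \<alpha>) * \<beta>' - (1 - \<alpha>) * s) / \<alpha> * ?h 0 + ((1 - \<alpha>) * s) / \<alpha> * ?h \<beta>'"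
        using b'0 \<alpha> by (simp add: field_simps)
      moreover have "((1 - \<alpha>) * \<beta>' - (1 - \<alpha>) * s) / \<alpha> = 1 - \<beta>'"
        unfolding s_eq using \<alpha> by (simp add: field_simps)
      moreover have "((1 - \<alpha>) * s) / \<alpha> = \<beta>' / \<alpha> - 1" unfolding s_eq using \<alpha> by (simp add: field_simps)
      ultimately have "\<beta>' * ?h 1 + (1 - \<beta>') * ?h 0 + (\<beta>' / \<alpha> - 1) * ?h \<beta>' \<le> \<beta>' / \<alpha> * ?h \<beta>'"
        by (simp only:)
      then show ?thesis unfolding left_diff_distrib[of "\<beta>' / \<alpha>"] by linarith
    qed
    then have "\<beta> / \<beta>' * (\<beta>' * ?h 1 + (1 - \<beta>') * ?h 0) \<le> \<beta> / \<beta>' * ?h \<beta>'"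
      using \<alpha> \<beta> b'0 by (intro mult_left_mono) auto
    moreover have "(1 - \<beta> / \<beta>') * ?h 0 + (\<beta> / \<beta>') * ?h \<beta>' \<le> ?h \<beta>"
      using conc[of \<beta>] \<beta> \<beta>' \<alpha> by simp
    moreover have "\<beta> / \<beta>' * (\<beta>' * ?h 1 + (1 - \<beta>') * ?h 0) + (1 - \<beta> / \<beta>') * ?h 0 = \<beta> * ?h 1 + (1 - \<beta>) * ?h 0"
      using b'0 by (simp add: field_simps)
    ultimately show ?thesis by linarith
  qed
qed


definition rad :: "real \<times> real \<Rightarrow> real" where
  "rad x = sqrt (\<delta>\<^sup>2 - snd x + (fst x)\<^sup>2)"

definition BB :: "real \<times> real \<Rightarrow> real" where
  "BB x = exp (fst x + rad x) * (1 - rad x)"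

lemma rad_sq: "(rad x)\<^sup>2 = \<delta>\<^sup>2 - snd x + (fst x)\<^sup>2"
  and rad_bounds: "r0 \<le> rad x" "rad x \<le> \<delta>"
  if "x \<in> Omega \<epsilon>"
proof -
  have *: "r0\<^sup>2 \<le> \<delta>\<^sup>2 - snd x + (fst x)\<^sup>2" "\<delta>\<^sup>2 - snd x + (fst x)\<^sup>2 \<le> \<delta>\<^sup>2"
    using that by (auto simp: Omega_def r0_sq)
  then show "r0 \<le> rad x" "rad x \<le> \<delta>"
    unfolding rad_def using \<epsilon> by (auto intro!: real_le_rsqrt real_le_lsqrt)
  show "(rad x)\<^sup>2 = \<delta>\<^sup>2 - snd x + (fst x)\<^sup>2"
    unfolding rad_def using * by (smt (verit) zero_le_power2 real_sqrt_pow2)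
qed

text \<open>Only the end with the larger first coordinate can violate the tangent plane condition,
  so only its weight has to be bounded below. \<open>BB_two_point\<close> bounds both weights and
  need not know the order of the ends.\<close>

lemma BB_two_point_ordered:
  assumes y: "y \<in> Omega \<epsilon>" and z: "z \<in> Omega \<epsilon>" and \<beta>: "\<alpha> \<le> \<beta>" "\<beta> \<le> 1"
    and x: "\<beta> *\<^sub>R y + (1 - \<beta>) *\<^sub>R z \<in> Omega \<epsilon>" and le: "fst z \<le> fst y"
  shows "\<beta> * BB y + (1 - \<beta>) * BB z \<le> BB (\<beta> *\<^sub>R y + (1 - \<beta>) *\<^sub>R z)"
proof -
  define w where "w = \<beta> *\<^sub>R y + (1 - \<beta>) *\<^sub>R z"
  define d where "d = fst y - fst z"
  have w: "w \<in> Omega \<epsilon>" using x by (simp add: w_def)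
  have sq: "seg_sq (rad y) (rad z) d \<beta> = (rad w)\<^sup>2"
    unfolding seg_sq_def rad_sq[OF y] rad_sq[OF z] rad_sq[OF w]
    by (simp add: w_def d_def power2_eq_square algebra_simps)
  have nn: "rad y \<ge> 0" "rad z \<ge> 0" "rad w \<ge> 0"
    using rad_bounds[OF y] rad_bounds[OF z] rad_bounds[OF w] r0_pos by auto
  have "\<beta> * seg_val (rad y) (rad z) d 1 + (1 - \<beta>) * seg_val (rad y) (rad z) d 0
      \<le> seg_val (rad y) (rad z) d \<beta>"
  proof (rule two_point)
    show "r0\<^sup>2 \<le> seg_sq (rad y) (rad z) d \<beta>"
      unfolding sq using rad_bounds[OF w] r0_pos by (intro power_mono) auto
  qed (use \<beta> le rad_bounds[OF y] rad_bounds[OF z] in \<open>auto simp: d_def\<close>)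
  then have "\<beta> * (exp (d + rad y) * (1 - rad y)) + (1 - \<beta>) * (exp (rad z) * (1 - rad z))
      \<le> exp (\<beta> * d + rad w) * (1 - rad w)"
    unfolding seg_val_def sq using nn by (simp add: seg_sq_def)
  from exp_scale_le[OF this, of "fst z"] show ?thesis
    unfolding BB_def w_def[symmetric] by (simp add: d_def w_def algebra_simps)
qed

lemma BB_two_point:
  assumes y: "y \<in> Omega \<epsilon>" and z: "z \<in> Omega \<epsilon>" and \<beta>: "\<alpha> \<le> \<beta>" "\<beta> \<le> 1 - \<alpha>"
    and x: "\<beta> *\<^sub>R y + (1 - \<beta>) *\<^sub>R z \<in> Omega \<epsilon>"
  shows "\<beta> * BB y + (1 - \<beta>) * BB z \<le> BB (\<beta> *\<^sub>R y + (1 - \<beta>) *\<^sub>R z)"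
proof (cases "fst z \<le> fst y")
  case True
  then show ?thesis using BB_two_point_ordered[OF y z] assms \<alpha> by auto
next
  case False
  then show ?thesis using BB_two_point_ordered[OF z y, of "1 - \<beta>"] assms \<alpha>
    by (auto simp: add.commute)
qed

end

section \<open>From two points to many\<close>

lemma sum_sq_le_card:
  fixes p :: "'b \<Rightarrow> real"
  assumes "finite I"
  shows "(\<Sum>i\<in>I. p i)\<^sup>2 \<le> real (card I) * (\<Sum>i\<in>I. (p i)\<^sup>2)"
  using sum_squared_le_sum_of_squares[of p I] assms by (simp add: mult.commute)

text \<open>The variances of the averages that leave out one point have mean at most the variance
  of the full average, so one of them can be left out without leaving the strip.\<close>

lemma Omega_drop_one:
  fixes x :: "'b \<Rightarrow> real \<times> real"
  assumes I: "finite I" "card I \<ge> 2" and x: "\<And>i. i \<in> I \<Longrightarrow> x i \<in> Omega \<epsilon>"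
    and av: "(1 / real (card I)) *\<^sub>R (\<Sum>i\<in>I. x i) \<in> Omega \<epsilon>"
  obtains k where "k \<in> I" "(1 / real (card I - 1)) *\<^sub>R (\<Sum>i\<in>I - {k}. x i) \<in> Omega \<epsilon>"
proof -
  define m where "m = real (card I)"
  define p where "p = (\<lambda>i. fst (x i))"
  define q where "q = (\<lambda>i. snd (x i))"
  have m: "m \<ge> 2" "real (card I - 1) = m - 1" using I by (auto simp: m_def)
  have qp: "(p i)\<^sup>2 \<le> q i" if "i \<in> I" for i using x[OF that] by (auto simp: Omega_def p_def q_def)
  define P where "P = (\<lambda>k. (sum p I - p k) / (m - 1))"
  define R where "R = (\<lambda>k. (sum q I - q k) / (m - 1))"
  have y: "(1 / real (card I - 1)) *\<^sub>R (\<Sum>i\<in>I - {k}. x i) = (P k, R k)" if "k \<in> I" for k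
    using I that by (simp add: sum_diff1 m(2) m_def p_def q_def P_def R_def prod_eq_iff fst_sum snd_sum)
  have low: "(P k)\<^sup>2 \<le> R k" if "k \<in> I" for k
  proof -
    have "(sum p (I - {k}))\<^sup>2 \<le> real (card (I - {k})) * (\<Sum>i\<in>I - {k}. (p i)\<^sup>2)"
      using I by (intro sum_sq_le_card) auto
    also have "\<dots> \<le> (m - 1) * sum q (I - {k})"
      using I that m qp by (intro mult_mono sum_mono) (auto intro!: sum_nonneg)
    finally have "(sum p I - p k)\<^sup>2 \<le> (m - 1) * (sum q I - q k)" using I that by (simp add: sum_diff1)
    then have "(sum p I - p k)\<^sup>2 / (m - 1)\<^sup>2 \<le> (m - 1) * (sum q I - q k) / (m - 1)\<^sup>2"
      by (intro divide_right_mono) auto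
    then show ?thesis using m by (simp add: P_def R_def power_divide power2_eq_square)
  qed
  have "\<exists>k\<in>I. R k \<le> (P k)\<^sup>2 + \<epsilon>\<^sup>2"
  proof (rule ccontr)
    assume "\<not> ?thesis"
    then have gt: "(P k)\<^sup>2 + \<epsilon>\<^sup>2 < R k" if "k \<in> I" for k using that by force
    have ne: "I \<noteq> {}" using I by auto
    \<comment> \<open>Each index is left out exactly once, so the leave-one-out means have the same
      totals as the original points.\<close>
    have sums: "sum P I = sum p I" "sum R I = sum q I"
      using m by (simp_all add: P_def R_def sum_divide_distrib[symmetric] sum_subtractf flip: m_def)
        (simp_all add: field_simps)
    have "(\<Sum>k\<in>I. (P k)\<^sup>2 + \<epsilon>\<^sup>2) < sum R I"
      using gt I ne by (intro sum_strict_mono) auto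
    then have "(\<Sum>k\<in>I. (P k)\<^sup>2) + m * \<epsilon>\<^sup>2 < sum q I" by (simp add: sums sum.distrib m_def)
    moreover have "(sum p I)\<^sup>2 \<le> m * (\<Sum>k\<in>I. (P k)\<^sup>2)"
      using sum_sq_le_card[OF I(1), of P] by (simp add: sums m_def)
    ultimately have "m * (m * \<epsilon>\<^sup>2) < m * sum q I - (sum p I)\<^sup>2"
      using m by (smt (verit) mult_strict_left_mono distrib_left)
    moreover have "sum q I / m \<le> (sum p I / m)\<^sup>2 + \<epsilon>\<^sup>2"
      using av by (simp add: Omega_def case_prod_unfold p_def q_def m_def fst_sum snd_sum)
    then have "m * m * (sum q I / m) \<le> m * m * ((sum p I / m)\<^sup>2 + \<epsilon>\<^sup>2)"
      using m by (intro mult_left_mono) auto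
    then have "m * sum q I \<le> (sum p I)\<^sup>2 + m * (m * \<epsilon>\<^sup>2)"
      using m by (simp add: power_divide power2_eq_square algebra_simps)
    ultimately show False by linarith
  qed
  then obtain k where "k \<in> I" "R k \<le> (P k)\<^sup>2 + \<epsilon>\<^sup>2" by blast
  then show ?thesis using that[of k] y[of k] low[of k] by (simp add: Omega_def)
qed

context bellman_data
begin

text \<open>The point split off has weight \<open>1 / card I\<close>, which lies between \<alpha>
  and 1/2, so both weights are admissible in \<open>BB_two_point\<close>.
  \<open>Omega_drop_one\<close> chooses it so that the mean of the others stays in
  \<open>Omega\<close>, which the induction hypothesis needs.\<close>

lemma BB_multi_point:
  fixes x :: "'b \<Rightarrow> real \<times> real"
  assumes "finite I" "I \<noteq> {}" "real (card I) * \<alpha> \<le> 1" "\<And>i. i \<in> I \<Longrightarrow> x i \<in> Omega \<epsilon>"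
    and "(1 / real (card I)) *\<^sub>R (\<Sum>i\<in>I. x i) \<in> Omega \<epsilon>"
  shows "(\<Sum>i\<in>I. BB (x i)) \<le> real (card I) * BB ((1 / real (card I)) *\<^sub>R (\<Sum>i\<in>I. x i))"
  using assms
proof (induction "card I" arbitrary: I)
  case 0
  then show ?case by simp
next
  case (Suc m)
  show ?case
  proof (cases "m = 0")
    case True
    then obtain i where "I = {i}" using Suc(2) by (metis One_nat_def card_1_singletonE)
    then show ?thesis by simp
  next
    case False
    have "card I \<ge> 2" using False Suc(2) by simp
    then obtain k where k: "k \<in> I" "(1 / real (card I - 1)) *\<^sub>R (\<Sum>i\<in>I - {k}. x i) \<in> Omega \<epsilon>"
      using Omega_drop_one[OF Suc(3) _ Suc(6,7)] by metis
    define J where "J = I - {k}"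
    define y where "y = (1 / real m) *\<^sub>R (\<Sum>i\<in>J. x i)"
    have cJ: "card J = m" using Suc(2,3) k by (simp add: J_def)
    have m: "real m \<ge> 1" "real (card I) = real m + 1" using False Suc(2) by (auto simp flip: Suc(2))
    have yO: "y \<in> Omega \<epsilon>" using k by (simp add: y_def J_def flip: Suc(2))
    define \<beta> where "\<beta> = 1 / (real m + 1)"
    have b1: "1 - \<beta> = real m / (real m + 1)" using m by (simp add: \<beta>_def field_simps)
    have sum_I: "(\<Sum>i\<in>I. f i) = f k + (\<Sum>i\<in>J. f i)" for f :: "'b \<Rightarrow> 'c::comm_monoid_add"
      using Suc(3) k(1) by (simp add: J_def sum.remove)
    have av: "(1 / real (card I)) *\<^sub>R (\<Sum>i\<in>I. x i) = \<beta> *\<^sub>R x k + (1 - \<beta>) *\<^sub>R y"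
      unfolding b1 using m by (simp add: sum_I \<beta>_def y_def scaleR_add_right)
    have "(\<Sum>i\<in>J. BB (x i)) \<le> real (card J) * BB ((1 / real (card J)) *\<^sub>R (\<Sum>i\<in>J. x i))"
    proof (rule Suc(1))
      show "real (card J) * \<alpha> \<le> 1" unfolding cJ using Suc(5) m \<alpha>
        by (smt (verit) mult_right_mono)
      show "(1 / real (card J)) *\<^sub>R (\<Sum>i\<in>J. x i) \<in> Omega \<epsilon>" using yO by (simp add: y_def cJ)
      show "J \<noteq> {}" using cJ False by auto
    qed (use Suc(3,6) cJ in \<open>auto simp: J_def\<close>)
    then have IH: "(\<Sum>i\<in>J. BB (x i)) \<le> real m * BB y" by (simp add: cJ y_def)
    have "\<beta> * BB (x k) + (1 - \<beta>) * BB y \<le> BB (\<beta> *\<^sub>R x k + (1 - \<beta>) *\<^sub>R y)"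
    proof (rule BB_two_point)
      show "\<alpha> \<le> \<beta>" using Suc(5) m by (simp add: \<beta>_def field_simps)
      have "\<beta> \<le> 1 / 2" using m by (simp add: \<beta>_def field_simps)
      then show "\<beta> \<le> 1 - \<alpha>" using \<alpha> by simp
      show "\<beta> *\<^sub>R x k + (1 - \<beta>) *\<^sub>R y \<in> Omega \<epsilon>" using Suc(7) av by simp
    qed (use Suc(6) k yO in auto)
    then have "(real m + 1) * (\<beta> * BB (x k) + (1 - \<beta>) * BB y) \<le> (real m + 1) * BB (\<beta> *\<^sub>R x k + (1 - \<beta>) *\<^sub>R y)"
      using m by (intro mult_left_mono) auto
    moreover have "(real m + 1) * (\<beta> * BB (x k) + (1 - \<beta>) * BB y) = BB (x k) + real m * BB y"
      unfolding b1 unfolding \<beta>_def using m by (simp add: distrib_left)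
    ultimately show ?thesis using IH unfolding av unfolding sum_I m by linarith
  qed
qed

end

section \<open>Existence and uniqueness of \<delta>\<close>

lemma sinh_bound:
  fixes y :: real
  assumes "y > 0"
  shows "2 * y < exp y - exp (- y)"
proof -
  have "(\<lambda>y::real. exp y - exp (- y) - 2 * y) 0 < (\<lambda>y. exp y - exp (- y) - 2 * y) y"
  proof (rule DERIV_pos_imp_increasing_open[OF assms])
    fix x :: real assume x: "0 < x" "x < y"
    have "((\<lambda>y::real. exp y - exp (- y) - 2 * y) has_real_derivative (exp x + exp (- x) - 2)) (at x)"
      by (auto intro!: derivative_eq_intros)
    moreover have "exp x + exp (- x) - 2 > 0"
    proof -
      have "exp (x / 2) \<noteq> exp (- x / 2)" using x by simp
      then have "(exp (x / 2) - exp (- x / 2))\<^sup>2 > 0" by simp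
      also have "(exp (x / 2) - exp (- x / 2))\<^sup>2 = exp x + exp (- x) - 2"
        unfolding power2_diff by (simp add: power2_eq_square flip: exp_add)
      finally show ?thesis .
    qed
    ultimately show "\<exists>z. ((\<lambda>y::real. exp y - exp (- y) - 2 * y) has_real_derivative z) (at x) \<and> 0 < z"
      by blast
  qed (intro continuous_intros)
  then show ?thesis by simp
qed


definition delta_quot :: "real \<Rightarrow> real \<Rightarrow> real" where
  "delta_quot \<epsilon> d = (1 - sqrt (d\<^sup>2 - \<epsilon>\<^sup>2)) / (1 - d) * exp (- d + sqrt (d\<^sup>2 - \<epsilon>\<^sup>2))"

text \<open>With \<open>s = sqrt (d^2 - \<epsilon>^2)\<close>, the logarithmic derivative is
  \<open>d * (d - s) / ((1 - d) * (1 - s))\<close>, positive because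
  \<open>s < d < 1\<close>.\<close>

lemma delta_quot_strict_mono:
  assumes \<epsilon>: "0 < \<epsilon>" "\<epsilon> < d" and d: "d < d'" "d' < 1"
  shows "delta_quot \<epsilon> d < delta_quot \<epsilon> d'"
proof -
  define L where "L = (\<lambda>d. ln (1 - sqrt (d\<^sup>2 - \<epsilon>\<^sup>2)) - ln (1 - d) + (- d + sqrt (d\<^sup>2 - \<epsilon>\<^sup>2)))"
  have rho: "0 < x\<^sup>2 - \<epsilon>\<^sup>2" "sqrt (x\<^sup>2 - \<epsilon>\<^sup>2) < x" if "\<epsilon> < x" "x < 1" for x
  proof -
    show 1: "0 < x\<^sup>2 - \<epsilon>\<^sup>2" using power_strict_mono[of \<epsilon> x 2] that \<epsilon> by simp
    have "\<epsilon>\<^sup>2 > 0" using \<epsilon> by simp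
    then show "sqrt (x\<^sup>2 - \<epsilon>\<^sup>2) < x" using that \<epsilon> by (intro real_less_lsqrt) auto
  qed
  have "L d < L d'"
  proof (rule DERIV_pos_imp_increasing[OF d(1)])
    fix x assume "d \<le> x" "x \<le> d'"
    then have x: "\<epsilon> < x" "x < 1" using \<epsilon> d by auto
    define s where "s = sqrt (x\<^sup>2 - \<epsilon>\<^sup>2)"
    have s: "0 < s" "s < x" using rho[OF x] by (auto simp: s_def)
    have ds: "((\<lambda>x. sqrt (x\<^sup>2 - \<epsilon>\<^sup>2)) has_real_derivative x / s) (at x)"
      using rho(1)[OF x] by (auto intro!: derivative_eq_intros simp: s_def field_simps)
    have "(ln has_real_derivative inverse (1 - s)) (at (1 - sqrt (x\<^sup>2 - \<epsilon>\<^sup>2)))"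
    proof -
      have "0 < 1 - s" using s x by linarith
      from DERIV_ln[OF this] show ?thesis by (simp add: s_def)
    qed
    from DERIV_chain2[OF this DERIV_diff[OF DERIV_const ds]]
    have "((\<lambda>x. ln (1 - sqrt (x\<^sup>2 - \<epsilon>\<^sup>2))) has_real_derivative inverse (1 - s) * (0 - x / s)) (at x)" .
    moreover have "((\<lambda>x. ln (1 - x)) has_real_derivative inverse (1 - x) * (- 1)) (at x)"
      using x by (auto intro!: derivative_eq_intros simp: field_simps)
    ultimately have "(L has_real_derivative
        (inverse (1 - s) * (0 - x / s) - inverse (1 - x) * (- 1) + (- 1 + x / s))) (at x)"
      unfolding L_def by (intro DERIV_add DERIV_diff DERIV_minus DERIV_ident ds)
    moreover have "inverse (1 - s) * (0 - x / s) - inverse (1 - x) * (- 1) + (- 1 + x / s)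
        = x * ((x - s) / ((1 - x) * (1 - s)))"
      using s x by (simp add: divide_simps) (simp add: algebra_simps)
    moreover have "x * ((x - s) / ((1 - x) * (1 - s))) > 0"
      using s x \<epsilon> by (intro mult_pos_pos divide_pos_pos) auto
    ultimately show "\<exists>y. (L has_real_derivative y) (at x) \<and> 0 < y" by metis
  qed
  moreover have "delta_quot \<epsilon> x = exp (L x)" if "\<epsilon> < x" "x < 1" for x
  proof -
    have "0 < 1 - sqrt (x\<^sup>2 - \<epsilon>\<^sup>2)" using rho[OF that] that by linarith
    then show ?thesis
      using that unfolding delta_quot_def L_def exp_add exp_diff by (simp only: exp_ln)
  qed
  ultimately show ?thesis using assms by simp
qed

text \<open>Dividing by the right-hand side gives \<open>\<alpha> * exp ((1 - \<alpha>) * \<epsilon>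
  / sqrt \<alpha>) < 1\<close>, whose logarithm is the hypothesis on \<epsilon>. So positivity of
  the denominator of \<open>K_const\<close> is the convergence condition of the geometric series of
  the lower bound.\<close>

lemma inverse_K_const_pos:
  assumes \<alpha>: "0 < \<alpha>" "\<alpha> < 1" and \<epsilon>: "\<epsilon> < sqrt \<alpha> / (1 - \<alpha>) * ln (1 / \<alpha>)"
  shows "\<alpha> * exp (\<epsilon> / sqrt \<alpha>) < exp (sqrt \<alpha> * \<epsilon>)"
proof -
  have sq: "sqrt \<alpha> * sqrt \<alpha> = \<alpha>" "sqrt \<alpha> > 0" using \<alpha> by auto
  have "\<epsilon> * (1 - \<alpha>) < sqrt \<alpha> * - ln \<alpha>" using \<epsilon> \<alpha> by (simp add: ln_div field_simps)
  then have "\<epsilon> * (1 - \<alpha>) / sqrt \<alpha> < - ln \<alpha>" using sq by (simp add: field_simps)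
  moreover have "\<epsilon> * (1 - \<alpha>) / sqrt \<alpha> = \<epsilon> / sqrt \<alpha> - sqrt \<alpha> * \<epsilon>"
    using sq by (simp add: field_simps)
  ultimately have "ln \<alpha> + \<epsilon> / sqrt \<alpha> < sqrt \<alpha> * \<epsilon>" by linarith
  then have "exp (ln \<alpha> + \<epsilon> / sqrt \<alpha>) < exp (sqrt \<alpha> * \<epsilon>)" by simp
  then show ?thesis using \<alpha> by (simp add: exp_add)
qed

text \<open>With \<open>y = ln (1 / sqrt \<alpha>)\<close> the left-hand side is
  \<open>y / sinh y\<close>.\<close>

lemma eps0_less_1:
  assumes \<alpha>: "0 < \<alpha>" "\<alpha> < 1"
  shows "sqrt \<alpha> / (1 - \<alpha>) * ln (1 / \<alpha>) < 1"
proof -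
  define y where "y = ln (1 / sqrt \<alpha>)"
  have s: "sqrt \<alpha> > 0" "sqrt \<alpha> < 1" "sqrt \<alpha> * sqrt \<alpha> = \<alpha>" using \<alpha> by auto
  have y: "y > 0" "exp y = 1 / sqrt \<alpha>" "exp (- y) = sqrt \<alpha>" using s by (auto simp: y_def exp_minus)
  have "ln (1 / \<alpha>) = 2 * y" using \<alpha> by (simp add: y_def ln_div ln_sqrt)
  also have "\<dots> < 1 / sqrt \<alpha> - sqrt \<alpha>" using sinh_bound[OF y(1)] by (simp add: y)
  also have "\<dots> = (1 - \<alpha>) / sqrt \<alpha>" using s by (simp add: field_simps)
  finally show ?thesis using s \<alpha> by (simp add: field_simps)
qed

text \<open>Compares \<open>1 / K_const\<close> with the reciprocal of \<open>delta_quot\<close> at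
  the lower end \<open>d = \<epsilon>\<close>. The difference of the two sides vanishes at 0. In its
  derivative the exponents \<open>x / t\<close> and \<open>t * x\<close> are \<open>c + y\<close>
  and \<open>c - y\<close>, with \<open>c > x\<close> by the arithmetic-geometric mean inequality,
  and \<open>sinh_bound\<close> handles y.\<close>

lemma inverse_K_const_less:
  assumes \<alpha>: "0 < \<alpha>" "\<alpha> < 1" and \<epsilon>: "0 < \<epsilon>"
  shows "exp (sqrt \<alpha> * \<epsilon>) - \<alpha> * exp (\<epsilon> / sqrt \<alpha>) < (1 - \<alpha>) * ((1 - \<epsilon>) * exp \<epsilon>)"
proof -
  define t where "t = sqrt \<alpha>"
  have t: "0 < t" "t < 1" "t * t = \<alpha>" using \<alpha> by (auto simp: t_def)
  define P where "P = (\<lambda>x. (1 - \<alpha>) * ((1 - x) * exp x) - exp (t * x) + \<alpha> * exp (x / t))"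
  have "P 0 < P \<epsilon>"
  proof (rule DERIV_pos_imp_increasing_open[OF \<epsilon>])
    fix x assume x: "0 < x" "x < \<epsilon>"
    define y where "y = x * (1 / t - t) / 2"
    define c where "c = x * (1 / t + t) / 2"
    have tt: "1 / t - t > 0" using t by (smt (verit) less_divide_eq_1_pos)
    have y: "y > 0" using tt x by (simp add: y_def)
    have c: "x < c"
    proof -
      have "0 < (1 - t)\<^sup>2" using t by simp
      then have "2 < 1 / t + t" using t by (simp add: power2_eq_square field_simps)
      then have "x * 2 < x * (1 / t + t)" using x by (intro mult_strict_left_mono) auto
      then show ?thesis by (simp add: c_def)
    qed
    have "(P has_real_derivative t * (exp (x / t) - exp (t * x)) - (1 - \<alpha>) * x * exp x) (at x)"
      unfolding P_def using t
      by (auto intro!: derivative_eq_intros simp: field_simps)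
    moreover have "t * (exp (x / t) - exp (t * x)) - (1 - \<alpha>) * x * exp x > 0"
    proof -
      have e: "x / t = c + y" "t * x = c + - y" by (auto simp: c_def y_def field_simps)
      have "(1 - \<alpha>) * x * exp x = t * (2 * y) * exp x" using t by (simp add: y_def field_simps)
      also have "\<dots> < t * (2 * y) * exp c" using c t y by simp
      also have "\<dots> < t * (exp y - exp (- y)) * exp c" using sinh_bound[OF y] t by simp
      also have "\<dots> = t * (exp (x / t) - exp (t * x))" unfolding e exp_add by (simp add: algebra_simps)
      finally show ?thesis by simp
    qed
    ultimately show "\<exists>y. (P has_real_derivative y) (at x) \<and> 0 < y" by blast
  qed (use t in \<open>auto simp: P_def intro!: continuous_intros\<close>)
  then show ?thesis by (simp add: P_def t_def)
qed

text \<open>For \<open>y < 1\<close> this is \<open>artanh y > y\<close>. It decides the comparison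
  at the upper limit for \<delta>.\<close>

lemma one_minus_exp_less:
  fixes y :: real
  assumes "0 < y"
  shows "(1 - y) * exp (2 * y) < 1 + y"
proof -
  define P where "P = (\<lambda>x::real. 1 + x - (1 - x) * exp (2 * x))"
  define P' where "P' = (\<lambda>x::real. 1 - exp (2 * x) + 2 * x * exp (2 * x))"
  have P': "P' x > 0" if "x > 0" for x
  proof -
    have "P' 0 < P' x"
    proof (rule DERIV_pos_imp_increasing_open[OF that])
      fix z :: real assume z: "0 < z" "z < x"
      have "(P' has_real_derivative 4 * z * exp (2 * z)) (at z)"
        unfolding P'_def by (auto intro!: derivative_eq_intros)
      then show "\<exists>y. (P' has_real_derivative y) (at z) \<and> 0 < y" using z by auto
    qed (auto simp: P'_def intro!: continuous_intros)
    then show ?thesis by (simp add: P'_def)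
  qed
  have "P 0 < P y"
  proof (rule DERIV_pos_imp_increasing_open[OF assms])
    fix z :: real assume z: "0 < z" "z < y"
    have "(P has_real_derivative P' z) (at z)"
      unfolding P_def P'_def by (auto intro!: derivative_eq_intros simp: algebra_simps)
    then show "\<exists>y. (P has_real_derivative y) (at z) \<and> 0 < y" using P'[OF z(1)] by auto
  qed (auto simp: P_def intro!: continuous_intros)
  then show ?thesis by (simp add: P_def)
qed

lemma delta_exists:
  assumes \<alpha>: "0 < \<alpha>" "\<alpha> < 1" and \<epsilon>: "0 < \<epsilon>" "\<epsilon> < sqrt \<alpha> / (1 - \<alpha>) * ln (1 / \<alpha>)"
  shows "\<exists>!d. \<epsilon> < d \<and> d < min 1 ((1 + \<alpha>) / (2 * sqrt \<alpha>) * \<epsilon>) \<and> delta_quot \<epsilon> d = K_const \<alpha> \<epsilon>"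
proof (rule ex_ex1I)
  define t where "t = sqrt \<alpha>"
  have t: "0 < t" "t < 1" "t * t = \<alpha>" using \<alpha> by (auto simp: t_def)
  define c where "c = (1 + \<alpha>) / (2 * t)"
  define u where "u = min 1 (c * \<epsilon>)"
  define E where "E = (exp (t * \<epsilon>) - \<alpha> * exp (\<epsilon> / t)) / (1 - \<alpha>)"
  \<comment> \<open>The reciprocal of \<open>delta_quot\<close>: it stays continuous, with value 0,
    at \<open>d = 1\<close>, where \<open>delta_quot\<close> has a pole. This allows the
    intermediate value theorem on the closed interval also when the upper limit is 1.\<close>
  define \<Psi> where "\<Psi> = (\<lambda>d. (1 - d) / (1 - sqrt (d\<^sup>2 - \<epsilon>\<^sup>2)) * exp (d - sqrt (d\<^sup>2 - \<epsilon>\<^sup>2)))"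
  have eps1: "\<epsilon> < 1" using eps0_less_1[OF \<alpha>] \<epsilon> by simp
  have E0: "E > 0" using inverse_K_const_pos[OF \<alpha> \<epsilon>(2)] \<alpha> by (simp add: E_def t_def)
  have c1: "c > 1"
  proof -
    have "0 < (1 - t)\<^sup>2" using t by simp
    then show ?thesis using t by (simp add: c_def power2_eq_square field_simps)
  qed
  have eu: "\<epsilon> < u" using eps1 c1 \<epsilon> by (simp add: u_def)
  have top: "E < \<Psi> \<epsilon>"
    using inverse_K_const_less[OF \<alpha> \<epsilon>(1)] \<alpha> by (simp add: E_def t_def \<Psi>_def divide_less_eq mult.commute)
  have bot: "\<Psi> u < E"
  proof (cases "c * \<epsilon> < 1")
    case False
    then show ?thesis using E0 by (simp add: u_def \<Psi>_def)
  next
    case True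
    \<comment> \<open>At \<open>d = c * \<epsilon>\<close> the root
      \<open>sqrt (d^2 - \<epsilon>^2)\<close> is rational in t: it is half of
      \<open>(1 - \<alpha>) * \<epsilon> / sqrt \<alpha>\<close>, the horizontal distance from the
      average to the right end of the extremal splitting.\<close>
    define \<rho> where "\<rho> = (1 / t - t) * \<epsilon> / 2"
    have u: "u = c * \<epsilon>" using True by (simp add: u_def)
    have "1 / t - t > 0" using t by (smt (verit) less_divide_eq_1_pos)
    then have r: "\<rho> > 0" using \<epsilon> by (simp add: \<rho>_def)
    have cr: "c * \<epsilon> = \<rho> + t * \<epsilon>" using t by (simp add: c_def \<rho>_def field_simps)
    have "(c * \<epsilon>)\<^sup>2 - \<epsilon>\<^sup>2 = \<rho>\<^sup>2"
      unfolding c_def \<rho>_def t(3)[symmetric] using t by (simp add: power2_eq_square field_simps)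
    then have s: "sqrt (u\<^sup>2 - \<epsilon>\<^sup>2) = \<rho>" using r by (simp add: u)
    have "t * \<epsilon> > 0" using t \<epsilon> by simp
    then have r1: "\<rho> < 1" using True cr by linarith
    have cr2: "c * \<epsilon> * (1 - \<alpha>) = \<rho> * (1 + \<alpha>)"
      unfolding c_def \<rho>_def t(3)[symmetric] using t by (simp add: field_simps)
    have et: "\<epsilon> / t = t * \<epsilon> + 2 * \<rho>" by (simp add: \<rho>_def field_simps)
    have "\<alpha> * ((1 - \<rho>) * exp (2 * \<rho>)) < \<alpha> * (1 + \<rho>)"
      using one_minus_exp_less[OF r] \<alpha> by simp
    then have "(1 - c * \<epsilon>) * (1 - \<alpha>) < (1 - \<rho>) * (1 - \<alpha> * exp (2 * \<rho>))"
      using cr2 by (simp add: algebra_simps)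
    then have "exp (t * \<epsilon>) * ((1 - c * \<epsilon>) * (1 - \<alpha>)) < exp (t * \<epsilon>) * ((1 - \<rho>) * (1 - \<alpha> * exp (2 * \<rho>)))"
      by simp
    also have "\<dots> = (1 - \<rho>) * (exp (t * \<epsilon>) - \<alpha> * exp (\<epsilon> / t))"
      unfolding et exp_add by (simp add: algebra_simps)
    finally have "exp (t * \<epsilon>) * ((1 - c * \<epsilon>) * (1 - \<alpha>)) < (1 - \<rho>) * (exp (t * \<epsilon>) - \<alpha> * exp (\<epsilon> / t))" .
    then have "(1 - c * \<epsilon>) / (1 - \<rho>) * exp (t * \<epsilon>) < E"
      using r1 \<alpha> by (simp add: E_def field_simps)
    moreover have "u - \<rho> = t * \<epsilon>" using cr u by simp
    ultimately show ?thesis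
      unfolding \<Psi>_def s by (simp only: u)
  qed
  have cont: "continuous_on {\<epsilon>..u} \<Psi>"
  proof -
    have "sqrt (x\<^sup>2 - \<epsilon>\<^sup>2) < 1" if "\<epsilon> \<le> x" "x \<le> u" for x
    proof -
      have "x\<^sup>2 \<le> 1\<^sup>2" using that \<epsilon> by (intro power_mono) (auto simp: u_def)
      moreover have "\<epsilon>\<^sup>2 > 0" using \<epsilon> by simp
      ultimately have "x\<^sup>2 - \<epsilon>\<^sup>2 < 1" unfolding power_one by linarith
      then show ?thesis by simp
    qed
    then show ?thesis unfolding \<Psi>_def by (intro continuous_intros) force
  qed
  obtain d where d: "\<epsilon> \<le> d" "d \<le> u" "\<Psi> d = E"
    using IVT2'[of \<Psi> u E \<epsilon>] cont top bot eu by auto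
  have "d \<noteq> \<epsilon>" "d \<noteq> u" using d top bot by auto
  then have d': "\<epsilon> < d" "d < u" using d by auto
  have "delta_quot \<epsilon> d = inverse (\<Psi> d)"
  proof -
    have "exp (- d + sqrt (d\<^sup>2 - \<epsilon>\<^sup>2)) = inverse (exp (d - sqrt (d\<^sup>2 - \<epsilon>\<^sup>2)))"
      by (simp flip: exp_minus)
    then show ?thesis unfolding delta_quot_def \<Psi>_def by (simp add: divide_inverse)
  qed
  also have "\<dots> = K_const \<alpha> \<epsilon>" unfolding d E_def K_const_def t_def by simp
  finally show "\<exists>d. \<epsilon> < d \<and> d < min 1 ((1 + \<alpha>) / (2 * sqrt \<alpha>) * \<epsilon>) \<and> delta_quot \<epsilon> d = K_const \<alpha> \<epsilon>"
    using d' unfolding u_def c_def t_def by blast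
next
  fix d d' assume "\<epsilon> < d \<and> d < min 1 ((1 + \<alpha>) / (2 * sqrt \<alpha>) * \<epsilon>) \<and> delta_quot \<epsilon> d = K_const \<alpha> \<epsilon>"
    "\<epsilon> < d' \<and> d' < min 1 ((1 + \<alpha>) / (2 * sqrt \<alpha>) * \<epsilon>) \<and> delta_quot \<epsilon> d' = K_const \<alpha> \<epsilon>"
  then show "d = d'"
    using delta_quot_strict_mono[OF \<epsilon>(1), of d d'] delta_quot_strict_mono[OF \<epsilon>(1), of d' d]
    by (metis less_irrefl linorder_neqE_linordered_idom min_less_iff_conj)
qed

lemma delta_bellman_data:
  assumes \<alpha>: "0 < \<alpha>" "\<alpha> \<le> 1 / 2" and \<epsilon>: "0 < \<epsilon>" "\<epsilon> < sqrt \<alpha> / (1 - \<alpha>) * ln (1 / \<alpha>)"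
  shows "bellman_data \<alpha> \<epsilon> (delta \<alpha> \<epsilon>) (sqrt ((delta \<alpha> \<epsilon>)\<^sup>2 - \<epsilon>\<^sup>2))"
proof -
  define d where "d = delta \<alpha> \<epsilon>"
  define r where "r = sqrt (d\<^sup>2 - \<epsilon>\<^sup>2)"
  have a1: "\<alpha> < 1" using \<alpha> by simp
  have d: "\<epsilon> < d \<and> d < min 1 ((1 + \<alpha>) / (2 * sqrt \<alpha>) * \<epsilon>) \<and> delta_quot \<epsilon> d = K_const \<alpha> \<epsilon>"
    unfolding d_def delta_def delta_quot_def[symmetric]
    by (rule theI'[OF delta_exists[OF \<alpha>(1) a1 \<epsilon>]])
  have "(1 + \<alpha>) / (2 * sqrt \<alpha>) * \<epsilon> \<le> \<epsilon> / sqrt \<alpha>"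
    using \<alpha> \<epsilon> by (simp add: field_simps)
  then have d_le: "d \<le> \<epsilon> / sqrt \<alpha>" using d by linarith
  have s: "sqrt \<alpha> * sqrt \<alpha> = \<alpha>" "sqrt \<alpha> > 0" using \<alpha> by auto
  define Den where "Den = exp (sqrt \<alpha> * \<epsilon>) - \<alpha> * exp (\<epsilon> / sqrt \<alpha>)"
  have Den: "Den > 0" using inverse_K_const_pos[OF \<alpha>(1) a1 \<epsilon>(2)] by (simp add: Den_def)
  have "(1 - r) / (1 - d) * exp (- d + r) = (1 - \<alpha>) / Den"
    using d by (simp add: delta_quot_def K_const_def r_def Den_def)
  then have "(1 - r) * exp (- d + r) * Den = (1 - \<alpha>) * (1 - d)"
    using Den d by (simp add: field_simps)
  \<comment> \<open>The factor is the exponential at the left end of the extremal splitting, at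
    first coordinate \<open>- \<alpha> * (\<epsilon> / sqrt \<alpha>)\<close> with root d. It turns
    the quotient equation into the equality case \<open>K\<close>.\<close>
  then have K1: "exp (d - sqrt \<alpha> * \<epsilon>) * ((1 - r) * exp (- d + r) * Den) = exp (d - sqrt \<alpha> * \<epsilon>) * ((1 - \<alpha>) * (1 - d))"
    by simp
  have e1: "exp (d - sqrt \<alpha> * \<epsilon>) * exp (- d + r) * exp (sqrt \<alpha> * \<epsilon>) = exp r"
    unfolding exp_add[symmetric] by simp
  have x1: "(1 - \<alpha>) * (\<epsilon> / sqrt \<alpha>) = \<epsilon> / sqrt \<alpha> - sqrt \<alpha> * \<epsilon>"
    and x2: "- \<alpha> * (\<epsilon> / sqrt \<alpha>) = - (sqrt \<alpha> * \<epsilon>)"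
    using s by (simp_all add: field_simps)
  have e2: "exp (d - sqrt \<alpha> * \<epsilon>) * exp (- d + r) * exp (\<epsilon> / sqrt \<alpha>) = exp ((1 - \<alpha>) * (\<epsilon> / sqrt \<alpha>) + r)"
    unfolding exp_add[symmetric] x1 by simp
  have e3: "exp (- \<alpha> * (\<epsilon> / sqrt \<alpha>) + d) = exp (d - sqrt \<alpha> * \<epsilon>)" unfolding x2 by simp
  have "exp (d - sqrt \<alpha> * \<epsilon>) * ((1 - r) * exp (- d + r) * Den)
     = (exp (d - sqrt \<alpha> * \<epsilon>) * exp (- d + r) * exp (sqrt \<alpha> * \<epsilon>)) * (1 - r)
      - \<alpha> * ((exp (d - sqrt \<alpha> * \<epsilon>) * exp (- d + r) * exp (\<epsilon> / sqrt \<alpha>)) * (1 - r))"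
    unfolding Den_def by (simp add: algebra_simps)
  also have "\<dots> = exp r * (1 - r) - \<alpha> * (exp ((1 - \<alpha>) * (\<epsilon> / sqrt \<alpha>) + r) * (1 - r))"
    unfolding e1 e2 ..
  finally have "exp r * (1 - r) = \<alpha> * (exp ((1 - \<alpha>) * (\<epsilon> / sqrt \<alpha>) + r) * (1 - r))
      + (1 - \<alpha>) * (exp (- \<alpha> * (\<epsilon> / sqrt \<alpha>) + d) * (1 - d))"
    unfolding e3 using K1 by (simp add: algebra_simps)
  then show ?thesis
    using \<alpha> \<epsilon> d d_le unfolding d_def[symmetric] r_def[symmetric]
    by unfold_locales (auto simp: r_def)
qed

section \<open>Dyadic cubes and averages\<close>

text \<open>As a fibre of the coordinatewise floor map, a cube is disjoint from the other cubes of
  its level by construction, and passing to the parent is integer division by 2.\<close>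

definition dcube :: "int \<Rightarrow> ('n \<Rightarrow> int) \<Rightarrow> (real ^ 'n) set" where
  "dcube m k = {t. \<forall>i. \<lfloor>t $ i * 2 powi m\<rfloor> = k i}"

lemma dcube_alt:
  "dcube m k = {t::real ^ 'n. \<forall>i. of_int (k i) * 2 powi (- m) \<le> t $ i \<and>
    t $ i < (of_int (k i) + 1) * 2 powi (- m)}"
  by (auto simp: dcube_def floor_eq_iff power_int_minus field_simps)

lemma dyadic_cube_iff: "dyadic_cube J \<longleftrightarrow> (\<exists>m k. J = dcube m k)"
  by (simp add: dyadic_cube_def dcube_alt)

text \<open>S collects the coordinates in which the child takes the upper half, so the children are
  indexed by the type \<open>'n set\<close> with its \<open>2 ^ CARD('n)\<close> elements.\<close>

definition child_index :: "('n \<Rightarrow> int) \<Rightarrow> 'n set \<Rightarrow> 'n \<Rightarrow> int" where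
  "child_index k S = (\<lambda>i. 2 * k i + of_bool (i \<in> S))"

lemma floor_double_div_2: "\<lfloor>x * 2 powi (m + 1)\<rfloor> div 2 = \<lfloor>x * 2 powi m\<rfloor>" for x :: real
proof -
  have "\<lfloor>x * 2 powi (m + 1) / of_int 2\<rfloor> = \<lfloor>x * 2 powi (m + 1)\<rfloor> div 2"
    by (rule floor_divide_real_eq_div) simp
  then show ?thesis by (simp add: power_int_add)
qed

lemma mem_child_iff:
  "t \<in> dcube (m + 1) (child_index k S) \<longleftrightarrow>
    t \<in> dcube m k \<and> S = {i. odd \<lfloor>t $ i * 2 powi (m + 1)\<rfloor>}"
proof -
  have "a = 2 * b + of_bool P \<longleftrightarrow> a div 2 = b \<and> (P \<longleftrightarrow> odd a)" for a b :: int and P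
    by (cases P; simp; presburger)
  then show ?thesis
    by (auto simp: dcube_def child_index_def floor_double_div_2)
qed

lemma dcube_eq_UN_children: "dcube m k = (\<Union>S. dcube (m + 1) (child_index k S))"
  by (auto simp: mem_child_iff)

lemma child_subset: "dcube (m + 1) (child_index k S) \<subseteq> dcube m k"
  by (auto simp: mem_child_iff)

lemma disjoint_children: "disjoint_family (\<lambda>S. dcube (m + 1) (child_index k S))"
  by (auto simp: disjoint_family_on_def mem_child_iff)

lemma floor_level_mono:
  fixes x y :: real
  assumes "m \<le> m'" "\<lfloor>x * 2 powi m'\<rfloor> = \<lfloor>y * 2 powi m'\<rfloor>"
  shows "\<lfloor>x * 2 powi m\<rfloor> = \<lfloor>y * 2 powi m\<rfloor>"
  using assms
proof (induction m' rule: int_ge_induct)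
  case (step i)
  then show ?case by (metis floor_double_div_2)
qed auto

lemma sets_dcube [measurable, simp]: "dcube m k \<in> sets borel"
proof -
  have "dcube m k = (\<Inter>i. {t. of_int (k i) * 2 powi (- m) \<le> t $ i} \<inter>
    {t. t $ i < (of_int (k i) + 1) * 2 powi (- m)})"
    by (auto simp: dcube_alt)
  moreover have "{t::real ^ 'a. c \<le> t $ i} \<in> sets borel" for c i
    by (intro borel_closed closed_Collect_le continuous_intros)
  moreover have "{t::real ^ 'a. t $ i < c} \<in> sets borel" for c i
    by (intro borel_open open_Collect_less continuous_intros)
  ultimately show ?thesis by auto
qed

lemma sets_dcube_lebesgue [measurable, simp]: "dcube m k \<in> sets lebesgue"
  using sets_dcube by (auto simp: sets_completionI_sets)

lemma dcube_bounds:
  fixes k :: "'n::finite \<Rightarrow> int" and m :: int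
  defines "a \<equiv> (\<chi> i. of_int (k i) * 2 powi (- m)) :: real ^ 'n"
    and "b \<equiv> (\<chi> i. (of_int (k i) + 1) * 2 powi (- m)) :: real ^ 'n"
  shows "box a b \<subseteq> dcube m k" "dcube m k \<subseteq> cbox a b"
  by (auto simp: dcube_alt mem_box_cart a_def b_def less_imp_le)

lemma emeasure_dcube:
  "emeasure lebesgue (dcube m k :: (real ^ 'n) set) = ennreal ((2 powi (- m)) ^ CARD('n))"
proof -
  define a :: "real ^ 'n" where "a = (\<chi> i. of_int (k i) * 2 powi (- m))"
  define b :: "real ^ 'n" where "b = (\<chi> i. (of_int (k i) + 1) * 2 powi (- m))"
  have le: "a \<bullet> i \<le> b \<bullet> i" if "i \<in> Basis" for i
    using that by (auto simp: Basis_vec_def a_def b_def inner_axis algebra_simps)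
  have ne: "cbox a b \<noteq> {}" using le by (simp add: box_ne_empty)
  have "measure lborel (cbox a b) = (\<Prod>i\<in>UNIV. b $ i - a $ i)"
    by (rule content_cbox_cart[OF ne])
  also have "\<dots> = (2 powi (- m)) ^ CARD('n)" by (simp add: a_def b_def algebra_simps)
  finally have c: "emeasure lborel (cbox a b) = ennreal ((2 powi (- m)) ^ CARD('n))"
    using emeasure_lborel_cbox_finite[of a b] by (subst emeasure_eq_ennreal_measure) auto
  have d: "emeasure lborel (box a b) = emeasure lborel (cbox a b)"
    using le by (simp add: emeasure_lborel_box_eq emeasure_lborel_cbox_eq)
  have "emeasure lborel (box a b) \<le> emeasure lborel (dcube m k)"
    using dcube_bounds(1)[where k = k and m = m] by (intro emeasure_mono) (auto simp: a_def b_def)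
  moreover have "emeasure lborel (dcube m k) \<le> emeasure lborel (cbox a b)"
    using dcube_bounds(2)[where k = k and m = m] by (intro emeasure_mono) (auto simp: a_def b_def)
  ultimately have "emeasure lborel (dcube m k) = ennreal ((2 powi (- m)) ^ CARD('n))"
    using c d by (metis antisym)
  then show ?thesis by simp
qed

lemma measure_dcube: "measure lebesgue (dcube m k :: (real ^ 'n) set) = (2 powi (- m)) ^ CARD('n)"
  by (simp add: measure_def emeasure_dcube)

lemma measure_dcube_pos [simp]: "measure lebesgue (dcube m k :: (real ^ 'n) set) > 0"
  by (simp add: measure_dcube)

lemma emeasure_dcube_measure:
  "emeasure lebesgue (dcube m k :: (real ^ 'n) set) = ennreal (measure lebesgue (dcube m k))"
  by (simp add: measure_dcube emeasure_dcube)

lemma measure_child: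
  "measure lebesgue (dcube m k :: (real ^ 'n) set) =
    2 ^ CARD('n) * measure lebesgue (dcube (m + 1) k' :: (real ^ 'n) set)"
proof -
  have "(2::real) powi (- m) = 2 * 2 powi (- (m + 1))"
    using power_int_add[of "2::real" 1 "- (m + 1)"] by simp
  then show ?thesis by (simp only: measure_dcube power_mult_distrib)
qed

lemma dcube_nonempty: "dcube m k \<noteq> {}"
  using measure_dcube_pos[of m k] by (metis less_irrefl measure_empty)

text \<open>Volumes show that the subcube has level at least m. For a larger level, any of its
  points selects the child, because equal floors at a fine level are equal at every coarser one.
  Conditions on all subcubes thus reduce to the cube itself and the subcubes of its
  children.\<close>

lemma subcube_cases:
  fixes k k' :: "'n::finite \<Rightarrow> int"
  assumes sub: "dcube m' k' \<subseteq> dcube m k"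
  obtains "m' = m" "k' = k" | S where "m < m'" "dcube m' k' \<subseteq> dcube (m + 1) (child_index k S)"
proof -
  obtain t where t: "t \<in> dcube m' k'" "t \<in> dcube m k" using dcube_nonempty sub by blast
  have "measure lebesgue (dcube m' k') \<le> measure lebesgue (dcube m k)"
    using sub by (intro measure_mono_fmeasurable) (auto simp: fmeasurable_def emeasure_dcube)
  then have "(2::real) powi (- m') \<le> 2 powi (- m)"
    unfolding measure_dcube by (simp add: power_mono_iff)
  then have "m \<le> m'"
    using power_int_strict_increasing[of "- m" "- m'" "2::real"] by force
  show ?thesis
  proof (cases "m' = m")
    case True
    then show ?thesis using t that(1) by (auto simp: dcube_def)
  next
    case False
    with \<open>m \<le> m'\<close> have "m + 1 \<le> m'" by simp
    obtain S where S: "t \<in> dcube (m + 1) (child_index k S)" using t dcube_eq_UN_children by blast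
    have "dcube m' k' \<subseteq> dcube (m + 1) (child_index k S)"
    proof
      fix s assume "s \<in> dcube m' k'"
      then have "\<lfloor>s $ i * 2 powi m'\<rfloor> = \<lfloor>t $ i * 2 powi m'\<rfloor>" for i using t by (simp add: dcube_def)
      then have "\<lfloor>s $ i * 2 powi (m + 1)\<rfloor> = \<lfloor>t $ i * 2 powi (m + 1)\<rfloor>" for i
        using floor_level_mono[OF \<open>m + 1 \<le> m'\<close>] by blast
      then show "s \<in> dcube (m + 1) (child_index k S)" using S by (simp add: dcube_def)
    qed
    then show ?thesis using that(2) False \<open>m \<le> m'\<close> by auto
  qed
qed

section \<open>Averages over cubes and the BMO condition\<close>

lemma avg_cong: "(\<And>t. t \<in> J \<Longrightarrow> f t = g t) \<Longrightarrow> avg J f = avg J g"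
  unfolding avg_def set_lebesgue_integral_def
  by (auto intro!: arg_cong2[where f = "(/)"] Bochner_Integration.integral_cong simp: indicator_def)

lemma set_nn_integral_cong':
  "(\<And>t. t \<in> J \<Longrightarrow> f t = g t) \<Longrightarrow> (\<integral>\<^sup>+t\<in>J. f t \<partial>M) = (\<integral>\<^sup>+t\<in>J. g t \<partial>M)"
  by (auto intro!: nn_integral_cong simp: indicator_def)

lemma nn_avg_cong: "(\<And>t. t \<in> J \<Longrightarrow> f t = g t) \<Longrightarrow> nn_avg J f = nn_avg J g"
  unfolding nn_avg_def by (intro arg_cong2[where f = "(/)"] set_nn_integral_cong') auto

lemma set_integrable_cong':
  "(\<And>t. t \<in> J \<Longrightarrow> f t = g t) \<Longrightarrow> set_integrable M J f \<longleftrightarrow> set_integrable M J g"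
  unfolding set_integrable_def by (auto intro!: Bochner_Integration.integrable_cong simp: indicator_def)

lemma mean_osc_cong:
  assumes "\<And>t. t \<in> J \<Longrightarrow> f t = g t"
  shows "mean_osc J f = mean_osc J g"
proof -
  have "nn_avg J (\<lambda>t. \<bar>f t - avg J f\<bar>\<^sup>2) = nn_avg J (\<lambda>t. \<bar>g t - avg J g\<bar>\<^sup>2)"
    using assms by (intro nn_avg_cong) (simp add: avg_cong[OF assms])
  then show ?thesis by (simp add: mean_osc_def)
qed

lemma BMO_d_cong:
  assumes "\<And>t. t \<in> Q \<Longrightarrow> f t = g t"
  shows "f \<in> BMO_d Q \<epsilon> \<longleftrightarrow> g \<in> BMO_d Q \<epsilon>"
proof -
  have "mean_osc J f = mean_osc J g" if "J \<in> dyadic_subcubes Q" for J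
    using that assms by (intro mean_osc_cong) (auto simp: dyadic_subcubes_def)
  then have "(SUP J\<in>dyadic_subcubes Q. mean_osc J f) = (SUP J\<in>dyadic_subcubes Q. mean_osc J g)"
    by (intro SUP_cong) auto
  then show ?thesis using set_integrable_cong'[of Q f g lebesgue, OF assms] by (simp add: BMO_d_def)
qed

lemma set_integrable_const [simp]: "set_integrable lebesgue (dcube m k) (\<lambda>t. c :: real)"
  by (simp add: set_integrable_def emeasure_dcube)

lemma avg_const [simp]: "avg (dcube m k) (\<lambda>t. c) = c"
  unfolding avg_def using measure_dcube_pos[of m k]
  by (subst set_integral_const) (simp_all add: emeasure_dcube)

lemma set_integrable_subcube:
  "set_integrable lebesgue J f \<Longrightarrow> dcube m k \<subseteq> J \<Longrightarrow> set_integrable lebesgue (dcube m k) f"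
  for f :: "real ^ 'n \<Rightarrow> real"
  by (erule set_integrable_subset) (rule sets_dcube_lebesgue)

lemma set_integral_dcube: "(LINT t:dcube m k|lebesgue. f t) = measure lebesgue (dcube m k) * avg (dcube m k) f"
  unfolding avg_def using measure_dcube_pos[of m k]
  by (metis less_irrefl nonzero_mult_div_cancel_left times_divide_eq_right)

lemma measure_child_eq:
  "measure lebesgue (dcube (m + 1) (child_index k S)) =
    measure lebesgue (dcube m k :: (real ^ 'n) set) / 2 ^ CARD('n)"
  unfolding measure_child[of m k "child_index k S"]
  by (rule nonzero_mult_div_cancel_left[symmetric]) simp

lemma set_integral_children:
  fixes f :: "real ^ 'n \<Rightarrow> real"
  assumes "set_integrable lebesgue (dcube m k) f"
  shows "(LINT t:dcube m k|lebesgue. f t) = (\<Sum>S\<in>UNIV. LINT t:dcube (m + 1) (child_index k S)|lebesgue. f t)"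
proof -
  have "set_integrable lebesgue (dcube (m + 1) (child_index k S)) f" for S
    using assms child_subset by (rule set_integrable_subcube)
  then have "(LINT t:(\<Union>S. dcube (m + 1) (child_index k S))|lebesgue. f t)
      = (\<Sum>S\<in>UNIV. LINT t:dcube (m + 1) (child_index k S)|lebesgue. f t)"
    using disjoint_children by (intro set_integral_finite_Union) auto
  then show ?thesis unfolding dcube_eq_UN_children[of m k, symmetric] .
qed

lemma avg_children:
  fixes f :: "real ^ 'n \<Rightarrow> real"
  assumes "set_integrable lebesgue (dcube m k) f"
  shows "avg (dcube m k) f = (\<Sum>S\<in>UNIV. avg (dcube (m + 1) (child_index k S)) f) / 2 ^ CARD('n)"
proof -
  have "measure lebesgue (dcube m k) * avg (dcube m k) f =
      (\<Sum>S\<in>UNIV. measure lebesgue (dcube m k) / 2 ^ CARD('n) * avg (dcube (m + 1) (child_index k S)) f)"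
    using set_integral_children[OF assms] unfolding set_integral_dcube measure_child_eq .
  also have "\<dots> = measure lebesgue (dcube m k) * ((\<Sum>S\<in>UNIV. avg (dcube (m + 1) (child_index k S)) f) / 2 ^ CARD('n))"
    unfolding sum_distrib_left[symmetric] by simp
  finally show ?thesis using measure_dcube_pos[of m k] by (metis less_irrefl mult_left_cancel)
qed

lemma nn_integral_children:
  fixes f :: "real ^ 'n \<Rightarrow> ennreal"
  assumes [measurable]: "f \<in> borel_measurable lebesgue"
  shows "(\<integral>\<^sup>+t\<in>dcube m k. f t \<partial>lebesgue) = (\<Sum>S\<in>UNIV. \<integral>\<^sup>+t\<in>dcube (m + 1) (child_index k S). f t \<partial>lebesgue)"
proof -
  have "indicator (dcube m k) t = (\<Sum>S\<in>UNIV. indicator (dcube (m + 1) (child_index k S)) t :: ennreal)" for t :: "real ^ 'n"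
    unfolding dcube_eq_UN_children[of m k]
    using disjoint_children[of m k] by (intro indicator_UN_disjoint) auto
  then have "(\<integral>\<^sup>+t\<in>dcube m k. f t \<partial>lebesgue)
      = (\<integral>\<^sup>+t. (\<Sum>S\<in>UNIV. f t * indicator (dcube (m + 1) (child_index k S)) t) \<partial>lebesgue)"
    by (simp add: sum_distrib_left)
  also have "\<dots> = (\<Sum>S\<in>UNIV. \<integral>\<^sup>+t\<in>dcube (m + 1) (child_index k S). f t \<partial>lebesgue)"
    by (rule nn_integral_sum) measurable
  finally show ?thesis .
qed

definition pt :: "(real ^ 'n) set \<Rightarrow> (real ^ 'n \<Rightarrow> real) \<Rightarrow> real \<times> real" where
  "pt J \<phi> = (avg J \<phi>, avg J (\<lambda>t. (\<phi> t)\<^sup>2))"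

lemma pt_cong: "(\<And>t. t \<in> J \<Longrightarrow> f t = g t) \<Longrightarrow> pt J f = pt J g"
  unfolding pt_def by (auto intro!: avg_cong)

lemma pt_children:
  fixes \<phi> :: "real ^ 'n \<Rightarrow> real"
  assumes "set_integrable lebesgue (dcube m k) \<phi>" "set_integrable lebesgue (dcube m k) (\<lambda>t. (\<phi> t)\<^sup>2)"
  shows "pt (dcube m k) \<phi> = (1 / 2 ^ CARD('n)) *\<^sub>R (\<Sum>S\<in>UNIV. pt (dcube (m + 1) (child_index k S)) \<phi>)"
  by (simp add: prod_eq_iff pt_def fst_sum snd_sum avg_children[OF assms(1)] avg_children[OF assms(2)])

lemma variance_integral:
  fixes \<phi> :: "real ^ 'n \<Rightarrow> real"
  assumes "set_integrable lebesgue (dcube m k) \<phi>" "set_integrable lebesgue (dcube m k) (\<lambda>t. (\<phi> t)\<^sup>2)"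
  defines "c \<equiv> avg (dcube m k) \<phi>"
  shows "set_integrable lebesgue (dcube m k) (\<lambda>t. (\<phi> t - c)\<^sup>2)"
    and "(LINT t:dcube m k|lebesgue. (\<phi> t - c)\<^sup>2) =
      measure lebesgue (dcube m k) * (avg (dcube m k) (\<lambda>t. (\<phi> t)\<^sup>2) - c\<^sup>2)"
proof -
  let ?J = "dcube m k :: (real ^ 'n) set"
  have eq: "(\<lambda>t. (\<phi> t - c)\<^sup>2) = (\<lambda>t. (\<phi> t)\<^sup>2 + (- 2 * c * \<phi> t + c\<^sup>2))"
    by (auto simp: power2_eq_square algebra_simps)
  have i1: "set_integrable lebesgue ?J (\<lambda>t. - 2 * c * \<phi> t)"
    using assms(1) by (intro set_integrable_mult_right)
  have i2: "set_integrable lebesgue ?J (\<lambda>t. - 2 * c * \<phi> t + c\<^sup>2)"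
    using set_integral_add(1)[OF i1 set_integrable_const[of m k "c\<^sup>2"]] .
  show "set_integrable lebesgue ?J (\<lambda>t. (\<phi> t - c)\<^sup>2)"
    unfolding eq using assms(2) i2 by (rule set_integral_add(1))
  have "(LINT t:?J|lebesgue. (\<phi> t - c)\<^sup>2) = (LINT t:?J|lebesgue. (\<phi> t)\<^sup>2) +
      ((LINT t:?J|lebesgue. - 2 * c * \<phi> t) + (LINT t:?J|lebesgue. c\<^sup>2))"
    unfolding eq set_integral_add(2)[OF assms(2) i2]
      set_integral_add(2)[OF i1 set_integrable_const[of m k "c\<^sup>2"]] ..
  also have "\<dots> = (LINT t:?J|lebesgue. (\<phi> t)\<^sup>2) +
      (- 2 * c * (LINT t:?J|lebesgue. \<phi> t) + (LINT t:?J|lebesgue. c\<^sup>2))"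
    by (simp only: set_integral_mult_right)
  also have "\<dots> = measure lebesgue ?J * (avg ?J (\<lambda>t. (\<phi> t)\<^sup>2) - c\<^sup>2)"
    unfolding set_integral_dcube avg_const unfolding c_def[symmetric]
    by (simp add: power2_eq_square algebra_simps)
  finally show "(LINT t:?J|lebesgue. (\<phi> t - c)\<^sup>2) = measure lebesgue ?J * (avg ?J (\<lambda>t. (\<phi> t)\<^sup>2) - c\<^sup>2)" .
qed

lemma avg_sq_ge:
  assumes "set_integrable lebesgue (dcube m k) \<phi>" "set_integrable lebesgue (dcube m k) (\<lambda>t. (\<phi> t)\<^sup>2)"
  shows "(avg (dcube m k) \<phi>)\<^sup>2 \<le> avg (dcube m k) (\<lambda>t. (\<phi> t)\<^sup>2)"
proof -
  have "0 \<le> (LINT t:dcube m k|lebesgue. (\<phi> t - avg (dcube m k) \<phi>)\<^sup>2)"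
    unfolding set_lebesgue_integral_def by (intro Bochner_Integration.integral_nonneg) auto
  then show ?thesis
    using measure_dcube_pos[of m k] unfolding variance_integral(2)[OF assms]
    by (simp add: zero_le_mult_iff del: measure_dcube_pos) 
qed

lemma set_integrable_of_nn_integral:
  assumes "f \<in> borel_measurable M" "A \<in> sets M" "\<And>t. f t \<ge> 0" "(\<integral>\<^sup>+t\<in>A. ennreal (f t) \<partial>M) < \<infinity>"
  shows "set_integrable M A f"
  unfolding set_integrable_def
proof (rule integrableI_bounded)
  have "(\<integral>\<^sup>+t. ennreal (norm (indicator A t *\<^sub>R f t)) \<partial>M) = (\<integral>\<^sup>+t\<in>A. ennreal (f t) \<partial>M)"
    using assms(3) by (intro nn_integral_cong) (auto simp: indicator_def)
  then show "(\<integral>\<^sup>+t. ennreal (norm (indicator A t *\<^sub>R f t)) \<partial>M) < \<infinity>" using assms(4) by simp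
qed (use assms in measurable)

lemma nn_integral_eq_set_integral:
  fixes f :: "'a \<Rightarrow> real"
  assumes "set_integrable M A f" "\<And>t. f t \<ge> 0"
  shows "(\<integral>\<^sup>+t\<in>A. ennreal (f t) \<partial>M) = ennreal (LINT t:A|M. f t)"
proof -
  have "(\<integral>\<^sup>+t\<in>A. ennreal (f t) \<partial>M) = (\<integral>\<^sup>+t. ennreal (indicator A t *\<^sub>R f t) \<partial>M)"
    by (intro nn_integral_cong) (auto simp: indicator_def)
  also have "\<dots> = ennreal (LINT t:A|M. f t)"
    using assms unfolding set_integrable_def set_lebesgue_integral_def
    by (intro nn_integral_eq_integral) auto
  finally show ?thesis .
qed

text \<open>A finite second moment of \<phi> about its mean already gives square integrability,
  since \<phi> is integrable and the cube has finite measure. The oscillation is then the root of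
  the variance: its bound is the upper boundary of \<open>Omega\<close>, its nonnegativity the lower
  one.\<close>

lemma mean_osc_le_iff:
  fixes \<phi> :: "real ^ 'n \<Rightarrow> real"
  assumes [measurable]: "\<phi> \<in> borel_measurable lebesgue"
    and int: "set_integrable lebesgue (dcube m k) \<phi>" and \<epsilon>: "\<epsilon> > 0"
  shows "mean_osc (dcube m k) \<phi> \<le> ereal \<epsilon> \<longleftrightarrow>
    set_integrable lebesgue (dcube m k) (\<lambda>t. (\<phi> t)\<^sup>2) \<and> pt (dcube m k) \<phi> \<in> Omega \<epsilon>"
proof -
  let ?J = "dcube m k :: (real ^ 'n) set"
  define c where "c = avg ?J \<phi>"
  define \<mu> where "\<mu> = measure lebesgue ?J"
  have mu: "\<mu> > 0" unfolding \<mu>_def by (rule measure_dcube_pos)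
  define I where "I = (\<integral>\<^sup>+t\<in>?J. ennreal ((\<phi> t - c)\<^sup>2) \<partial>lebesgue)"
  have v: "nn_avg ?J (\<lambda>t. \<bar>\<phi> t - avg ?J \<phi>\<bar>\<^sup>2) = I / ennreal \<mu>"
    by (simp add: nn_avg_def I_def c_def \<mu>_def emeasure_dcube_measure)
  have sq: "set_integrable lebesgue ?J (\<lambda>t. (\<phi> t)\<^sup>2)" if "I < \<infinity>"
  proof -
    have "set_integrable lebesgue ?J (\<lambda>t. (\<phi> t - c)\<^sup>2)"
      using that unfolding I_def by (intro set_integrable_of_nn_integral) auto
    moreover have "set_integrable lebesgue ?J (\<lambda>t. 2 * c * \<phi> t - c\<^sup>2)"
      using int by (intro set_integral_diff(1)) auto
    ultimately have "set_integrable lebesgue ?J (\<lambda>t. (\<phi> t - c)\<^sup>2 + (2 * c * \<phi> t - c\<^sup>2))"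
      by (rule set_integral_add(1))
    moreover have "(\<lambda>t. (\<phi> t - c)\<^sup>2 + (2 * c * \<phi> t - c\<^sup>2)) = (\<lambda>t. (\<phi> t)\<^sup>2)"
      by (auto simp: power2_eq_square algebra_simps)
    ultimately show ?thesis by simp
  qed
  have osc: "mean_osc ?J \<phi> = ereal (sqrt (avg ?J (\<lambda>t. (\<phi> t)\<^sup>2) - c\<^sup>2))"
    if int2: "set_integrable lebesgue ?J (\<lambda>t. (\<phi> t)\<^sup>2)"
  proof -
    have ge: "avg ?J (\<lambda>t. (\<phi> t)\<^sup>2) - c\<^sup>2 \<ge> 0" using avg_sq_ge[OF int int2] by (simp add: c_def)
    have "I = ennreal (LINT t:?J|lebesgue. (\<phi> t - c)\<^sup>2)"
      unfolding I_def using variance_integral(1)[OF int int2]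
      by (intro nn_integral_eq_set_integral) (auto simp: c_def)
    also have "\<dots> = ennreal (\<mu> * (avg ?J (\<lambda>t. (\<phi> t)\<^sup>2) - c\<^sup>2))"
      using variance_integral(2)[OF int int2] by (simp add: c_def \<mu>_def)
    finally have "I / ennreal \<mu> = ennreal (avg ?J (\<lambda>t. (\<phi> t)\<^sup>2) - c\<^sup>2)"
      using mu ge by (simp add: divide_ennreal)
    then show ?thesis unfolding mean_osc_def v using ge by simp
  qed
  show ?thesis
  proof
    assume le: "mean_osc ?J \<phi> \<le> ereal \<epsilon>"
    have "I / ennreal \<mu> \<noteq> \<infinity>"
      using le unfolding mean_osc_def v by (auto simp: Let_def)
    then have "I \<noteq> \<infinity>" using mu by (auto simp: ennreal_top_divide)
    then have "I < \<infinity>" by (simp add: less_top)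
    note int2 = sq[OF this]
    have "sqrt (avg ?J (\<lambda>t. (\<phi> t)\<^sup>2) - c\<^sup>2) \<le> \<epsilon>" using le osc[OF int2] by simp
    then have "avg ?J (\<lambda>t. (\<phi> t)\<^sup>2) - c\<^sup>2 \<le> \<epsilon>\<^sup>2"
      using \<epsilon> by (simp add: real_sqrt_le_iff' sqrt_le_D)
    then show "set_integrable lebesgue ?J (\<lambda>t. (\<phi> t)\<^sup>2) \<and> pt ?J \<phi> \<in> Omega \<epsilon>"
      using int2 avg_sq_ge[OF int int2] by (simp add: pt_def Omega_def c_def)
  next
    assume "set_integrable lebesgue ?J (\<lambda>t. (\<phi> t)\<^sup>2) \<and> pt ?J \<phi> \<in> Omega \<epsilon>"
    then show "mean_osc ?J \<phi> \<le> ereal \<epsilon>"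
      using \<epsilon> by (simp add: osc pt_def Omega_def c_def real_le_lsqrt)
  qed
qed

lemma BMO_d_iff:
  fixes \<phi> :: "real ^ 'n \<Rightarrow> real"
  assumes "\<phi> \<in> borel_measurable lebesgue" "\<epsilon> > 0"
  shows "\<phi> \<in> BMO_d (dcube m k) \<epsilon> \<longleftrightarrow>
    set_integrable lebesgue (dcube m k) \<phi> \<and> set_integrable lebesgue (dcube m k) (\<lambda>t. (\<phi> t)\<^sup>2) \<and>
    (\<forall>m' k'. dcube m' k' \<subseteq> dcube m k \<longrightarrow> pt (dcube m' k') \<phi> \<in> Omega \<epsilon>)"
proof -
  have "\<phi> \<in> BMO_d (dcube m k) \<epsilon> \<longleftrightarrow> set_integrable lebesgue (dcube m k) \<phi> \<and>
    (\<forall>m' k'. dcube m' k' \<subseteq> dcube m k \<longrightarrow> mean_osc (dcube m' k') \<phi> \<le> ereal \<epsilon>)"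
    by (auto simp: BMO_d_def SUP_le_iff dyadic_subcubes_def dyadic_cube_iff)
  also have "\<dots> \<longleftrightarrow> set_integrable lebesgue (dcube m k) \<phi> \<and>
    (\<forall>m' k'. dcube m' k' \<subseteq> dcube m k \<longrightarrow>
      set_integrable lebesgue (dcube m' k') (\<lambda>t. (\<phi> t)\<^sup>2) \<and> pt (dcube m' k') \<phi> \<in> Omega \<epsilon>)"
    using mean_osc_le_iff[OF assms(1) set_integrable_subcube assms(2)] by blast
  also have "\<dots> \<longleftrightarrow> set_integrable lebesgue (dcube m k) \<phi> \<and> set_integrable lebesgue (dcube m k) (\<lambda>t. (\<phi> t)\<^sup>2) \<and>
    (\<forall>m' k'. dcube m' k' \<subseteq> dcube m k \<longrightarrow> pt (dcube m' k') \<phi> \<in> Omega \<epsilon>)"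
    using set_integrable_subcube by blast
  finally show ?thesis .
qed

section \<open>Bellman induction\<close>

text \<open>The conditional expectation of \<phi> given the partition into cubes of level l,
  evaluated on the cube containing t.\<close>

definition level_avg :: "int \<Rightarrow> (real ^ 'n \<Rightarrow> real) \<Rightarrow> real ^ 'n \<Rightarrow> real" where
  "level_avg l \<phi> t = avg (dcube l (\<lambda>i. \<lfloor>t $ i * 2 powi l\<rfloor>)) \<phi>"

lemma level_avg_eq: "t \<in> dcube l k \<Longrightarrow> level_avg l \<phi> t = avg (dcube l k) \<phi>"
proof -
  assume "t \<in> dcube l k"
  then have "(\<lambda>i. \<lfloor>t $ i * 2 powi l\<rfloor>) = k" by (auto simp: dcube_def)
  then show ?thesis by (simp add: level_avg_def)
qed

lemma level_avg_measurable [measurable]: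
  "level_avg l \<phi> \<in> borel_measurable (lebesgue :: (real ^ 'n) measure)"
proof -
  have "(\<lambda>t::real ^ 'n. \<lambda>i. \<lfloor>t $ i * 2 powi l\<rfloor>) \<in> measurable lebesgue (count_space UNIV)"
  proof (subst measurable_count_space_eq_countable)
    have "(\<lambda>t::real ^ 'n. \<lambda>i. \<lfloor>t $ i * 2 powi l\<rfloor>) -` {k} \<inter> space lebesgue = dcube l k" for k
      by (auto simp: dcube_def fun_eq_iff)
    then show "(\<lambda>t::real ^ 'n. \<lambda>i. \<lfloor>t $ i * 2 powi l\<rfloor>) \<in> space lebesgue \<rightarrow> UNIV \<and>
      (\<forall>k\<in>UNIV. (\<lambda>t::real ^ 'n. \<lambda>i. \<lfloor>t $ i * 2 powi l\<rfloor>) -` {k} \<inter> space lebesgue \<in> sets lebesgue)"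
      by simp
  qed (rule countableI_type)
  then have "(\<lambda>t. avg (dcube l ((\<lambda>t::real ^ 'n. \<lambda>i. \<lfloor>t $ i * 2 powi l\<rfloor>) t)) \<phi>) \<in> borel_measurable lebesgue"
    by (rule measurable_compose) simp
  then show ?thesis by (simp add: level_avg_def[abs_def])
qed

lemma level_cube_subset:
  assumes "t \<in> dcube m k" "m \<le> l"
  shows "dcube l (\<lambda>i. \<lfloor>t $ i * 2 powi l\<rfloor>) \<subseteq> dcube m k"
proof
  fix s assume "s \<in> dcube l (\<lambda>i. \<lfloor>t $ i * 2 powi l\<rfloor>)"
  then have "\<lfloor>s $ i * 2 powi l\<rfloor> = \<lfloor>t $ i * 2 powi l\<rfloor>" for i by (simp add: dcube_def)
  then have "\<lfloor>s $ i * 2 powi m\<rfloor> = \<lfloor>t $ i * 2 powi m\<rfloor>" for i by (rule floor_level_mono[OF assms(2)])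
  then show "s \<in> dcube m k" using assms(1) by (simp add: dcube_def)
qed

lemma set_nn_integral_const_dcube:
  "(\<integral>\<^sup>+t\<in>dcube m k. ennreal c \<partial>lebesgue) = ennreal (measure lebesgue (dcube m k) * c)"
  if "c \<ge> 0" for k :: "'n::finite \<Rightarrow> int"
proof -
  have "(\<integral>\<^sup>+t\<in>dcube m k. ennreal c \<partial>lebesgue) = ennreal c * emeasure lebesgue (dcube m k)"
    by (rule nn_integral_cmult_indicator) (rule sets_dcube_lebesgue)
  also have "\<dots> = ennreal (measure lebesgue (dcube m k) * c)"
    unfolding emeasure_dcube_measure using that by (subst mult.commute, subst ennreal_mult) simp_all
  finally show ?thesis .
qed

text \<open>\<open>multi\<close> is used once per cube, from the top down; the weight of the
  children cancels the factor \<open>2 ^ CARD('n)\<close>. After j generations the integrand is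
  \<open>exp\<close> of a first coordinate, which \<open>base\<close> dominates. Replacing the
  averages by \<phi> itself is left to the limit in j.\<close>

lemma bellman_induction:
  fixes \<phi> :: "real ^ 'n \<Rightarrow> real" and b :: "real \<times> real \<Rightarrow> real"
  assumes base: "\<And>p. p \<in> Omega \<epsilon> \<Longrightarrow> exp (fst p) \<le> b p"
    and multi: "\<And>x :: 'n set \<Rightarrow> real \<times> real. (\<And>S. x S \<in> Omega \<epsilon>) \<Longrightarrow>
      (1 / 2 ^ CARD('n)) *\<^sub>R (\<Sum>S\<in>UNIV. x S) \<in> Omega \<epsilon> \<Longrightarrow>
      (\<Sum>S\<in>UNIV. b (x S)) \<le> 2 ^ CARD('n) * b ((1 / 2 ^ CARD('n)) *\<^sub>R (\<Sum>S\<in>UNIV. x S))"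
    and int: "set_integrable lebesgue (dcube m k) \<phi>" "set_integrable lebesgue (dcube m k) (\<lambda>t. (\<phi> t)\<^sup>2)"
    and Om: "\<And>m' k'. dcube m' k' \<subseteq> dcube m k \<Longrightarrow> pt (dcube m' k') \<phi> \<in> Omega \<epsilon>"
  shows "(\<integral>\<^sup>+t\<in>dcube m k. ennreal (exp (level_avg (m + int j) \<phi> t)) \<partial>lebesgue)
    \<le> ennreal (measure lebesgue (dcube m k) * b (pt (dcube m k) \<phi>))"
  using int Om
proof (induction j arbitrary: m k)
  case 0
  let ?p = "pt (dcube m k) \<phi>"
  have "(\<integral>\<^sup>+t\<in>dcube m k. ennreal (exp (level_avg (m + int 0) \<phi> t)) \<partial>lebesgue)
      = (\<integral>\<^sup>+t\<in>dcube m k. ennreal (exp (fst ?p)) \<partial>lebesgue)"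
    by (intro set_nn_integral_cong') (simp add: level_avg_eq pt_def)
  also have "\<dots> = ennreal (measure lebesgue (dcube m k) * exp (fst ?p))"
    by (rule set_nn_integral_const_dcube) simp
  also have "\<dots> \<le> ennreal (measure lebesgue (dcube m k) * b ?p)"
    by (intro ennreal_leI mult_left_mono base 0(3) order_refl measure_nonneg)
  finally show ?case .
next
  case (Suc j)
  let ?C = "\<lambda>S. dcube (m + 1) (child_index k S)"
  let ?\<mu> = "measure lebesgue (dcube m k)"
  have b0: "b p \<ge> 0" if "p \<in> Omega \<epsilon>" for p using base[OF that] by (smt (verit) exp_gt_zero)
  have sub: "?C S \<subseteq> dcube m k" for S by (rule child_subset)
  have Om': "pt (?C S) \<phi> \<in> Omega \<epsilon>" for S by (rule Suc.prems(3)[OF sub])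
  have "(\<integral>\<^sup>+t\<in>dcube m k. ennreal (exp (level_avg (m + int (Suc j)) \<phi> t)) \<partial>lebesgue)
      = (\<Sum>S\<in>UNIV. \<integral>\<^sup>+t\<in>?C S. ennreal (exp (level_avg (m + int (Suc j)) \<phi> t)) \<partial>lebesgue)"
    by (rule nn_integral_children) measurable
  also have "\<dots> \<le> (\<Sum>S\<in>UNIV. ennreal (measure lebesgue (?C S) * b (pt (?C S) \<phi>)))"
  proof (rule sum_mono)
    fix S
    have "m + int (Suc j) = m + 1 + int j" by simp
    moreover have "(\<integral>\<^sup>+t\<in>?C S. ennreal (exp (level_avg (m + 1 + int j) \<phi> t)) \<partial>lebesgue)
        \<le> ennreal (measure lebesgue (?C S) * b (pt (?C S) \<phi>))"
    proof (rule Suc.IH)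
      show "pt (dcube m' k') \<phi> \<in> Omega \<epsilon>" if "dcube m' k' \<subseteq> ?C S" for m' k'
        by (rule Suc.prems(3)[OF order_trans[OF that sub]])
    qed (rule set_integrable_subcube[OF Suc.prems(1) sub] set_integrable_subcube[OF Suc.prems(2) sub])+
    ultimately show "(\<integral>\<^sup>+t\<in>?C S. ennreal (exp (level_avg (m + int (Suc j)) \<phi> t)) \<partial>lebesgue)
        \<le> ennreal (measure lebesgue (?C S) * b (pt (?C S) \<phi>))" by (simp only:)
  qed
  also have "\<dots> = ennreal (\<Sum>S\<in>UNIV. measure lebesgue (?C S) * b (pt (?C S) \<phi>))"
    using b0[OF Om'] by (intro sum_ennreal) (auto intro!: mult_nonneg_nonneg)
  also have "(\<Sum>S\<in>UNIV. measure lebesgue (?C S) * b (pt (?C S) \<phi>))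
      = ?\<mu> / 2 ^ CARD('n) * (\<Sum>S\<in>UNIV. b (pt (?C S) \<phi>))"
    unfolding measure_child_eq sum_distrib_left ..
  also have "ennreal \<dots> \<le> ennreal (?\<mu> / 2 ^ CARD('n) * (2 ^ CARD('n) * b (pt (dcube m k) \<phi>)))"
  proof (intro ennreal_leI mult_left_mono)
    show "(\<Sum>S\<in>UNIV. b (pt (?C S) \<phi>)) \<le> 2 ^ CARD('n) * b (pt (dcube m k) \<phi>)"
      using multi[of "\<lambda>S. pt (?C S) \<phi>", OF Om'] Suc.prems(3)[OF order_refl]
      unfolding pt_children[OF Suc.prems(1,2), symmetric] by simp
  qed simp
  also have "?\<mu> / 2 ^ CARD('n) * (2 ^ CARD('n) * b (pt (dcube m k) \<phi>)) = ?\<mu> * b (pt (dcube m k) \<phi>)" by simp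
  finally show ?case .
qed

section \<open>Convergence of the level averages in L1\<close>

lemma level_avg_contraction:
  fixes \<phi> :: "real ^ 'n \<Rightarrow> real"
  assumes "set_integrable lebesgue (dcube m k) \<phi>" and [measurable]: "\<phi> \<in> borel_measurable lebesgue"
  shows "(\<integral>\<^sup>+t\<in>dcube m k. ennreal \<bar>level_avg (m + int j) \<phi> t\<bar> \<partial>lebesgue)
    \<le> (\<integral>\<^sup>+t\<in>dcube m k. ennreal \<bar>\<phi> t\<bar> \<partial>lebesgue)"
  using assms(1)
proof (induction j arbitrary: m k)
  case 0
  have "(\<integral>\<^sup>+t\<in>dcube m k. ennreal \<bar>level_avg (m + int 0) \<phi> t\<bar> \<partial>lebesgue)
      = (\<integral>\<^sup>+t\<in>dcube m k. ennreal \<bar>avg (dcube m k) \<phi>\<bar> \<partial>lebesgue)"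
    by (intro set_nn_integral_cong') (simp add: level_avg_eq)
  also have "\<dots> = ennreal (measure lebesgue (dcube m k) * \<bar>avg (dcube m k) \<phi>\<bar>)"
    by (rule set_nn_integral_const_dcube) simp
  also have "measure lebesgue (dcube m k) * \<bar>avg (dcube m k) \<phi>\<bar> = \<bar>LINT t:dcube m k|lebesgue. \<phi> t\<bar>"
    unfolding set_integral_dcube abs_mult by (simp only: abs_of_pos[OF measure_dcube_pos])
  also have "\<dots> \<le> (LINT t:dcube m k|lebesgue. \<bar>\<phi> t\<bar>)"
    using integral_norm_bound[of lebesgue "\<lambda>t. indicator (dcube m k) t *\<^sub>R \<phi> t"]
    unfolding set_lebesgue_integral_def by (simp add: abs_mult)
  also have "ennreal \<dots> = (\<integral>\<^sup>+t\<in>dcube m k. ennreal \<bar>\<phi> t\<bar> \<partial>lebesgue)"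
    using 0 by (intro nn_integral_eq_set_integral[symmetric] set_integrable_abs) auto
  finally show ?case by (simp add: ennreal_leI)
next
  case (Suc j)
  let ?C = "\<lambda>S. dcube (m + 1) (child_index k S)"
  have "(\<integral>\<^sup>+t\<in>dcube m k. ennreal \<bar>level_avg (m + int (Suc j)) \<phi> t\<bar> \<partial>lebesgue)
      = (\<Sum>S\<in>UNIV. \<integral>\<^sup>+t\<in>?C S. ennreal \<bar>level_avg (m + int (Suc j)) \<phi> t\<bar> \<partial>lebesgue)"
    by (rule nn_integral_children) measurable
  also have "\<dots> \<le> (\<Sum>S\<in>UNIV. \<integral>\<^sup>+t\<in>?C S. ennreal \<bar>\<phi> t\<bar> \<partial>lebesgue)"
  proof (rule sum_mono)
    fix S
    have "m + int (Suc j) = m + 1 + int j" by simp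
    moreover have "(\<integral>\<^sup>+t\<in>?C S. ennreal \<bar>level_avg (m + 1 + int j) \<phi> t\<bar> \<partial>lebesgue)
        \<le> (\<integral>\<^sup>+t\<in>?C S. ennreal \<bar>\<phi> t\<bar> \<partial>lebesgue)"
      by (rule Suc.IH[OF set_integrable_subcube[OF Suc.prems child_subset]])
    ultimately show "(\<integral>\<^sup>+t\<in>?C S. ennreal \<bar>level_avg (m + int (Suc j)) \<phi> t\<bar> \<partial>lebesgue)
        \<le> (\<integral>\<^sup>+t\<in>?C S. ennreal \<bar>\<phi> t\<bar> \<partial>lebesgue)" by (simp only:)
  qed
  also have "\<dots> = (\<integral>\<^sup>+t\<in>dcube m k. ennreal \<bar>\<phi> t\<bar> \<partial>lebesgue)"
    by (rule nn_integral_children[symmetric]) measurable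
  finally show ?case .
qed

lemma level_avg_diff:
  assumes "set_integrable lebesgue (dcube m k) \<phi>" "set_integrable lebesgue (dcube m k) g"
    and "t \<in> dcube m k" "m \<le> l"
  shows "level_avg l (\<lambda>s. \<phi> s - g s) t = level_avg l \<phi> t - level_avg l g t"
proof -
  note sub = level_cube_subset[OF assms(3,4)]
  show ?thesis
    unfolding level_avg_def avg_def
    by (subst set_integral_diff(2)[OF set_integrable_subcube[OF assms(1) sub] set_integrable_subcube[OF assms(2) sub]])
      (rule diff_divide_distrib)
qed

lemma dist_dcube:
  fixes s t :: "real ^ 'n"
  assumes "s \<in> dcube l k" "t \<in> dcube l k"
  shows "dist s t \<le> real CARD('n) * 2 powi (- l)"
proof -
  have "\<bar>(s - t) $ i\<bar> \<le> 2 powi (- l)" for i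
  proof -
    have "of_int (k i) * 2 powi (- l) \<le> s $ i" "s $ i < (of_int (k i) + 1) * 2 powi (- l)"
      "of_int (k i) * 2 powi (- l) \<le> t $ i" "t $ i < (of_int (k i) + 1) * 2 powi (- l)"
      using assms by (simp_all add: dcube_alt)
    then show ?thesis unfolding distrib_right vector_minus_component by linarith
  qed
  then have "(\<Sum>i\<in>UNIV. \<bar>(s - t) $ i\<bar>) \<le> (\<Sum>i\<in>(UNIV::'n set). 2 powi (- l))" by (intro sum_mono)
  then show ?thesis using norm_le_l1_cart[of "s - t"] by (simp add: dist_norm)
qed

lemma avg_bounds:
  fixes g :: "real ^ 'n \<Rightarrow> real"
  assumes "set_integrable lebesgue (dcube m k) g" "\<And>s. s \<in> dcube m k \<Longrightarrow> \<bar>g s - c\<bar> \<le> e"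
  shows "\<bar>avg (dcube m k) g - c\<bar> \<le> e"
proof -
  have "(LINT t:dcube m k|lebesgue. c - e) \<le> (LINT t:dcube m k|lebesgue. g t)"
  proof (rule set_integral_mono)
    show "c - e \<le> g s" if "s \<in> dcube m k" for s using assms(2)[OF that] by linarith
  qed (use assms(1) in simp_all)
  moreover have "(LINT t:dcube m k|lebesgue. g t) \<le> (LINT t:dcube m k|lebesgue. c + e)"
  proof (rule set_integral_mono)
    show "g s \<le> c + e" if "s \<in> dcube m k" for s using assms(2)[OF that] by linarith
  qed (use assms(1) in simp_all)
  ultimately have "c - e \<le> avg (dcube m k) g" "avg (dcube m k) g \<le> c + e"
    using measure_dcube_pos[of m k] unfolding set_integral_dcube avg_const
    by (simp_all only: mult_le_cancel_left_pos)
  then show ?thesis by linarith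
qed

lemma level_avg_continuous_tendsto:
  fixes g :: "real ^ 'n \<Rightarrow> real"
  assumes cont: "continuous_on UNIV g" and int: "set_integrable lebesgue (dcube m k) g" and t: "t \<in> dcube m k"
  shows "(\<lambda>j. level_avg (m + int j) g t) \<longlonglongrightarrow> g t"
proof (rule LIMSEQ_I)
  fix e :: real assume "e > 0"
  then obtain \<eta> where \<eta>: "\<eta> > 0" "\<And>s. dist s t < \<eta> \<Longrightarrow> dist (g s) (g t) < e / 2"
    using cont unfolding continuous_on_iff by (metis UNIV_I half_gt_zero)
  have "(\<lambda>j. real CARD('n) * (2 powi (- m) * (1 / 2) ^ j)) \<longlonglongrightarrow> real CARD('n) * (2 powi (- m) * 0)"
    by (intro tendsto_intros LIMSEQ_realpow_zero) auto
  then have "\<forall>\<^sub>F j in sequentially. real CARD('n) * (2 powi (- m) * (1 / 2) ^ j) < \<eta>"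
    using \<eta>(1) by (simp add: order_tendsto_iff)
  then obtain J where J: "\<And>j. j \<ge> J \<Longrightarrow> real CARD('n) * (2 powi (- m) * (1 / 2) ^ j) < \<eta>"
    by (auto simp: eventually_sequentially)
  have "norm (level_avg (m + int j) g t - g t) < e" if "j \<ge> J" for j
  proof -
    define l where "l = m + int j"
    define k' where "k' = (\<lambda>i. \<lfloor>t $ i * 2 powi l\<rfloor>)"
    have tk: "t \<in> dcube l k'" by (simp add: k'_def dcube_def)
    have sub: "dcube l k' \<subseteq> dcube m k" unfolding k'_def using t by (rule level_cube_subset) (simp add: l_def)
    have pl: "(2::real) powi (- l) = 2 powi (- m) * (1 / 2) ^ j"
      by (simp add: l_def power_int_diff power_one_over inverse_eq_divide)
    have "\<bar>g s - g t\<bar> \<le> e / 2" if "s \<in> dcube l k'" for s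
      using dist_dcube[OF that tk] J[OF \<open>j \<ge> J\<close>] \<eta>(2)[of s] unfolding pl dist_real_def by linarith
    then have "\<bar>avg (dcube l k') g - g t\<bar> \<le> e / 2"
      by (intro avg_bounds set_integrable_subcube[OF int sub])
    then show ?thesis using \<open>e > 0\<close> by (simp add: l_def[symmetric] level_avg_eq[OF tk])
  qed
  then show "\<exists>J. \<forall>j\<ge>J. norm (level_avg (m + int j) g t - g t) < e" by blast
qed

lemma borel_measurable_continuous_lebesgue:
  fixes g :: "'a::euclidean_space \<Rightarrow> real"
  assumes "continuous_on UNIV g"
  shows "g \<in> borel_measurable lebesgue"
proof -
  have "g \<in> borel_measurable lborel" using borel_measurable_continuous_onI[OF assms] by simp
  then show ?thesis by (rule measurable_completion)
qed

text \<open>Two dominated limits: f is truncated at a large height, and the truncation is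
  approximated by truncated continuous functions converging to it almost everywhere. The common
  truncation supplies the dominating constant and makes the final g bounded.\<close>

lemma L1_continuous_approx:
  fixes f :: "'a::euclidean_space \<Rightarrow> real"
  assumes int: "integrable lebesgue f" and Q: "Q \<in> sets lebesgue" "emeasure lebesgue Q < \<infinity>" and e: "e > 0"
  obtains g M where "continuous_on UNIV g" "\<And>t. \<bar>g t\<bar> \<le> M" "(LINT t:Q|lebesgue. \<bar>f t - g t\<bar>) < e"
proof -
  have fm [measurable]: "f \<in> borel_measurable lebesgue" using int by auto
  note Q(1) [measurable]
  define cl where "cl = (\<lambda>M y::real. max (- M) (min M y))"
  have cl_bound: "\<bar>cl M y\<bar> \<le> \<bar>M\<bar>" for M y by (auto simp: cl_def)
  have iQ: "integrable lebesgue (\<lambda>t. indicator Q t * c)" for c :: real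
    using Q by (intro integrable_mult_left integrable_real_indicator) auto
  have lim1: "(\<lambda>n. LINT t:Q|lebesgue. \<bar>f t - cl (real n) (f t)\<bar>) \<longlonglongrightarrow> (LINT t:Q|lebesgue. 0)"
    unfolding set_lebesgue_integral_def
  proof (rule integral_dominated_convergence[where w = "\<lambda>t. \<bar>f t\<bar>"])
    show "AE t in lebesgue. (\<lambda>n. indicator Q t *\<^sub>R \<bar>f t - cl (real n) (f t)\<bar>) \<longlonglongrightarrow> indicator Q t *\<^sub>R 0"
    proof (rule AE_I2)
      fix t
      obtain N where N: "\<bar>f t\<bar> \<le> real N" using real_arch_simple by blast
      have "indicator Q t *\<^sub>R \<bar>f t - cl (real n) (f t)\<bar> = indicator Q t *\<^sub>R 0" if "n \<ge> N" for n
      proof -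
        have "\<bar>f t\<bar> \<le> real n" using N that by (meson of_nat_mono order_trans)
        then show ?thesis by (simp add: cl_def)
      qed
      then show "(\<lambda>n. indicator Q t *\<^sub>R \<bar>f t - cl (real n) (f t)\<bar>) \<longlonglongrightarrow> indicator Q t *\<^sub>R 0"
        by (intro tendsto_eventually eventually_sequentiallyI[of N])
    qed
    show "AE t in lebesgue. norm (indicator Q t *\<^sub>R \<bar>f t - cl (real n) (f t)\<bar>) \<le> \<bar>f t\<bar>" for n
      by (auto simp: cl_def indicator_def)
  qed (use int in \<open>auto simp: cl_def\<close>)
  then have "\<forall>\<^sub>F n in sequentially. (LINT t:Q|lebesgue. \<bar>f t - cl (real n) (f t)\<bar>) < e / 2"
    using e by (intro order_tendstoD(2)[where y = 0]) simp_all
  from eventually_happens'[OF sequentially_bot this]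
  obtain n where n: "(LINT t:Q|lebesgue. \<bar>f t - cl (real n) (f t)\<bar>) < e / 2" ..
  define M where "M = real n"
  obtain N g where N: "negligible N" and g: "\<And>i. continuous_on UNIV (g i)"
    and lim: "\<And>x. x \<notin> N \<Longrightarrow> (\<lambda>i. g i x) \<longlonglongrightarrow> f x"
  proof -
    have "f measurable_on UNIV"
      using lebesgue_measurable_imp_measurable_on[of f UNIV] fm by simp
    then show ?thesis using that unfolding measurable_on_def by auto
  qed
  have gm [measurable]: "g i \<in> borel_measurable lebesgue" for i
    by (rule borel_measurable_continuous_lebesgue[OF g])
  have AEN: "AE x in lebesgue. x \<notin> N"
    using N by (simp add: negligible_iff_null_sets AE_not_in)
  have lim2: "(\<lambda>i. LINT t:Q|lebesgue. \<bar>cl M (f t) - cl M (g i t)\<bar>) \<longlonglongrightarrow> (LINT t:Q|lebesgue. 0)"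
    unfolding set_lebesgue_integral_def
  proof (rule integral_dominated_convergence[where w = "\<lambda>t. indicator Q t * (2 * M)"])
    show "AE t in lebesgue. (\<lambda>i. indicator Q t *\<^sub>R \<bar>cl M (f t) - cl M (g i t)\<bar>) \<longlonglongrightarrow> indicator Q t *\<^sub>R 0"
      using AEN
    proof eventually_elim
      case (elim t)
      have "(\<lambda>i. indicator Q t *\<^sub>R \<bar>cl M (f t) - cl M (g i t)\<bar>) \<longlonglongrightarrow> indicator Q t *\<^sub>R \<bar>cl M (f t) - cl M (f t)\<bar>"
        unfolding cl_def by (intro tendsto_intros lim elim)
      then show ?case by simp
    qed
    have "\<bar>cl M y - cl M z\<bar> \<le> 2 * M" for y z
      using cl_bound[of M y] cl_bound[of M z] by (simp add: M_def)
    then show "AE t in lebesgue. norm (indicator Q t *\<^sub>R \<bar>cl M (f t) - cl M (g i t)\<bar>) \<le> indicator Q t * (2 * M)" for i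
      by (auto simp: indicator_def)
  qed (use iQ in \<open>auto simp: cl_def\<close>)
  then have "\<forall>\<^sub>F i in sequentially. (LINT t:Q|lebesgue. \<bar>cl M (f t) - cl M (g i t)\<bar>) < e / 2"
    using e by (intro order_tendstoD(2)[where y = 0]) simp_all
  from eventually_happens'[OF sequentially_bot this]
  obtain i where i: "(LINT t:Q|lebesgue. \<bar>cl M (f t) - cl M (g i t)\<bar>) < e / 2" ..
  have cl_le: "\<bar>cl M y\<bar> \<le> M" for y using cl_bound[of M y] by (simp add: M_def)
  have m_cl [measurable]: "(\<lambda>t. cl M (f t)) \<in> borel_measurable lebesgue" "(\<lambda>t. cl M (g i t)) \<in> borel_measurable lebesgue"
    unfolding cl_def by measurable
  have i1: "set_integrable lebesgue Q (\<lambda>t. \<bar>f t - cl M (f t)\<bar>)"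
    unfolding set_integrable_def
    by (rule Bochner_Integration.integrable_bound[OF int]) (auto simp: cl_def indicator_def M_def)
  have i2: "set_integrable lebesgue Q (\<lambda>t. \<bar>cl M (f t) - cl M (g i t)\<bar>)"
    unfolding set_integrable_def
  proof (rule Bochner_Integration.integrable_bound[OF iQ[of "2 * M"]])
    have "\<bar>cl M y - cl M z\<bar> \<le> 2 * M" for y z
      using cl_le[of y] cl_le[of z] by simp
    then show "AE t in lebesgue. norm (indicator Q t *\<^sub>R \<bar>cl M (f t) - cl M (g i t)\<bar>) \<le> norm (indicator Q t * (2 * M))"
      by (auto simp: indicator_def M_def)
  qed measurable
  have "(LINT t:Q|lebesgue. \<bar>f t - cl M (g i t)\<bar>)
      \<le> (LINT t:Q|lebesgue. \<bar>f t - cl M (f t)\<bar> + \<bar>cl M (f t) - cl M (g i t)\<bar>)"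
  proof (rule set_integral_mono)
    show sum: "set_integrable lebesgue Q (\<lambda>t. \<bar>f t - cl M (f t)\<bar> + \<bar>cl M (f t) - cl M (g i t)\<bar>)"
      using i1 i2 by (rule set_integral_add(1))
    show "set_integrable lebesgue Q (\<lambda>t. \<bar>f t - cl M (g i t)\<bar>)"
      using sum unfolding set_integrable_def
      by (rule Bochner_Integration.integrable_bound) (measurable, auto simp: indicator_def)
  qed auto
  also have "\<dots> < e" using n[folded M_def] i unfolding set_integral_add(2)[OF i1 i2] by linarith
  finally have "(LINT t:Q|lebesgue. \<bar>f t - cl M (g i t)\<bar>) < e" .
  moreover have "continuous_on UNIV (\<lambda>t. cl M (g i t))"
    unfolding cl_def by (intro continuous_intros g)
  ultimately show ?thesis using that[of "\<lambda>t. cl M (g i t)" M] cl_le by blast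
qed

lemma set_integrable_bounded_dcube:
  fixes g :: "real ^ 'n \<Rightarrow> real"
  assumes "g \<in> borel_measurable lebesgue" "\<And>t. \<bar>g t\<bar> \<le> M"
  shows "set_integrable lebesgue (dcube m k) g"
  by (rule set_integrable_bound[OF set_integrable_const[of m k M]])
    (use assms in \<open>auto simp: set_borel_measurable_def intro: order_trans[OF _ abs_ge_self]\<close>)

lemma level_avg_contraction_real:
  fixes \<phi> :: "real ^ 'n \<Rightarrow> real"
  assumes int: "set_integrable lebesgue (dcube m k) \<phi>" and [measurable]: "\<phi> \<in> borel_measurable lebesgue"
  shows "set_integrable lebesgue (dcube m k) (\<lambda>t. \<bar>level_avg (m + int j) \<phi> t\<bar>)"
    and "(LINT t:dcube m k|lebesgue. \<bar>level_avg (m + int j) \<phi> t\<bar>) \<le> (LINT t:dcube m k|lebesgue. \<bar>\<phi> t\<bar>)"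
proof -
  have eq: "(\<integral>\<^sup>+t\<in>dcube m k. ennreal \<bar>\<phi> t\<bar> \<partial>lebesgue) = ennreal (LINT t:dcube m k|lebesgue. \<bar>\<phi> t\<bar>)"
    by (intro nn_integral_eq_set_integral set_integrable_abs int) simp
  have le: "(\<integral>\<^sup>+t\<in>dcube m k. ennreal \<bar>level_avg (m + int j) \<phi> t\<bar> \<partial>lebesgue)
      \<le> ennreal (LINT t:dcube m k|lebesgue. \<bar>\<phi> t\<bar>)"
    using level_avg_contraction[OF assms] unfolding eq .
  show i: "set_integrable lebesgue (dcube m k) (\<lambda>t. \<bar>level_avg (m + int j) \<phi> t\<bar>)"
    using le by (intro set_integrable_of_nn_integral) (auto simp: less_top[symmetric] top_unique)
  have "ennreal (LINT t:dcube m k|lebesgue. \<bar>level_avg (m + int j) \<phi> t\<bar>)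
      \<le> ennreal (LINT t:dcube m k|lebesgue. \<bar>\<phi> t\<bar>)"
    using le nn_integral_eq_set_integral[OF i] by simp
  moreover have "0 \<le> (LINT t:dcube m k|lebesgue. \<bar>\<phi> t\<bar>)"
    unfolding set_lebesgue_integral_def by (intro Bochner_Integration.integral_nonneg) auto
  ultimately show "(LINT t:dcube m k|lebesgue. \<bar>level_avg (m + int j) \<phi> t\<bar>) \<le> (LINT t:dcube m k|lebesgue. \<bar>\<phi> t\<bar>)"
    by (simp only: ennreal_le_iff)
qed

lemma level_avg_integrable:
  fixes \<phi> :: "real ^ 'n \<Rightarrow> real"
  assumes "set_integrable lebesgue (dcube m k) \<phi>" "\<phi> \<in> borel_measurable lebesgue"
  shows "set_integrable lebesgue (dcube m k) (level_avg (m + int j) \<phi>)"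
  using level_avg_contraction_real(1)[OF assms, of j] unfolding set_integrable_def
  by (rule Bochner_Integration.integrable_bound) (measurable, auto simp: indicator_def)

text \<open>With a continuous g close to \<phi> in L1, the error splits into the averages of
  \<open>\<phi> - g\<close>, the error for g, and \<open>g - \<phi>\<close>. Averaging is an L1
  contraction, so the first part is as small as the third; the second tends to 0 by continuity and
  boundedness of g.\<close>

lemma level_avg_tendsto_L1:
  fixes \<phi> :: "real ^ 'n \<Rightarrow> real"
  assumes int: "set_integrable lebesgue (dcube m k) \<phi>" and [measurable]: "\<phi> \<in> borel_measurable lebesgue"
  shows "(\<lambda>j. LINT t:dcube m k|lebesgue. \<bar>level_avg (m + int j) \<phi> t - \<phi> t\<bar>) \<longlonglongrightarrow> 0"
proof (rule LIMSEQ_I)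
  fix e :: real assume e: "e > 0"
  let ?Q = "dcube m k :: (real ^ 'n) set"
  obtain g M where g: "continuous_on UNIV g" "\<And>t. \<bar>g t\<bar> \<le> M"
    and close: "(LINT t:?Q|lebesgue. \<bar>indicator ?Q t *\<^sub>R \<phi> t - g t\<bar>) < e / 3"
    using L1_continuous_approx[of "\<lambda>t. indicator ?Q t *\<^sub>R \<phi> t" ?Q "e / 3"] int e
    unfolding set_integrable_def by (auto simp: emeasure_dcube)
  have gm [measurable]: "g \<in> borel_measurable lebesgue" by (rule borel_measurable_continuous_lebesgue[OF g(1)])
  have gi: "set_integrable lebesgue ?Q g" by (rule set_integrable_bounded_dcube[OF gm g(2)])
  have di: "set_integrable lebesgue ?Q (\<lambda>t. \<phi> t - g t)" using int gi by (rule set_integral_diff(1))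
  have dm: "(\<lambda>t. \<phi> t - g t) \<in> borel_measurable lebesgue" by measurable
  have close': "(LINT t:?Q|lebesgue. \<bar>\<phi> t - g t\<bar>) < e / 3"
    using close set_lebesgue_integral_cong[of ?Q lebesgue "\<lambda>t. \<bar>indicator ?Q t *\<^sub>R \<phi> t - g t\<bar>" "\<lambda>t. \<bar>\<phi> t - g t\<bar>"]
    by simp
  have "(\<lambda>j. LINT t:?Q|lebesgue. \<bar>level_avg (m + int j) g t - g t\<bar>) \<longlonglongrightarrow> (LINT t:?Q|lebesgue. 0)"
    unfolding set_lebesgue_integral_def
  proof (rule integral_dominated_convergence[where w = "\<lambda>t. indicator ?Q t *\<^sub>R (2 * M)"])
    show "integrable lebesgue (\<lambda>t. indicator ?Q t *\<^sub>R (2 * M))"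
      using set_integrable_const[of m k "2 * M"] unfolding set_integrable_def .
    show "AE t in lebesgue. (\<lambda>j. indicator ?Q t *\<^sub>R \<bar>level_avg (m + int j) g t - g t\<bar>) \<longlonglongrightarrow> indicator ?Q t *\<^sub>R 0"
    proof (rule AE_I2)
      fix t
      show "(\<lambda>j. indicator ?Q t *\<^sub>R \<bar>level_avg (m + int j) g t - g t\<bar>) \<longlonglongrightarrow> indicator ?Q t *\<^sub>R 0"
      proof (cases "t \<in> ?Q")
        case True
        have "(\<lambda>j. \<bar>level_avg (m + int j) g t - g t\<bar>) \<longlonglongrightarrow> \<bar>g t - g t\<bar>"
          by (intro tendsto_intros level_avg_continuous_tendsto[OF g(1) gi True])
        then show ?thesis using True by simp
      qed simp
    qed
    show "AE t in lebesgue. norm (indicator ?Q t *\<^sub>R \<bar>level_avg (m + int j) g t - g t\<bar>) \<le> indicator ?Q t *\<^sub>R (2 * M)" for j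
    proof (rule AE_I2)
      fix t
      have "\<bar>level_avg (m + int j) g t\<bar> \<le> M"
      proof -
        define l where "l = m + int j"
        have "\<bar>avg (dcube l (\<lambda>i. \<lfloor>t $ i * 2 powi l\<rfloor>)) g - 0\<bar> \<le> M"
          by (rule avg_bounds) (use set_integrable_bounded_dcube[OF gm g(2)] g(2) in auto)
        then show ?thesis by (simp add: level_avg_def l_def)
      qed
      then show "norm (indicator ?Q t *\<^sub>R \<bar>level_avg (m + int j) g t - g t\<bar>) \<le> indicator ?Q t *\<^sub>R (2 * M)"
        using g(2)[of t] by (auto simp: indicator_def)
    qed
  qed measurable
  then have "(\<lambda>j. LINT t:?Q|lebesgue. \<bar>level_avg (m + int j) g t - g t\<bar>) \<longlonglongrightarrow> 0" by simp
  then have "\<forall>\<^sub>F j in sequentially. (LINT t:?Q|lebesgue. \<bar>level_avg (m + int j) g t - g t\<bar>) < e / 3"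
    using e by (intro order_tendstoD(2)[where y = 0]) simp_all
  then obtain J where J: "\<And>j. j \<ge> J \<Longrightarrow> (LINT t:?Q|lebesgue. \<bar>level_avg (m + int j) g t - g t\<bar>) < e / 3"
    by (auto simp: eventually_sequentially)
  have "norm ((LINT t:?Q|lebesgue. \<bar>level_avg (m + int j) \<phi> t - \<phi> t\<bar>) - 0) < e" if "j \<ge> J" for j
  proof -
    let ?A = "level_avg (m + int j)"
    have i1: "set_integrable lebesgue ?Q (\<lambda>t. \<bar>?A (\<lambda>t. \<phi> t - g t) t\<bar>)"
      by (rule level_avg_contraction_real(1)[OF di dm])
    have i2: "set_integrable lebesgue ?Q (\<lambda>t. \<bar>?A g t - g t\<bar>)"
      by (intro set_integrable_abs set_integral_diff(1) level_avg_integrable gi gm)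
    have i3: "set_integrable lebesgue ?Q (\<lambda>t. \<bar>\<phi> t - g t\<bar>)" by (rule set_integrable_abs[OF di])
    have i12: "set_integrable lebesgue ?Q (\<lambda>t. \<bar>?A (\<lambda>t. \<phi> t - g t) t\<bar> + \<bar>?A g t - g t\<bar>)"
      using i1 i2 by (rule set_integral_add(1))
    have "(LINT t:?Q|lebesgue. \<bar>?A \<phi> t - \<phi> t\<bar>)
        \<le> (LINT t:?Q|lebesgue. (\<bar>?A (\<lambda>t. \<phi> t - g t) t\<bar> + \<bar>?A g t - g t\<bar>) + \<bar>\<phi> t - g t\<bar>)"
    proof (rule set_integral_mono)
      show "set_integrable lebesgue ?Q (\<lambda>t. \<bar>?A \<phi> t - \<phi> t\<bar>)"
        by (intro set_integrable_abs set_integral_diff(1) level_avg_integrable int) measurable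
      show "set_integrable lebesgue ?Q (\<lambda>t. (\<bar>?A (\<lambda>t. \<phi> t - g t) t\<bar> + \<bar>?A g t - g t\<bar>) + \<bar>\<phi> t - g t\<bar>)"
        using i12 i3 by (rule set_integral_add(1))
      fix t assume t: "t \<in> ?Q"
      show "\<bar>?A \<phi> t - \<phi> t\<bar> \<le> (\<bar>?A (\<lambda>t. \<phi> t - g t) t\<bar> + \<bar>?A g t - g t\<bar>) + \<bar>\<phi> t - g t\<bar>"
        using level_avg_diff[OF int gi t, of "m + int j"] by simp
    qed
    also have "\<dots> = ((LINT t:?Q|lebesgue. \<bar>?A (\<lambda>t. \<phi> t - g t) t\<bar>) + (LINT t:?Q|lebesgue. \<bar>?A g t - g t\<bar>))
        + (LINT t:?Q|lebesgue. \<bar>\<phi> t - g t\<bar>)"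
      unfolding set_integral_add(2)[OF i12 i3] set_integral_add(2)[OF i1 i2] ..
    also have "\<dots> < e"
      using level_avg_contraction_real(2)[OF di dm, of j] J[OF that] close' by linarith
    finally have "(LINT t:?Q|lebesgue. \<bar>?A \<phi> t - \<phi> t\<bar>) < e" .
    moreover have "0 \<le> (LINT t:?Q|lebesgue. \<bar>?A \<phi> t - \<phi> t\<bar>)"
      unfolding set_lebesgue_integral_def by (intro Bochner_Integration.integral_nonneg) auto
    ultimately show ?thesis by simp
  qed
  then show "\<exists>J. \<forall>j\<ge>J. norm ((LINT t:?Q|lebesgue. \<bar>level_avg (m + int j) \<phi> t - \<phi> t\<bar>) - 0) < e" by blast
qed

text \<open>L1 convergence yields almost everywhere convergence along a subsequence. That is enough
  for Fatou's lemma, since the bound c is the same at all levels.\<close>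

lemma exp_integral_le_limit:
  fixes \<phi> :: "real ^ 'n \<Rightarrow> real"
  assumes int: "set_integrable lebesgue (dcube m k) \<phi>" and [measurable]: "\<phi> \<in> borel_measurable lebesgue"
    and le: "\<And>j. (\<integral>\<^sup>+t\<in>dcube m k. ennreal (exp (level_avg (m + int j) \<phi> t)) \<partial>lebesgue) \<le> c"
  shows "(\<integral>\<^sup>+t\<in>dcube m k. ennreal (exp (\<phi> t)) \<partial>lebesgue) \<le> c"
proof -
  let ?Q = "dcube m k :: (real ^ 'n) set"
  define u where "u = (\<lambda>j t. indicator ?Q t *\<^sub>R (level_avg (m + int j) \<phi> t - \<phi> t))"
  have ui: "integrable lebesgue (u j)" for j
  proof -
    have "set_integrable lebesgue ?Q (\<lambda>t. level_avg (m + int j) \<phi> t - \<phi> t)"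
      by (intro set_integral_diff(1) level_avg_integrable int) measurable
    then show ?thesis unfolding set_integrable_def u_def .
  qed
  have "(\<lambda>j. \<integral>t. norm (u j t) \<partial>lebesgue) \<longlonglongrightarrow> 0"
  proof -
    have "(\<integral>t. norm (u j t) \<partial>lebesgue) = (LINT t:?Q|lebesgue. \<bar>level_avg (m + int j) \<phi> t - \<phi> t\<bar>)" for j
      unfolding set_lebesgue_integral_def u_def by (intro Bochner_Integration.integral_cong) (auto simp: indicator_def)
    then show ?thesis using level_avg_tendsto_L1[OF assms(1,2)] by simp
  qed
  from tendsto_L1_AE_subseq[OF ui this] obtain r :: "nat \<Rightarrow> nat"
    where r: "AE t in lebesgue. (\<lambda>n. u (r n) t) \<longlonglongrightarrow> 0" by blast
  have "(\<integral>\<^sup>+t\<in>?Q. ennreal (exp (\<phi> t)) \<partial>lebesgue)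
      = (\<integral>\<^sup>+t. liminf (\<lambda>n. ennreal (exp (level_avg (m + int (r n)) \<phi> t)) * indicator ?Q t) \<partial>lebesgue)"
  proof (rule nn_integral_cong_AE)
    show "AE t in lebesgue. ennreal (exp (\<phi> t)) * indicator ?Q t
        = liminf (\<lambda>n. ennreal (exp (level_avg (m + int (r n)) \<phi> t)) * indicator ?Q t)"
      using r
    proof eventually_elim
      case (elim t)
      show ?case
      proof (cases "t \<in> ?Q")
        case True
        have "(\<lambda>n. u (r n) t + \<phi> t) \<longlonglongrightarrow> 0 + \<phi> t" by (intro tendsto_intros elim)
        then have "(\<lambda>n. level_avg (m + int (r n)) \<phi> t) \<longlonglongrightarrow> \<phi> t" using True by (simp add: u_def)
        then have "(\<lambda>n. ennreal (exp (level_avg (m + int (r n)) \<phi> t))) \<longlonglongrightarrow> ennreal (exp (\<phi> t))"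
          by (intro tendsto_intros)
        from lim_imp_Liminf[OF sequentially_bot this] show ?thesis using True by simp
      qed (simp add: Liminf_const)
    qed
  qed
  also have "\<dots> \<le> liminf (\<lambda>n. \<integral>\<^sup>+t\<in>?Q. ennreal (exp (level_avg (m + int (r n)) \<phi> t)) \<partial>lebesgue)"
    by (rule nn_integral_liminf) measurable
  also have "\<dots> \<le> liminf (\<lambda>n::nat. c)"
    by (intro Liminf_mono always_eventually allI le)
  also have "\<dots> = c" by (simp add: Liminf_const)
  finally show ?thesis .
qed

section \<open>Optimizers\<close>

text \<open>The base cube is universally quantified so that optimizers can be placed in the children
  of a cube without any rescaling.\<close>

definition attains :: "'n::finite itself \<Rightarrow> real \<Rightarrow> real \<times> real \<Rightarrow> real \<Rightarrow> bool" where
  "attains T \<epsilon> x y \<longleftrightarrow> (\<forall>m (k :: 'n \<Rightarrow> int). \<exists>\<phi>\<in>borel_measurable lebesgue.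
     \<phi> \<in> BMO_d (dcube m k) \<epsilon> \<and> pt (dcube m k) \<phi> = x \<and>
     ennreal (measure lebesgue (dcube m k) * y) \<le> (\<integral>\<^sup>+t\<in>dcube m k. ennreal (exp (\<phi> t)) \<partial>lebesgue))"

lemma attains_mono:
  assumes "attains T \<epsilon> x y" "y' \<le> y"
  shows "attains T \<epsilon> x y'"
proof -
  have "ennreal (\<mu> * y') \<le> ennreal (\<mu> * y)" if "\<mu> \<ge> 0" for \<mu> :: real
    using assms(2) that by (intro ennreal_leI mult_left_mono)
  then show ?thesis using assms(1) unfolding attains_def by (meson measure_nonneg order_trans)
qed

lemma attains_const:
  assumes "\<epsilon> > 0"
  shows "attains (T :: 'n::finite itself) \<epsilon> (c, c\<^sup>2) (exp c)"
  unfolding attains_def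
proof (intro allI bexI conjI)
  fix m and k :: "'n \<Rightarrow> int"
  show "(\<lambda>t. c) \<in> BMO_d (dcube m k) \<epsilon>"
    using assms by (subst BMO_d_iff) (auto simp: pt_def Omega_def)
  show "ennreal (measure lebesgue (dcube m k) * exp c) \<le> (\<integral>\<^sup>+t\<in>dcube m k. ennreal (exp c) \<partial>lebesgue)"
    by (subst set_nn_integral_const_dcube) simp_all
qed (auto simp: pt_def)

text \<open>By \<open>subcube_cases\<close> the glued function meets the BMO condition as soon as
  its pieces do and the average over the parent lies in \<open>Omega\<close>.\<close>

lemma attains_glue:
  fixes x :: "'n::finite set \<Rightarrow> real \<times> real"
  assumes \<epsilon>: "\<epsilon> > 0" and att: "\<And>S. attains (T :: 'n itself) \<epsilon> (x S) (y S)"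
    and Om: "(1 / 2 ^ CARD('n)) *\<^sub>R (\<Sum>S\<in>UNIV. x S) \<in> Omega \<epsilon>"
  shows "attains T \<epsilon> ((1 / 2 ^ CARD('n)) *\<^sub>R (\<Sum>S\<in>UNIV. x S)) ((\<Sum>S\<in>UNIV. y S) / 2 ^ CARD('n))"
  unfolding attains_def
proof (intro allI)
  fix m and k :: "'n \<Rightarrow> int"
  let ?Q = "dcube m k :: (real ^ 'n) set"
  let ?C = "\<lambda>S. dcube (m + 1) (child_index k S) :: (real ^ 'n) set"
  have "\<forall>S. \<exists>\<phi>. \<phi> \<in> borel_measurable lebesgue \<and> \<phi> \<in> BMO_d (?C S) \<epsilon> \<and> pt (?C S) \<phi> = x S \<and>
     ennreal (measure lebesgue (?C S) * y S) \<le> (\<integral>\<^sup>+t\<in>?C S. ennreal (exp (\<phi> t)) \<partial>lebesgue)"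
    using att unfolding attains_def by blast
  from choice[OF this] obtain f where F:
    "\<forall>S. f S \<in> borel_measurable lebesgue \<and> f S \<in> BMO_d (?C S) \<epsilon> \<and> pt (?C S) (f S) = x S \<and>
     ennreal (measure lebesgue (?C S) * y S) \<le> (\<integral>\<^sup>+t\<in>?C S. ennreal (exp (f S t)) \<partial>lebesgue)" ..
  have f [measurable]: "f S \<in> borel_measurable lebesgue"
    and fB: "f S \<in> BMO_d (?C S) \<epsilon>" and fx: "pt (?C S) (f S) = x S"
    and fe: "ennreal (measure lebesgue (?C S) * y S) \<le> (\<integral>\<^sup>+t\<in>?C S. ennreal (exp (f S t)) \<partial>lebesgue)" for S
    using spec[OF F, of S] by simp_all
  define \<phi> where "\<phi> = (\<lambda>t. \<Sum>S\<in>UNIV. indicator (?C S) t * f S t)"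
  have \<phi>m [measurable]: "\<phi> \<in> borel_measurable lebesgue" unfolding \<phi>_def by measurable
  have eq: "\<phi> t = f S t" if "t \<in> ?C S" for t S
  proof -
    have "indicator (?C S') t * f S' t = (if S' = S then f S t else 0)" for S'
      using that disjoint_children[of m k] by (auto simp: disjoint_family_on_def indicator_def)
    then show ?thesis unfolding \<phi>_def by (simp only: sum.delta finite) simp
  qed
  have \<phi>B: "\<phi> \<in> BMO_d (?C S) \<epsilon>" for S
    by (rule iffD2[OF BMO_d_cong[OF eq] fB])
  note C = iffD1[OF BMO_d_iff[OF \<phi>m \<epsilon>] \<phi>B]
  have "set_integrable lebesgue (\<Union>S. ?C S) \<phi>"
    using C by (intro set_integrable_UN) auto
  then have i1: "set_integrable lebesgue ?Q \<phi>" unfolding dcube_eq_UN_children[of m k, symmetric] .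
  have "set_integrable lebesgue (\<Union>S. ?C S) (\<lambda>t. (\<phi> t)\<^sup>2)"
    using C by (intro set_integrable_UN) auto
  then have i2: "set_integrable lebesgue ?Q (\<lambda>t. (\<phi> t)\<^sup>2)" unfolding dcube_eq_UN_children[of m k, symmetric] .
  have ptC: "pt (?C S) \<phi> = x S" for S
    using pt_cong[of "?C S" \<phi> "f S", OF eq] fx by simp
  have ptQ: "pt ?Q \<phi> = (1 / 2 ^ CARD('n)) *\<^sub>R (\<Sum>S\<in>UNIV. x S)"
    unfolding pt_children[OF i1 i2] ptC ..
  have "pt (dcube m' k') \<phi> \<in> Omega \<epsilon>" if sub: "dcube m' k' \<subseteq> ?Q" for m' k'
    using sub
  proof (cases rule: subcube_cases)
    case 1
    then show ?thesis using Om ptQ by simp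
  next
    case (2 S)
    from C[of S, THEN conjunct2, THEN conjunct2, rule_format, OF 2(2)] show ?thesis .
  qed
  then have B: "\<phi> \<in> BMO_d ?Q \<epsilon>" unfolding BMO_d_iff[OF \<phi>m \<epsilon>] using i1 i2 by simp
  have "ennreal (measure lebesgue ?Q * ((\<Sum>S\<in>UNIV. y S) / 2 ^ CARD('n)))
      = ennreal (\<Sum>S\<in>UNIV. measure lebesgue (?C S) * y S)"
    unfolding measure_child_eq sum_distrib_left[symmetric] by simp
  \<comment> \<open>Some \<open>y S\<close> may be negative. Since \<open>ennreal\<close> sends
    negative numbers to 0, cutting off at 0 changes no single term but makes the sum commute with
    \<open>ennreal\<close>.\<close>
  also have "\<dots> \<le> ennreal (\<Sum>S\<in>UNIV. max 0 (measure lebesgue (?C S) * y S))"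
    by (intro ennreal_leI sum_mono) simp
  also have "\<dots> = (\<Sum>S\<in>UNIV. ennreal (max 0 (measure lebesgue (?C S) * y S)))"
    by (rule sum_ennreal[symmetric]) simp
  also have "\<dots> \<le> (\<Sum>S\<in>UNIV. \<integral>\<^sup>+t\<in>?C S. ennreal (exp (\<phi> t)) \<partial>lebesgue)"
  proof (rule sum_mono)
    fix S
    have "(\<integral>\<^sup>+t\<in>?C S. ennreal (exp (\<phi> t)) \<partial>lebesgue) = (\<integral>\<^sup>+t\<in>?C S. ennreal (exp (f S t)) \<partial>lebesgue)"
      by (intro set_nn_integral_cong') (simp add: eq)
    then show "ennreal (max 0 (measure lebesgue (?C S) * y S)) \<le> (\<integral>\<^sup>+t\<in>?C S. ennreal (exp (\<phi> t)) \<partial>lebesgue)"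
      using fe[of S] by (simp only: ennreal_max_0)
  qed
  also have "\<dots> = (\<integral>\<^sup>+t\<in>?Q. ennreal (exp (\<phi> t)) \<partial>lebesgue)"
    by (rule nn_integral_children[symmetric]) measurable
  finally show "\<exists>\<phi>\<in>borel_measurable lebesgue.
     \<phi> \<in> BMO_d ?Q \<epsilon> \<and> pt ?Q \<phi> = (1 / 2 ^ CARD('n)) *\<^sub>R (\<Sum>S\<in>UNIV. x S) \<and>
     ennreal (measure lebesgue ?Q * ((\<Sum>S\<in>UNIV. y S) / 2 ^ CARD('n))) \<le> (\<integral>\<^sup>+t\<in>?Q. ennreal (exp (\<phi> t)) \<partial>lebesgue)"
    using \<phi>m B ptQ by blast
qed

lemma attains_glue_nat:
  fixes x :: "nat \<Rightarrow> real \<times> real"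
  assumes \<epsilon>: "\<epsilon> > 0" and N: "N = 2 ^ CARD('n::finite)"
    and att: "\<And>j. j < N \<Longrightarrow> attains (T :: 'n itself) \<epsilon> (x j) (y j)"
    and Om: "(1 / real N) *\<^sub>R (\<Sum>j<N. x j) \<in> Omega \<epsilon>"
  shows "attains T \<epsilon> ((1 / real N) *\<^sub>R (\<Sum>j<N. x j)) ((\<Sum>j<N. y j) / real N)"
proof -
  obtain h where h: "bij_betw h (UNIV :: 'n set set) {..<N}"
    using ex_bij_betw_finite_nat[of "UNIV :: 'n set set"] by (auto simp: N atLeast0LessThan)
  have sx: "(\<Sum>S\<in>UNIV. x (h S)) = (\<Sum>j<N. x j)" and sy: "(\<Sum>S\<in>UNIV. y (h S)) = (\<Sum>j<N. y j)"
    by (rule sum.reindex_bij_betw[OF h])+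
  have "attains T \<epsilon> ((1 / 2 ^ CARD('n)) *\<^sub>R (\<Sum>S\<in>UNIV. x (h S))) ((\<Sum>S\<in>UNIV. y (h S)) / 2 ^ CARD('n))"
  proof (rule attains_glue[OF \<epsilon>])
    show "attains T \<epsilon> (x (h S)) (y (h S))" for S
      using h att[of "h S"] by (auto simp: bij_betw_def)
    show "(1 / 2 ^ CARD('n)) *\<^sub>R (\<Sum>S\<in>UNIV. x (h S)) \<in> Omega \<epsilon>"
      using Om by (simp add: sx N)
  qed
  then show ?thesis by (simp add: sx sy N)
qed

lemma sum_alternating:
  fixes a b :: "'a::real_vector"
  shows "(\<Sum>j<2 * M. if even j then a else b) = real M *\<^sub>R (a + b)"
  by (induction M) (auto simp: algebra_simps)

lemma sum_one_exception:
  fixes a b c :: "'a::real_vector"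
  assumes "d < N"
  shows "(\<Sum>j<N. if j < d then a else if j = d then b else c) = real d *\<^sub>R a + b + (real N - 1 - real d) *\<^sub>R c"
  using assms
proof (induction N)
  case (Suc N)
  show ?case
  proof (cases "d = N")
    case True
    have "(\<Sum>j<N. if j < d then a else if j = d then b else c) = (\<Sum>j<N. a)"
      using True by (intro sum.cong) auto
    then show ?thesis using True by (simp add: sum_constant_scaleR)
  next
    case False
    then show ?thesis using Suc by (simp add: algebra_simps)
  qed
qed simp

text \<open>Starting point of the inductions below: some test function exists over every point of
  \<open>Omega\<close>. It takes the values \<open>x1 + s\<close> and \<open>x1 - s\<close> on half
  of the children each, where s is the root of the variance.\<close>

lemma attains_zero:
  assumes \<epsilon>: "\<epsilon> > 0" and x: "x \<in> Omega \<epsilon>"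
  shows "attains (T :: 'n::finite itself) \<epsilon> x 0"
proof -
  define s where "s = sqrt (snd x - (fst x)\<^sup>2)"
  have s: "s\<^sup>2 = snd x - (fst x)\<^sup>2" using x by (auto simp: s_def Omega_def)
  define M :: nat where "M = 2 ^ (CARD('n) - 1)"
  have M: "2 * M = 2 ^ CARD('n)" by (simp add: M_def power_eq_if)
  have M0: "M > 0" by (simp add: M_def)
  define a where "a = fst x + s"
  define b where "b = fst x - s"
  let ?x = "\<lambda>j::nat. if even j then (a, a\<^sup>2) else (b, b\<^sup>2)"
  have "(a, a\<^sup>2) + (b, b\<^sup>2) = 2 *\<^sub>R x"
    using s by (simp add: prod_eq_iff a_def b_def power2_eq_square algebra_simps)
  then have av: "(1 / real (2 * M)) *\<^sub>R (\<Sum>j<2 * M. ?x j) = x"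
    unfolding sum_alternating using M0 by simp
  have "attains T \<epsilon> ((1 / real (2 * M)) *\<^sub>R (\<Sum>j<2 * M. ?x j)) ((\<Sum>j<2 * M. 0) / real (2 * M))"
  proof (rule attains_glue_nat[OF \<epsilon> M])
    show "attains T \<epsilon> (?x j) 0" for j
      using attains_mono[OF attains_const[OF \<epsilon>, where T = T], of 0] by simp
  qed (use x av in simp)
  then show ?thesis unfolding av by simp
qed

text \<open>A point at parameter \<open>t\<close> of the segment is split according to the leading base-\<open>N\<close> digit of
  \<open>t\<close>: all but one of the children sit at the end points, and the defect of the exceptional child
  enters with weight \<open>1/N\<close>.\<close>

lemma attains_segment:
  assumes \<epsilon>: "\<epsilon> > 0" and N: "N = 2 ^ CARD('n::finite)"
    and z: "attains (T :: 'n itself) \<epsilon> z y0" "0 \<le> y0" and p: "attains T \<epsilon> p y1" "0 \<le> y1"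
    and seg: "\<And>t. 0 \<le> t \<Longrightarrow> t \<le> 1 \<Longrightarrow> (1 - t) *\<^sub>R z + t *\<^sub>R p \<in> Omega \<epsilon>"
    and t: "0 \<le> t" "t \<le> 1"
  shows "attains T \<epsilon> ((1 - t) *\<^sub>R z + t *\<^sub>R p) ((1 - t) * y0 + t * y1 - (y0 + y1) / real N ^ j)"
  using t
proof (induction j arbitrary: t)
  case 0
  \<comment> \<open>With no digit resolved, the error \<open>y0 + y1\<close> is at least the whole
    value, so the claimed bound is at most 0.\<close>
  have "(1 - t) * y0 \<le> 1 * y0" "t * y1 \<le> 1 * y1" using 0 z p by (intro mult_right_mono; simp)+
  then have "(1 - t) * y0 + t * y1 - (y0 + y1) / real N ^ 0 \<le> 0" by simp
  then show ?case using attains_mono[OF attains_zero[OF \<epsilon> seg[OF 0]]] by blast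
next
  case (Suc j)
  have N0: "real N > 0" by (simp add: N)
  show ?case
  \<comment> \<open>For \<open>t = 1\<close> the leading digit would be N, beyond the last child;
    the point is then p itself.\<close>
  proof (cases "t = 1")
    case True
    have "y1 - (y0 + y1) / real N ^ Suc j \<le> y1" using z p by simp
    then show ?thesis using True attains_mono[OF p(1)] by simp
  next
    case False
    define d where "d = nat \<lfloor>t * real N\<rfloor>"
    define t' where "t' = t * real N - real d"
    have d: "real d = of_int \<lfloor>t * real N\<rfloor>" using Suc.prems N0 by (simp add: d_def)
    have t': "0 \<le> t'" "t' \<le> 1" unfolding t'_def d by linarith+
    have "t * real N < 1 * real N" using False Suc.prems N0 by (intro mult_strict_right_mono) auto
    then have "real d < real N" using t' by (simp add: t'_def)
    then have dN: "d < N" by simp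
    let ?v = "(1 - t') *\<^sub>R z + t' *\<^sub>R p"
    let ?w = "(1 - t') * y0 + t' * y1 - (y0 + y1) / real N ^ j"
    have tN: "t = (real d + t') / real N" using N0 by (simp add: t'_def)
    have t1: "1 - t = (real N - real d - t') / real N" using N0 by (simp add: tN field_simps)
    have av: "(1 / real N) *\<^sub>R (\<Sum>i<N. if i < d then p else if i = d then ?v else z) = (1 - t) *\<^sub>R z + t *\<^sub>R p"
      unfolding sum_one_exception[OF dN] unfolding t1 unfolding tN
      by (simp add: prod_eq_iff field_simps add_divide_distrib diff_divide_distrib)
    have "(\<Sum>i<N. if i < d then y1 else if i = d then ?w else y0)
        = real d * y1 + ?w + (real N - 1 - real d) * y0"
      using sum_one_exception[OF dN, of y1 ?w y0] by simp
    also have "\<dots> = (real N - real d - t') * y0 + (real d + t') * y1 - (y0 + y1) / real N ^ j"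
      by (simp add: algebra_simps)
    finally have S: "(\<Sum>i<N. if i < d then y1 else if i = d then ?w else y0)
        = (real N - real d - t') * y0 + (real d + t') * y1 - (y0 + y1) / real N ^ j" .
    have val: "(\<Sum>i<N. if i < d then y1 else if i = d then ?w else y0) / real N
        = (1 - t) * y0 + t * y1 - (y0 + y1) / real N ^ Suc j"
    proof -
      have "(A * y0 + B * y1 - Y / q) / n = A / n * y0 + B / n * y1 - Y / (n * q)" for A B Y q n :: real
        by (simp add: diff_divide_distrib add_divide_distrib mult.commute)
      then show ?thesis unfolding t1 unfolding tN power_Suc S .
    qed
    have "attains T \<epsilon> ((1 / real N) *\<^sub>R (\<Sum>i<N. if i < d then p else if i = d then ?v else z))
        ((\<Sum>i<N. if i < d then y1 else if i = d then ?w else y0) / real N)"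
    proof (rule attains_glue_nat[OF \<epsilon> N])
      show "attains T \<epsilon> (if i < d then p else if i = d then ?v else z)
          (if i < d then y1 else if i = d then ?w else y0)" for i
        using z(1) p(1) Suc.IH[OF t'] by simp
      show "(1 / real N) *\<^sub>R (\<Sum>i<N. if i < d then p else if i = d then ?v else z) \<in> Omega \<epsilon>"
        unfolding av by (rule seg[OF Suc.prems])
    qed
    then show ?thesis unfolding av val .
  qed
qed

text \<open>Each step puts one child on the upper boundary and the others on the lower one; the weight
  \<open>1/N\<close> makes the average land on the upper boundary again.\<close>

lemma attains_top:
  assumes \<epsilon>: "\<epsilon> > 0" and N: "N = 2 ^ CARD('n::finite)"
  defines "\<alpha> \<equiv> 1 / real N"
  defines "D \<equiv> \<epsilon> / sqrt \<alpha>"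
  shows "attains (T :: 'n itself) \<epsilon> (c, c\<^sup>2 + \<epsilon>\<^sup>2)
    (exp c * ((1 - \<alpha>) * exp (- \<alpha> * D) * (\<Sum>i<j. (\<alpha> * exp ((1 - \<alpha>) * D)) ^ i)))"
proof (induction j arbitrary: c)
  case 0
  then show ?case using attains_zero[OF \<epsilon>, of "(c, c\<^sup>2 + \<epsilon>\<^sup>2)"] by (simp add: Omega_def)
next
  case (Suc j)
  have N0: "real N > 0" by (simp add: N)
  then have \<alpha>: "\<alpha> > 0" "real N * \<alpha> = 1" "real N - 1 = real N * (1 - \<alpha>)"
    by (auto simp: \<alpha>_def algebra_simps)
  \<comment> \<open>The average has variance
    \<open>\<alpha> * \<epsilon>^2 + \<alpha> * (1 - \<alpha>) * D^2\<close>; this choice of the gap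
    makes it \<epsilon>^2 again.\<close>
  have D: "\<alpha> * D\<^sup>2 = \<epsilon>\<^sup>2" using \<alpha> by (simp add: D_def power_divide)
  define c1 where "c1 = c + (1 - \<alpha>) * D"
  define c0 where "c0 = c - \<alpha> * D"
  let ?q = "(1 - \<alpha>) * exp (- \<alpha> * D)" and ?l = "\<alpha> * exp ((1 - \<alpha>) * D)"
  let ?y1 = "exp c1 * (?q * (\<Sum>i<j. ?l ^ i))"
  have dN: "0 < N" by (simp add: N)
  have "\<alpha> * (c1\<^sup>2 + \<epsilon>\<^sup>2) + (1 - \<alpha>) * c0\<^sup>2 = c\<^sup>2 + (1 - \<alpha>) * (\<alpha> * D\<^sup>2) + \<alpha> * \<epsilon>\<^sup>2"
    by (simp add: c1_def c0_def power2_eq_square algebra_simps)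
  also have "\<dots> = c\<^sup>2 + \<epsilon>\<^sup>2" unfolding D by (simp add: algebra_simps)
  finally have e2: "\<alpha> * (c1\<^sup>2 + \<epsilon>\<^sup>2) + (1 - \<alpha>) * c0\<^sup>2 = c\<^sup>2 + \<epsilon>\<^sup>2" .
  have e1: "\<alpha> * c1 + (1 - \<alpha>) * c0 = c" by (simp add: c1_def c0_def algebra_simps)
  have inv: "1 / real N = \<alpha>" "(1 / real N) * (real N - 1) = 1 - \<alpha>" using N0 by (auto simp: \<alpha>_def field_simps)
  have av: "(1 / real N) *\<^sub>R (\<Sum>i<N. if i < 0 then 0 else if i = 0 then (c1, c1\<^sup>2 + \<epsilon>\<^sup>2) else (c0, c0\<^sup>2)) = (c, c\<^sup>2 + \<epsilon>\<^sup>2)"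
    unfolding sum_one_exception[OF dN] scaleR_add_right scaleR_scaleR
    using e1 e2 inv by simp
  have "(\<Sum>i<N. if i < 0 then 0 else if i = 0 then ?y1 else exp c0) / real N
      = (1 / real N) * ?y1 + ((1 / real N) * (real N - 1)) * exp c0"
    unfolding sum_one_exception[OF dN] by (simp add: add_divide_distrib)
  also have "\<dots> = \<alpha> * ?y1 + (1 - \<alpha>) * exp c0" unfolding inv(2) unfolding inv(1) ..
  also have "\<dots> = exp c * (?q * (\<Sum>i<Suc j. ?l ^ i))"
  proof -
    have "exp c1 = exp c * exp ((1 - \<alpha>) * D)" "exp c0 = exp c * exp (- \<alpha> * D)"
      by (simp_all add: c1_def c0_def flip: exp_add)
    moreover have "(\<Sum>i<Suc j. ?l ^ i) = 1 + ?l * (\<Sum>i<j. ?l ^ i)"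
      unfolding sum.lessThan_Suc_shift by (simp add: sum_distrib_left)
    ultimately show ?thesis by (simp only:) (simp add: algebra_simps)
  qed
  finally have val: "(\<Sum>i<N. if i < 0 then 0 else if i = 0 then ?y1 else exp c0) / real N
      = exp c * (?q * (\<Sum>i<Suc j. ?l ^ i))" .
  have "attains T \<epsilon> ((1 / real N) *\<^sub>R (\<Sum>i<N. if i < 0 then 0 else if i = 0 then (c1, c1\<^sup>2 + \<epsilon>\<^sup>2) else (c0, c0\<^sup>2)))
      ((\<Sum>i<N. if i < 0 then 0 else if i = 0 then ?y1 else exp c0) / real N)"
  proof (rule attains_glue_nat[OF \<epsilon> N])
    show "attains T \<epsilon> (if i < 0 then 0 else if i = 0 then (c1, c1\<^sup>2 + \<epsilon>\<^sup>2) else (c0, c0\<^sup>2))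
        (if i < 0 then 0 else if i = 0 then ?y1 else exp c0)" for i :: nat
      using Suc.IH[of c1] attains_const[OF \<epsilon>, where T = T and c = c0] by simp
  qed (unfold av, simp add: Omega_def)
  then show ?case unfolding av val .
qed

section \<open>The dyadic Bellman function\<close>

lemma eps0_d_eq:
  assumes "n \<ge> 1"
  shows "eps0_d n = sqrt (1 / 2 ^ n) / (1 - 1 / 2 ^ n) * ln (1 / (1 / 2 ^ n))"
proof -
  define s where "s = sqrt (2 ^ n)"
  have s: "s > 0" "2 ^ n = s * s" by (auto simp: s_def)
  have "2 powr (real n / 2) = s"
    by (simp add: s_def powr_half_sqrt[symmetric] powr_powr flip: powr_realpow)
  moreover have "s * s > 1" using assms unfolding s(2)[symmetric] by simp
  moreover have "sqrt (1 / 2 ^ n) = 1 / s" by (simp add: s_def real_sqrt_divide)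
  moreover have "ln (1 / (1 / 2 ^ n)) = real n * ln 2" by (simp add: ln_realpow)
  ultimately show ?thesis unfolding eps0_d_def using s by (simp add: field_simps)
qed

lemma attains_le_bellman:
  assumes att: "attains (TYPE('n::finite)) \<epsilon> x y" and y: "0 \<le> y" and Q: "dyadic_cube (Q :: (real ^ 'n) set)"
  shows "ereal y \<le> bellman Q \<epsilon> x"
proof -
  obtain m and k :: "'n \<Rightarrow> int" where Qk: "Q = dcube m k" using Q by (auto simp: dyadic_cube_iff)
  obtain \<phi> where \<phi>: "\<phi> \<in> BMO_d Q \<epsilon>" "pt Q \<phi> = x"
    "ennreal (measure lebesgue Q * y) \<le> (\<integral>\<^sup>+t\<in>Q. ennreal (exp (\<phi> t)) \<partial>lebesgue)"
    using att unfolding attains_def Qk by blast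
  have mu: "measure lebesgue Q > 0" unfolding Qk by (rule measure_dcube_pos)
  have "ennreal y = ennreal (measure lebesgue Q * y) / ennreal (measure lebesgue Q)"
    using mu y by (subst divide_ennreal) auto
  also have "\<dots> \<le> nn_avg Q (\<lambda>t. exp (\<phi> t))"
    unfolding nn_avg_def Qk emeasure_dcube_measure using \<phi>(3) unfolding Qk by (rule divide_right_mono_ennreal)
  finally have "enn2ereal (ennreal y) \<le> enn2ereal (nn_avg Q (\<lambda>t. exp (\<phi> t)))"
    by (simp add: less_eq_ennreal.rep_eq)
  also have "\<dots> \<le> bellman Q \<epsilon> x"
    unfolding bellman_def using \<phi>(1,2) by (intro Sup_upper) (auto simp: pt_def)
  finally show ?thesis using y by simp
qed

lemma bellman_leI:
  fixes Q :: "(real ^ 'n) set"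
  assumes \<epsilon>: "\<epsilon> > 0" and Qk: "Q = dcube m k" and b: "b \<ge> 0"
    and le: "\<And>\<phi>. \<phi> \<in> borel_measurable lebesgue \<Longrightarrow> \<phi> \<in> BMO_d Q \<epsilon> \<Longrightarrow> pt Q \<phi> = x \<Longrightarrow>
      (\<integral>\<^sup>+t\<in>Q. ennreal (exp (\<phi> t)) \<partial>lebesgue) \<le> ennreal (measure lebesgue Q * b)"
  shows "bellman Q \<epsilon> x \<le> ereal b"
  unfolding bellman_def
proof (rule Sup_least)
  fix v assume "v \<in> {enn2ereal (nn_avg Q (\<lambda>t. exp (\<phi> t))) |\<phi>.
     \<phi> \<in> BMO_d Q \<epsilon> \<and> avg Q \<phi> = fst x \<and> avg Q (\<lambda>t. (\<phi> t)\<^sup>2) = snd x}"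
  then obtain \<phi> where v: "v = enn2ereal (nn_avg Q (\<lambda>t. exp (\<phi> t)))"
    and B: "\<phi> \<in> BMO_d Q \<epsilon>" and p: "pt Q \<phi> = x"
    by (auto simp: pt_def)
  \<comment> \<open>Membership in \<open>BMO_d\<close> restricts \<phi> only on Q. Cutting it off
    outside makes it measurable on the whole space without changing any average over a
    subcube.\<close>
  define \<psi> where "\<psi> = (\<lambda>t. indicator Q t *\<^sub>R \<phi> t)"
  have eq: "\<psi> t = \<phi> t" if "t \<in> Q" for t using that by (simp add: \<psi>_def)
  have m: "\<psi> \<in> borel_measurable lebesgue"
    using B unfolding BMO_d_def set_integrable_def \<psi>_def by auto
  have "nn_avg Q (\<lambda>t. exp (\<phi> t)) = nn_avg Q (\<lambda>t. exp (\<psi> t))"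
    by (rule nn_avg_cong) (simp add: eq)
  also have "\<dots> \<le> ennreal (measure lebesgue Q * b) / ennreal (measure lebesgue Q)"
    using le[OF m iffD2[OF BMO_d_cong[OF eq] B]] p pt_cong[of Q \<psi> \<phi>, OF eq]
    unfolding nn_avg_def Qk emeasure_dcube_measure by (intro divide_right_mono_ennreal) simp
  also have "\<dots> = ennreal b"
  proof -
    have "measure lebesgue Q > 0" unfolding Qk by (rule measure_dcube_pos)
    then show ?thesis using b by (subst divide_ennreal) auto
  qed
  finally have "enn2ereal (nn_avg Q (\<lambda>t. exp (\<phi> t))) \<le> enn2ereal (ennreal b)"
    by (simp add: less_eq_ennreal.rep_eq)
  then show "v \<le> ereal b" using b by (simp add: v)
qed

section \<open>Matching bounds below the critical \<epsilon>\<close>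

context bellman_data
begin

text \<open>The factor normalises the candidate to \<open>exp x1\<close> on the lower boundary,
  where \<open>rad x = \<delta>\<close>.\<close>

definition cand :: "real \<times> real \<Rightarrow> real" where
  "cand x = exp (- \<delta>) / (1 - \<delta>) * BB x"

lemma cand_ge_exp:
  assumes "x \<in> Omega \<epsilon>"
  shows "exp (fst x) \<le> cand x"
proof -
  have "exp \<delta> * (1 - \<delta>) \<le> exp (rad x) * (1 - rad x)"
    using rad_bounds[OF assms] r0_pos by (intro exp_one_minus_antimono) auto
  then have "exp (fst x) * (exp (- \<delta>) / (1 - \<delta>)) * (exp \<delta> * (1 - \<delta>))
      \<le> exp (fst x) * (exp (- \<delta>) / (1 - \<delta>)) * (exp (rad x) * (1 - rad x))"
    using \<delta> by (intro mult_left_mono) auto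
  also have "\<dots> = cand x" by (simp add: cand_def BB_def exp_add)
  finally show ?thesis using \<delta> by (simp add: exp_minus)
qed

lemma bellman_le_cand:
  fixes Q :: "(real ^ 'n) set"
  assumes \<alpha>n: "\<alpha> = 1 / 2 ^ CARD('n)" and Qk: "Q = dcube m k" and x: "x \<in> Omega \<epsilon>"
  shows "bellman Q \<epsilon> x \<le> ereal (cand x)"
proof (rule bellman_leI[OF \<epsilon>(1) Qk])
  show "0 \<le> cand x" using cand_ge_exp[OF x] by (smt (verit) exp_gt_zero)
  fix \<phi> assume m: "\<phi> \<in> borel_measurable lebesgue" and B: "\<phi> \<in> BMO_d Q \<epsilon>" and p: "pt Q \<phi> = x"
  note C = iffD1[OF BMO_d_iff[OF m \<epsilon>(1)] B[unfolded Qk]]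
  have "(\<integral>\<^sup>+t\<in>dcube m k. ennreal (exp (level_avg (m + int j) \<phi> t)) \<partial>lebesgue)
    \<le> ennreal (measure lebesgue (dcube m k) * cand (pt (dcube m k) \<phi>))" for j
  proof (rule bellman_induction[OF cand_ge_exp])
    fix y :: "'n set \<Rightarrow> real \<times> real"
    assume y: "\<And>S. y S \<in> Omega \<epsilon>" "(1 / 2 ^ CARD('n)) *\<^sub>R (\<Sum>S\<in>UNIV. y S) \<in> Omega \<epsilon>"
    have "(\<Sum>S\<in>UNIV. BB (y S)) \<le> 2 ^ CARD('n) * BB ((1 / 2 ^ CARD('n)) *\<^sub>R (\<Sum>S\<in>UNIV. y S))"
      using BB_multi_point[of "UNIV :: 'n set set" y] y by (simp add: \<alpha>n)
    then have "exp (- \<delta>) / (1 - \<delta>) * (\<Sum>S\<in>UNIV. BB (y S))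
        \<le> exp (- \<delta>) / (1 - \<delta>) * (2 ^ CARD('n) * BB ((1 / 2 ^ CARD('n)) *\<^sub>R (\<Sum>S\<in>UNIV. y S)))"
      using \<delta> by (intro mult_left_mono) auto
    then show "(\<Sum>S\<in>UNIV. cand (y S)) \<le> 2 ^ CARD('n) * cand ((1 / 2 ^ CARD('n)) *\<^sub>R (\<Sum>S\<in>UNIV. y S))"
      unfolding cand_def sum_distrib_left[symmetric] by (simp only: mult.left_commute)
  qed (use C in simp_all)
  then have "(\<integral>\<^sup>+t\<in>dcube m k. ennreal (exp (\<phi> t)) \<partial>lebesgue)
      \<le> ennreal (measure lebesgue (dcube m k) * cand (pt (dcube m k) \<phi>))"
    by (rule exp_integral_le_limit[OF conjunct1[OF C] m])
  then show "(\<integral>\<^sup>+t\<in>Q. ennreal (exp (\<phi> t)) \<partial>lebesgue) \<le> ennreal (measure lebesgue Q * cand x)"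
    using p unfolding Qk by simp
qed

lemma cand_le_bellman:
  fixes Q :: "(real ^ 'n) set"
  assumes \<alpha>n: "\<alpha> = 1 / 2 ^ CARD('n)" and Q: "dyadic_cube Q" and x: "x \<in> Omega \<epsilon>"
  shows "ereal (cand x) \<le> bellman Q \<epsilon> x"
proof -
  define N :: nat where "N = 2 ^ CARD('n)"
  have \<alpha>N: "\<alpha> = 1 / real N" by (simp add: \<alpha>n N_def)
  define D where "D = \<epsilon> / sqrt \<alpha>"
  define l where "l = \<alpha> * exp ((1 - \<alpha>) * D)"
  define q where "q = (1 - \<alpha>) * exp (- \<alpha> * D)"
  define G where "G = (\<lambda>j. q * (\<Sum>i<j. l ^ i))"
  have l0: "l \<ge> 0" using \<alpha> by (simp add: l_def)
  have q0: "q > 0" using \<alpha> by (simp add: q_def)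
  \<comment> \<open>\<open>K\<close> rearranged: it shows that the ratio l of the series is below 1
    and that its sum \<open>q / (1 - l)\<close> is the candidate at
    \<open>(0, \<epsilon>^2)\<close>.\<close>
  have Keq: "exp r0 * (1 - r0) * (1 - l) = q * (exp \<delta> * (1 - \<delta>))"
    using K unfolding D_def[symmetric] exp_add l_def q_def by (simp add: algebra_simps)
  have r01: "0 < 1 - r0" using r0_less \<delta> by simp
  have "0 < q * (exp \<delta> * (1 - \<delta>))" using q0 \<delta> by simp
  then have "0 < exp r0 * (1 - r0) * (1 - l)" unfolding Keq .
  moreover have "0 < exp r0 * (1 - r0)" using r01 by simp
  ultimately have l1: "l < 1" using zero_less_mult_pos by force
  have ql: "q / (1 - l) = exp r0 * (1 - r0) / (exp \<delta> * (1 - \<delta>))"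
    using Keq l1 \<delta> by (simp add: field_simps)
  have G_lim: "G \<longlonglongrightarrow> q * (1 / (1 - l))"
    using geometric_sums[of l] l0 l1 unfolding G_def sums_def by (intro tendsto_intros) auto
  define r where "r = rad x"
  \<comment> \<open>Along the extremal tangent, \<open>x1 + rad x\<close> is constantly u and the
    candidate is a constant multiple of \<open>1 - rad x\<close>, hence affine. Its ends z and p lie
    on the lower and upper boundary, with \<open>rad\<close> equal to \<delta> and
    \<open>r0\<close>, and x sits at parameter t.\<close>
  define u where "u = fst x + r"
  define t where "t = (\<delta> - r) / (\<delta> - r0)"
  have r: "r0 \<le> r" "r \<le> \<delta>" "r\<^sup>2 = \<delta>\<^sup>2 - snd x + (fst x)\<^sup>2"
    using rad_bounds[OF x] rad_sq[OF x] by (auto simp: r_def)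
  have t: "0 \<le> t" "t \<le> 1" using r r0_less by (auto simp: t_def)
  have tr: "t * (\<delta> - r0) = \<delta> - r" using r0_less by (simp add: t_def)
  define z where "z = (u - \<delta>, (u - \<delta>)\<^sup>2)"
  define p where "p = (u - r0, (u - r0)\<^sup>2 + \<epsilon>\<^sup>2)"
  have line: "(1 - s) *\<^sub>R z + s *\<^sub>R p = (u - \<rho>, (u - \<rho>)\<^sup>2 + (\<delta>\<^sup>2 - \<rho>\<^sup>2))"
    if "\<rho> = \<delta> - s * (\<delta> - r0)" for s \<rho>
  proof -
    have e: "(u - r0)\<^sup>2 + \<epsilon>\<^sup>2 = u\<^sup>2 - 2 * u * r0 + \<delta>\<^sup>2" using r0_sq by (simp add: power2_eq_square algebra_simps)
    show ?thesis unfolding that z_def p_def e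
      by (simp add: power2_eq_square algebra_simps)
  qed
  have seg: "(1 - s) *\<^sub>R z + s *\<^sub>R p \<in> Omega \<epsilon>" if s: "0 \<le> s" "s \<le> 1" for s
  proof -
    define \<rho> where "\<rho> = \<delta> - s * (\<delta> - r0)"
    have "s * (\<delta> - r0) \<le> 1 * (\<delta> - r0)" "0 \<le> s * (\<delta> - r0)"
      using s r0_less by (auto intro!: mult_right_mono mult_nonneg_nonneg simp del: mult_1)
    then have "r0 \<le> \<rho>" "\<rho> \<le> \<delta>" by (auto simp: \<rho>_def)
    then have "r0\<^sup>2 \<le> \<rho>\<^sup>2" "\<rho>\<^sup>2 \<le> \<delta>\<^sup>2" using r0_pos by (auto intro!: power_mono)
    then show ?thesis unfolding line[OF \<rho>_def] using r0_sq by (simp add: Omega_def)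
  qed
  have xt: "(1 - t) *\<^sub>R z + t *\<^sub>R p = x"
    using line[of r t] tr r(3) by (simp add: prod_eq_iff u_def)
  \<comment> \<open>One index serves both as the number of terms of the series and as the number of
    digits of t; the error vanishes because \<open>G\<close> converges.\<close>
  define f where "f = (\<lambda>j. (1 - t) * exp (u - \<delta>) + t * (exp (u - r0) * G j)
      - (exp (u - \<delta>) + exp (u - r0) * G j) / real N ^ j)"
  have G0: "G j \<ge> 0" for j using q0 l0 by (auto simp: G_def intro!: mult_nonneg_nonneg sum_nonneg)
  have att: "attains (TYPE('n)) \<epsilon> x (f j)" for j
    unfolding f_def xt[symmetric]
  proof (rule attains_segment[OF \<epsilon>(1) N_def])
    show "attains (TYPE('n)) \<epsilon> z (exp (u - \<delta>))" unfolding z_def by (rule attains_const[OF \<epsilon>(1)])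
    show "attains (TYPE('n)) \<epsilon> p (exp (u - r0) * G j)"
      unfolding p_def G_def q_def l_def D_def \<alpha>N by (rule attains_top[OF \<epsilon>(1) N_def])
  qed (use G0 seg t in auto)
  have "norm (1 / real N) < 1" using \<alpha> by (simp flip: \<alpha>N)
  then have "(\<lambda>j. (1 - t) * exp (u - \<delta>) + t * (exp (u - r0) * G j)
      - (exp (u - \<delta>) + exp (u - r0) * G j) * (1 / real N) ^ j)
    \<longlonglongrightarrow> (1 - t) * exp (u - \<delta>) + t * (exp (u - r0) * (q * (1 / (1 - l))))
      - (exp (u - \<delta>) + exp (u - r0) * (q * (1 / (1 - l)))) * 0"
    by (intro tendsto_intros G_lim LIMSEQ_power_zero)
  moreover have "(1 - t) * exp (u - \<delta>) + t * (exp (u - r0) * (q * (1 / (1 - l)))) = cand x"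
  proof -
    define X where "X = exp u * (exp (- \<delta>) / (1 - \<delta>))"
    have e1: "exp (u - r0) * (q / (1 - l)) = X * (1 - r0)"
      unfolding ql X_def using \<delta> by (simp add: exp_diff exp_minus divide_simps)
    have e2: "exp (u - \<delta>) = X * (1 - \<delta>)"
      unfolding X_def using \<delta> by (simp add: exp_diff exp_minus field_simps)
    have "(1 - t) * exp (u - \<delta>) + t * (exp (u - r0) * (q / (1 - l)))
        = X * ((1 - t) * (1 - \<delta>) + t * (1 - r0))"
      unfolding e1 e2 by (simp add: algebra_simps)
    also have "(1 - t) * (1 - \<delta>) + t * (1 - r0) = 1 - r" using tr by (simp add: algebra_simps)
    finally show ?thesis by (simp add: X_def cand_def BB_def u_def r_def)
  qed
  ultimately have "f \<longlonglongrightarrow> cand x" by (simp add: f_def power_one_over)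
  then have lim: "(\<lambda>j. ereal (f j)) \<longlonglongrightarrow> ereal (cand x)" by simp
  have "0 < cand x" using cand_ge_exp[OF x] by (smt (verit) exp_gt_zero)
  then have "\<forall>\<^sub>F j in sequentially. 0 < f j" using \<open>f \<longlonglongrightarrow> cand x\<close> by (rule order_tendstoD(1)[rotated])
  then have "\<forall>\<^sub>F j in sequentially. ereal (f j) \<le> bellman Q \<epsilon> x"
    by eventually_elim (intro attains_le_bellman[OF att _ Q], simp)
  then show ?thesis by (rule tendsto_upperbound[OF lim _ sequentially_bot])
qed

end

section \<open>The critical and supercritical case, and the lower boundary\<close>

lemma bellman_infinite:
  fixes Q :: "(real ^ 'n) set"
  assumes \<epsilon>: "\<epsilon> > 0" "\<epsilon> \<ge> eps0_d CARD('n)" and Q: "dyadic_cube Q"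
    and x: "x \<in> Omega \<epsilon>" "x \<notin> Gamma0"
  shows "bellman Q \<epsilon> x = \<infinity>"
proof -
  define N :: nat where "N = 2 ^ CARD('n)"
  define \<alpha> where "\<alpha> = 1 / real N"
  have N2: "real N \<ge> 2" using power_increasing[of 1 "CARD('n)" "2::real"] by (simp add: N_def)
  have \<alpha>: "0 < \<alpha>" "\<alpha> \<le> 1 / 2" using N2 by (auto simp: \<alpha>_def field_simps)
  have \<alpha>n: "\<alpha> = 1 / 2 ^ CARD('n)" by (simp add: \<alpha>_def N_def)
  define D where "D = \<epsilon> / sqrt \<alpha>"
  define l where "l = \<alpha> * exp ((1 - \<alpha>) * D)"
  define q where "q = (1 - \<alpha>) * exp (- \<alpha> * D)"
  have q0: "q > 0" using \<alpha> by (simp add: q_def)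
  have l1: "l \<ge> 1"
  proof -
    have s: "sqrt \<alpha> > 0" "1 - \<alpha> > 0" using \<alpha> by auto
    have "eps0_d CARD('n) = sqrt \<alpha> / (1 - \<alpha>) * - ln \<alpha>"
      using \<alpha> eps0_d_eq[of "CARD('n)"] unfolding \<alpha>n[symmetric] by (simp add: ln_div Suc_le_eq)
    then have "sqrt \<alpha> / (1 - \<alpha>) * - ln \<alpha> \<le> \<epsilon>" using \<epsilon> by simp
    then have "- ln \<alpha> \<le> (1 - \<alpha>) * D" using s by (simp add: D_def field_simps)
    then have "exp (- ln \<alpha>) \<le> exp ((1 - \<alpha>) * D)" by simp
    then show ?thesis using \<alpha> by (simp add: l_def exp_minus field_simps)
  qed
  define G where "G = (\<lambda>j. q * (\<Sum>i<j. l ^ i))"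
  have G_ge: "G j \<ge> q * real j" for j
  proof -
    have "(\<Sum>i<j. (1::real)) \<le> (\<Sum>i<j. l ^ i)" using l1 by (intro sum_mono one_le_power)
    then show ?thesis using q0 by (simp add: G_def)
  qed
  have G0: "G j \<ge> 0" for j using G_ge[of j] q0 by (smt (verit) mult_nonneg_nonneg of_nat_0_le_iff)
  define c where "c = fst x"
  define v where "v = snd x - c\<^sup>2"
  have v: "0 < v" "v \<le> \<epsilon>\<^sup>2" using x by (auto simp: v_def c_def Omega_def Gamma0_def)
  define t where "t = v / \<epsilon>\<^sup>2"
  have e2: "\<epsilon>\<^sup>2 > 0" using \<epsilon> by simp
  have t: "0 < t" "t \<le> 1" using v e2 by (auto simp: t_def)
  define z where "z = (c, c\<^sup>2)"
  define p where "p = (c, c\<^sup>2 + \<epsilon>\<^sup>2)"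
  have line: "(1 - s) *\<^sub>R z + s *\<^sub>R p = (c, c\<^sup>2 + s * \<epsilon>\<^sup>2)" for s
    by (simp add: z_def p_def algebra_simps)
  have seg: "(1 - s) *\<^sub>R z + s *\<^sub>R p \<in> Omega \<epsilon>" if "0 \<le> s" "s \<le> 1" for s
    unfolding line using that mult_right_mono[of s 1 "\<epsilon>\<^sup>2"] by (simp add: Omega_def)
  have xt: "(1 - t) *\<^sub>R z + t *\<^sub>R p = x"
    unfolding line using e2 by (simp add: prod_eq_iff t_def v_def c_def)
  \<comment> \<open>Here \<open>G\<close> is unbounded, so the number of digits is fixed first. The
    relative error stays below \<open>t / 2\<close>, and half of the growing term
    \<open>t * G j\<close> survives as j increases.\<close>
  obtain j0 where j0: "(1 / real N) ^ j0 < t / 2"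
    using real_arch_pow_inv[of "t / 2" "1 / real N"] t N2 by auto
  have att: "attains (TYPE('n)) \<epsilon> x (exp c * (t / 2 * G j - 1))" for j
  proof (rule attains_mono)
    show "attains (TYPE('n)) \<epsilon> x ((1 - t) * exp c + t * (exp c * G j) - (exp c + exp c * G j) / real N ^ j0)"
      unfolding xt[symmetric]
    proof (rule attains_segment[OF \<epsilon>(1) N_def])
      show "attains (TYPE('n)) \<epsilon> z (exp c)" unfolding z_def by (rule attains_const[OF \<epsilon>(1)])
      show "attains (TYPE('n)) \<epsilon> p (exp c * G j)"
        unfolding p_def G_def q_def l_def D_def \<alpha>_def by (rule attains_top[OF \<epsilon>(1) N_def])
    qed (use G0 seg t in auto)
    define w where "w = (1 / real N) ^ j0"
    have w: "w < t / 2" "0 \<le> w" using j0 by (auto simp: w_def)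
    have "w * (1 + G j) \<le> t / 2 * (1 + G j)" using w G0[of j] by (intro mult_right_mono) auto
    then have "t / 2 * G j - 1 \<le> (1 - t) + t * G j - w * (1 + G j)"
      using t by (simp add: algebra_simps)
    then have "exp c * (t / 2 * G j - 1) \<le> exp c * ((1 - t) + t * G j - w * (1 + G j))"
      by (intro mult_left_mono) auto
    also have "\<dots> = (1 - t) * exp c + t * (exp c * G j) - (exp c + exp c * G j) * w"
      by (simp add: algebra_simps)
    finally show "exp c * (t / 2 * G j - 1) \<le> (1 - t) * exp c + t * (exp c * G j) - (exp c + exp c * G j) / real N ^ j0"
      by (simp add: w_def power_one_over)
  qed
  show ?thesis
  proof (rule ereal_top)
    fix B :: real
    obtain j where j: "(\<bar>B\<bar> / exp c + 1) / (t / 2 * q) \<le> real j" using real_arch_simple by blast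
    have tq: "t / 2 * q > 0" using t q0 by simp
    have "\<bar>B\<bar> / exp c + 1 \<le> t / 2 * q * real j" using j tq by (simp add: pos_divide_le_eq mult.commute)
    also have "\<dots> \<le> t / 2 * G j" using G_ge[of j] t by (simp add: mult.assoc)
    finally have "\<bar>B\<bar> \<le> exp c * (t / 2 * G j - 1)" by (simp add: field_simps)
    then have "ereal B \<le> ereal (exp c * (t / 2 * G j - 1))" "0 \<le> exp c * (t / 2 * G j - 1)" by auto
    then show "ereal B \<le> bellman Q \<epsilon> x" using attains_le_bellman[OF att _ Q] by (meson order_trans)
  qed
qed

text \<open>Over the lower boundary the variance on Q is 0, so every admissible function equals c
  almost everywhere, whatever \<epsilon> is.\<close>

lemma bellman_Gamma0:
  fixes Q :: "(real ^ 'n) set"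
  assumes \<epsilon>: "\<epsilon> > 0" and Q: "dyadic_cube Q" and x: "x \<in> Gamma0"
  shows "bellman Q \<epsilon> x = ereal (exp (fst x))"
proof (rule antisym)
  obtain m k where Qk: "Q = dcube m k" using Q by (auto simp: dyadic_cube_iff)
  obtain c where xc: "x = (c, c\<^sup>2)" using x by (auto simp: Gamma0_def)
  show "ereal (exp (fst x)) \<le> bellman Q \<epsilon> x"
    unfolding xc using attains_const[OF \<epsilon>, where T = "TYPE('n)"] by (intro attains_le_bellman[OF _ _ Q]) auto
  show "bellman Q \<epsilon> x \<le> ereal (exp (fst x))"
  proof (rule bellman_leI[OF \<epsilon> Qk])
    fix \<phi> assume m [measurable]: "\<phi> \<in> borel_measurable lebesgue" and B: "\<phi> \<in> BMO_d Q \<epsilon>" and p: "pt Q \<phi> = x"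
    note C = iffD1[OF BMO_d_iff[OF m \<epsilon>] B[unfolded Qk]]
    note V = variance_integral[OF conjunct1[OF C] conjunct1[OF conjunct2[OF C]]]
    have a: "avg (dcube m k) \<phi> = c" "avg (dcube m k) (\<lambda>t. (\<phi> t)\<^sup>2) = c\<^sup>2"
      using p by (simp_all add: pt_def Qk xc)
    have "(LINT t:dcube m k|lebesgue. (\<phi> t - c)\<^sup>2) = 0" using V(2) unfolding a by simp
    then have "AE t in lebesgue. indicator (dcube m k) t *\<^sub>R (\<phi> t - c)\<^sup>2 = 0"
      using V(1) unfolding a set_lebesgue_integral_def set_integrable_def
      by (subst (asm) integral_nonneg_eq_0_iff_AE) auto
    then have "(\<integral>\<^sup>+t\<in>dcube m k. ennreal (exp (\<phi> t)) \<partial>lebesgue) = (\<integral>\<^sup>+t\<in>dcube m k. ennreal (exp c) \<partial>lebesgue)"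
      by (intro nn_integral_cong_AE) (auto elim!: eventually_mono simp: indicator_def split: if_splits)
    also have "\<dots> = ennreal (measure lebesgue (dcube m k) * exp c)"
      by (rule set_nn_integral_const_dcube) simp
    finally show "(\<integral>\<^sup>+t\<in>Q. ennreal (exp (\<phi> t)) \<partial>lebesgue) \<le> ennreal (measure lebesgue Q * exp (fst x))"
      by (simp only: Qk xc fst_conv)
  qed simp
qed

theorem theorem3p4:
  fixes Q :: "(real ^ 'n) set" and \<epsilon> :: real
  assumes "dyadic_cube Q" and "\<epsilon> > 0"
  shows "(\<epsilon> < eps0_d CARD('n) \<longrightarrow>
            (\<forall>x\<in>Omega \<epsilon>. bellman Q \<epsilon> x = ereal (B_fun (1 / 2 ^ CARD('n)) \<epsilon> x))) \<and>
         (\<epsilon> \<ge> eps0_d CARD('n) \<longrightarrow>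
            (\<forall>x\<in>Omega \<epsilon>. bellman Q \<epsilon> x = (if x \<in> Gamma0 then ereal (exp (fst x)) else \<infinity>)))"
proof (intro conjI impI ballI)
  fix x assume le: "\<epsilon> \<ge> eps0_d CARD('n)" and x: "x \<in> Omega \<epsilon>"
  show "bellman Q \<epsilon> x = (if x \<in> Gamma0 then ereal (exp (fst x)) else \<infinity>)"
    using bellman_Gamma0[OF assms(2,1)] bellman_infinite[OF assms(2) le assms(1) x] by simp
next
  fix x assume less: "\<epsilon> < eps0_d CARD('n)" and x: "x \<in> Omega \<epsilon>"
  define \<alpha> :: real where "\<alpha> = 1 / 2 ^ CARD('n)"
  have "(2::real) \<le> 2 ^ CARD('n)" using power_increasing[of 1 "CARD('n)" "2::real"] by (simp add: Suc_le_eq)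
  then have \<alpha>: "0 < \<alpha>" "\<alpha> \<le> 1 / 2" by (auto simp: \<alpha>_def field_simps)
  have "\<epsilon> < sqrt \<alpha> / (1 - \<alpha>) * ln (1 / \<alpha>)"
    using less eps0_d_eq[of "CARD('n)"] unfolding \<alpha>_def by (simp add: Suc_le_eq)
  then interpret bellman_data \<alpha> \<epsilon> "delta \<alpha> \<epsilon>" "sqrt ((delta \<alpha> \<epsilon>)\<^sup>2 - \<epsilon>\<^sup>2)"
    by (rule delta_bellman_data[OF \<alpha> assms(2)])
  obtain m k where Qk: "Q = dcube m k" using assms(1) by (auto simp: dyadic_cube_iff)
  have "B_fun \<alpha> \<epsilon> x = cand x"
    by (simp add: B_fun_def cand_def BB_def rad_def Let_def)
  then show "bellman Q \<epsilon> x = ereal (B_fun (1 / 2 ^ CARD('n)) \<epsilon> x)"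
    using bellman_le_cand[OF \<alpha>_def Qk x] cand_le_bellman[OF \<alpha>_def assms(1) x]
    unfolding \<alpha>_def by (metis antisym)
qed

end
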